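(* Let $n\ge 2$, let $\Omega\subset\mathbb{R}^n$ be a bounded Lipschitz domain, $1<p<q<\infty$, $\varkappa>0$, and let $a:\Omega\to[0,\infty)$ satisfy $a\in\mathcal{Z}^\varkappa(\Omega)$. Let $\mathcal{F}[u]=\int_\Omega|\nabla u(x)|^p+a(x)|\nabla u(x)|^q\,dx$ and $W(\Omega)=\{\varphi\in W^{1,1}_0(\Omega):\int_\Omega|\nabla\varphi|^p+a(x)|\nabla\varphi|^q\,dx<\infty\}$. Let $u_0\in W^{1,1}(\Omega)$ satisfy $\mathcal{F}[u_0]<\infty$. Then the following hold. (i) If $\varkappa\ge q-p$, then $$\inf_{v\in u_0+W(\Omega)}\mathcal{F}[v]=\inf_{w\in u_0+C_c^\infty(\Omega)}\mathcal{F}[w].$$ (ii) Let $\gamma\in(0,1]$. If $\varkappa\ge(q-p)(1-\gamma)$, then $$\inf_{v\in u_0+W(\Omega)\cap C^{0,\gamma}(\Omega)}\mathcal{F}[v]=\inf_{w\in u_0+C_c^\infty(\Omega)}\mathcal{F}[w].$$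
   Context: For $\varkappa\in(0,\infty)$, the class $\mathcal{Z}^\varkappa(\Omega)$ consists of all (Lebesgue measurable) functions $a:\Omega\to[0,\infty)$ for which there is a constant $C>0$ such that $a(x)\le C\,(a(y)+|x-y|^\varkappa)$ for all $x,y\in\Omega$. $C^{0,\gamma}(\Omega)$ is the space of functions $f$ on $\Omega$ with $\sup_{x\ne y\in\Omega}|f(x)-f(y)|/|x-y|^\gamma<\infty$. The set $u_0+W(\Omega)\cap C^{0,\gamma}(\Omega)$ means $\{u_0+\varphi:\varphi\in W(\Omega)\cap C^{0,\gamma}(\Omega)\}$. *)

theory Defs
  imports "HOL-Analysis.Analysis"
begin

primrec Ck :: "nat \<Rightarrow> ('a::euclidean_space \<Rightarrow> real) \<Rightarrow> bool" where
  "Ck 0 f \<longleftrightarrow> continuous_on UNIV f"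
| "Ck (Suc k) f \<longleftrightarrow> (\<forall>x. f differentiable (at x)) \<and>
     (\<forall>b\<in>Basis. Ck k (\<lambda>x. frechet_derivative f (at x) b))"

definition smooth :: "('a::euclidean_space \<Rightarrow> real) \<Rightarrow> bool" where
  "smooth f \<longleftrightarrow> (\<forall>k. Ck k f)"

text \<open>
  Functions on an open set \<open>\<Omega>\<close> are represented by total functions whose values outside
  \<open>\<Omega>\<close> are irrelevant; the only exception is the space of test functions, whose
  elements are extended by zero.
\<close>

definition test_functions :: "'a::euclidean_space set \<Rightarrow> ('a \<Rightarrow> real) set" where
  "test_functions \<Omega> =
     {\<phi>. smooth \<phi> \<and> compact (closure {x. \<phi> x \<noteq> 0}) \<and> closure {x. \<phi> x \<noteq> 0} \<subseteq> \<Omega>}"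

definition locally_integrable_on ::
    "('a::euclidean_space \<Rightarrow> 'b::euclidean_space) \<Rightarrow> 'a set \<Rightarrow> bool"  (infixr "locally'_integrable'_on" 46)
  where "f locally_integrable_on \<Omega> \<longleftrightarrow>
     (\<forall>K. compact K \<and> K \<subseteq> \<Omega> \<longrightarrow> f absolutely_integrable_on K)"

definition has_weak_gradient ::
    "'a::euclidean_space set \<Rightarrow> ('a \<Rightarrow> real) \<Rightarrow> ('a \<Rightarrow> 'a) \<Rightarrow> bool" where
  "has_weak_gradient \<Omega> u g \<longleftrightarrow>
     u locally_integrable_on \<Omega> \<and> g locally_integrable_on \<Omega> \<and>
     (\<forall>\<phi>\<in>test_functions \<Omega>. \<forall>b\<in>Basis.
        (LINT x:\<Omega>|lebesgue. u x * frechet_derivative \<phi> (at x) b) =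
        - (LINT x:\<Omega>|lebesgue. (g x \<bullet> b) * \<phi> x))"

text \<open>
  A weak gradient is determined only up to a null subset of \<open>\<Omega>\<close>; everything below is
  insensitive to the choice of representative.
\<close>

definition weak_gradient :: "'a::euclidean_space set \<Rightarrow> ('a \<Rightarrow> real) \<Rightarrow> 'a \<Rightarrow> 'a" where
  "weak_gradient \<Omega> u = (SOME g. has_weak_gradient \<Omega> u g)"

definition W11 :: "'a::euclidean_space set \<Rightarrow> ('a \<Rightarrow> real) set" where
  "W11 \<Omega> = {u. u absolutely_integrable_on \<Omega> \<and>
     (\<exists>g. has_weak_gradient \<Omega> u g \<and> g absolutely_integrable_on \<Omega>)}"

definition W11_norm :: "'a::euclidean_space set \<Rightarrow> ('a \<Rightarrow> real) \<Rightarrow> real" where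
  "W11_norm \<Omega> u =
     (LINT x:\<Omega>|lebesgue. \<bar>u x\<bar>) + (LINT x:\<Omega>|lebesgue. norm (weak_gradient \<Omega> u x))"

definition W11_0 :: "'a::euclidean_space set \<Rightarrow> ('a \<Rightarrow> real) set" where
  "W11_0 \<Omega> = {u \<in> W11 \<Omega>. \<exists>\<psi>::nat \<Rightarrow> 'a \<Rightarrow> real.
     (\<forall>k. \<psi> k \<in> test_functions \<Omega>) \<and>
     (\<lambda>k. W11_norm \<Omega> (\<lambda>x. \<psi> k x - u x)) \<longlonglongrightarrow> 0}"

definition energy ::
    "real \<Rightarrow> real \<Rightarrow> ('a::euclidean_space \<Rightarrow> real) \<Rightarrow> 'a set \<Rightarrow> ('a \<Rightarrow> real) \<Rightarrow> ennreal" where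
  "energy p q a \<Omega> u =
     (\<integral>\<^sup>+x\<in>\<Omega>. ennreal (norm (weak_gradient \<Omega> u x) powr p
                     + a x * norm (weak_gradient \<Omega> u x) powr q) \<partial>lebesgue)"

definition energy_space ::
    "real \<Rightarrow> real \<Rightarrow> ('a::euclidean_space \<Rightarrow> real) \<Rightarrow> 'a set \<Rightarrow> ('a \<Rightarrow> real) set" where
  "energy_space p q a \<Omega> = {\<phi> \<in> W11_0 \<Omega>. energy p q a \<Omega> \<phi> < \<infinity>}"

definition Z_class :: "real \<Rightarrow> 'a::euclidean_space set \<Rightarrow> ('a \<Rightarrow> real) set" where
  "Z_class \<kappa> \<Omega> = {a. a \<in> borel_measurable (lebesgue_on \<Omega>) \<and> (\<forall>x\<in>\<Omega>. 0 \<le> a x) \<and>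
     (\<exists>C>0. \<forall>x\<in>\<Omega>. \<forall>y\<in>\<Omega>. a x \<le> C * (a y + norm (x - y) powr \<kappa>))}"

definition holder_space :: "real \<Rightarrow> 'a::euclidean_space set \<Rightarrow> ('a \<Rightarrow> real) set" where
  "holder_space \<gamma> \<Omega> =
     {f. bdd_above {\<bar>f x - f y\<bar> / norm (x - y) powr \<gamma> | x y. x \<in> \<Omega> \<and> y \<in> \<Omega> \<and> x \<noteq> y}}"

definition affine_class :: "('a \<Rightarrow> real) \<Rightarrow> ('a \<Rightarrow> real) set \<Rightarrow> ('a \<Rightarrow> real) set" where
  "affine_class u\<^sub>0 X = {(\<lambda>x. u\<^sub>0 x + \<phi> x) | \<phi>. \<phi> \<in> X}"

text \<open>
  Near every boundary point the set is the strict epigraph of a Lipschitz function in some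
  rotated coordinate system: \<open>e\<close> is the vertical direction, the hyperplane orthogonal to
  \<open>e\<close> plays the role of the horizontal coordinates, and \<open>x - (x \<bullet> e) *\<^sub>R e\<close>
  is the horizontal component of \<open>x\<close>.
\<close>

definition lipschitz_boundary :: "'a::euclidean_space set \<Rightarrow> bool" where
  "lipschitz_boundary \<Omega> \<longleftrightarrow> (\<forall>x\<^sub>0\<in>frontier \<Omega>. \<exists>r>0. \<exists>e L. \<exists>g::'a \<Rightarrow> real.
     norm e = 1 \<and> L-lipschitz_on {y. y \<bullet> e = 0} g \<and>
     \<Omega> \<inter> ball x\<^sub>0 r = {x \<in> ball x\<^sub>0 r. g (x - (x \<bullet> e) *\<^sub>R e) < x \<bullet> e})"

definition bounded_lipschitz_domain :: "'a::euclidean_space set \<Rightarrow> bool" where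
  "bounded_lipschitz_domain \<Omega> \<longleftrightarrow>
     \<Omega> \<noteq> {} \<and> open \<Omega> \<and> connected \<Omega> \<and> bounded \<Omega> \<and> lipschitz_boundary \<Omega>"

end

theory Submission
  imports Defs
begin

text \<open>
  Functions in \<open>W11_0\<close> extend by zero to weakly differentiable functions on the whole space. After
  truncation (in part (i)) or directly (in part (ii), where Hoelder functions in \<open>W11_0\<close> vanish at the
  boundary) the extension \<open>v\<close> satisfies \<open>\<bar>v x - v y\<bar> \<le> H \<bar>x - y\<bar> powr \<gamma>\<close>, where \<open>\<gamma> = 0\<close> encodes boundedness.
  Localise with cutoffs to balls in which a fixed direction \<open>w\<close> points into the domain, and convolve with
  kernels supported in \<open>cball (\<delta> w) \<delta>\<close>: this shifts the support inwards and yields test functions whose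
  gradients are at most of order \<open>\<delta> powr (\<gamma> - 1)\<close>. As \<open>a\<close> exceeds a multiple of its minimum over a ball of radius \<open>\<delta>\<close>
  by at most \<open>O(\<delta> powr \<kappa>)\<close>, and \<open>\<delta> powr \<kappa>\<close> times the \<open>(q - p)\<close>-th power of the gradient is bounded by the hypothesis on
  \<open>\<kappa>\<close>, Jensen's inequality bounds the energy density of the mollified function by the mollified energy
  density. The generalised dominated convergence theorem then gives convergence in energy.
\<close>

section \<open>Smooth bump functions\<close>

text \<open>The obstacle is the gap between \<open>p\<close> and \<open>q\<close>: mollification
  spreads a gradient from points where \<open>a\<close> vanishes to points where \<open>a\<close> is
  positive, and the \<open>q\<close>-phase created there has to be paid for by the
  \<open>p\<close>-phase alone. A bound on the mollified gradient by \<open>v\<close> itself is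
  therefore needed, and it has a simple source: the gradient of a kernel has integral zero, so
  \<open>v\<close> may be replaced by its increments. The energy is convex but not a norm. Errors
  are split with weights \<open>1 - l\<close> and \<open>l\<close>; the factor
  \<open>(1 - l) powr (1 - q)\<close> on the main term tends to 1 as \<open>l\<close> tends to 0.
  Hence it suffices to approximate the gradient of \<phi> alone, in the energy of the difference,
  and \<open>u\<^sub>0\<close> enters only in the last comparison. Cutting off by \<beta> adds the
  field \<open>v x *\<^sub>R \<beta>' x\<close> to the gradient. It has finite energy because
  \<open>v\<close> is bounded, which is why unbounded functions are truncated before they are
  localised. The Lipschitz boundary is used twice: to find the inward directions, and to know that
  the complement has interior points arbitrarily close to each boundary point, without which zero
  boundary values could not be read off.\<close>

lemma Ck_SucI:
  assumes "\<And>x. (f has_derivative f' x) (at x)" "\<And>b. b \<in> Basis \<Longrightarrow> Ck k (\<lambda>x. f' x b)"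
  shows "Ck (Suc k) f"
proof -
  have "frechet_derivative f (at x) = f' x" for x
    using frechet_derivative_at[OF assms(1)] by simp
  then show ?thesis using assms by (auto simp: differentiable_def)
qed

lemma Ck_Suc_has_derivative:
  "Ck (Suc k) f \<Longrightarrow> (f has_derivative frechet_derivative f (at x)) (at x)"
  by (simp add: frechet_derivative_works)

lemma Ck_SucD: "Ck (Suc k) f \<Longrightarrow> Ck k f"
proof (induction k arbitrary: f)
  case 0
  then show ?case
    by (simp add: continuous_at_imp_continuous_on differentiable_imp_continuous_within)
next
  case (Suc k)
  show ?case
    using Suc.prems Suc.IH
    by (meson Ck.simps(2))
qed

lemma Ck_const: "Ck k (\<lambda>x. c)"
proof (induction k arbitrary: c)
  case (Suc k)
  show ?case by (rule Ck_SucI[where f'="\<lambda>x h. 0"]) (use Suc in auto)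
qed simp

lemma Ck_add: "Ck k f \<Longrightarrow> Ck k g \<Longrightarrow> Ck k (\<lambda>x. f x + g x)"
proof (induction k arbitrary: f g)
  case 0 then show ?case by (simp add: continuous_on_add)
next
  case (Suc k)
  show ?case
  proof (rule Ck_SucI)
    show "((\<lambda>x. f x + g x) has_derivative
        (\<lambda>h. frechet_derivative f (at x) h + frechet_derivative g (at x) h)) (at x)" for x
      by (intro has_derivative_add Ck_Suc_has_derivative[OF Suc.prems(1)] Ck_Suc_has_derivative[OF Suc.prems(2)])
  qed (use Suc in auto)
qed

lemma Ck_mult: "Ck k f \<Longrightarrow> Ck k g \<Longrightarrow> Ck k (\<lambda>x. f x * g x)"
proof (induction k arbitrary: f g)
  case 0 then show ?case by (simp add: continuous_on_mult)
next
  case (Suc k)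
  show ?case
  proof (rule Ck_SucI)
    show "((\<lambda>x. f x * g x) has_derivative
        (\<lambda>h. f x * frechet_derivative g (at x) h + frechet_derivative f (at x) h * g x)) (at x)" for x
      by (intro has_derivative_mult Ck_Suc_has_derivative[OF Suc.prems(1)] Ck_Suc_has_derivative[OF Suc.prems(2)])
    fix b :: 'a assume "b \<in> Basis"
    then show "Ck k (\<lambda>x. f x * frechet_derivative g (at x) b + frechet_derivative f (at x) b * g x)"
      using Suc.prems by (intro Ck_add Suc.IH Ck_SucD[of k f] Ck_SucD[of k g]) auto
  qed
qed

lemma Ck_inner: "Ck k (\<lambda>x. (s *\<^sub>R x - w) \<bullet> b)"
proof (cases k)
  case (Suc j)
  show ?thesis unfolding Suc
    by (rule Ck_SucI[where f'="\<lambda>x h. (s *\<^sub>R h) \<bullet> b"])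
       (auto intro!: derivative_eq_intros Ck_const)
qed (simp add: continuous_intros)

text \<open>Up to linear combinations the powers of \<open>inverse t\<close> make the family closed
  under differentiation, so smoothness of the function \<open>exp (- inverse t)\<close>, extended by
  0, follows by an induction over all \<open>m\<close> at once.\<close>

definition flat_exp :: "nat \<Rightarrow> real \<Rightarrow> real" where
  "flat_exp m t = (if t > 0 then exp (- inverse t) * inverse t ^ m else 0)"

lemma flat_exp_tendsto_0: "(flat_exp m \<longlongrightarrow> 0) (at 0)"
proof -
  \<comment> \<open>Substituting \<open>x = inverse t\<close> moves the limit at \<open>0\<close>
    from the right to infinity, where the exponential beats every power.\<close>
  have "((\<lambda>x. x ^ m / exp x) \<longlongrightarrow> (0::real)) at_top"
    by (rule tendsto_power_div_exp_0)
  then have "((\<lambda>t. inverse t ^ m / exp (inverse t)) \<longlongrightarrow> (0::real)) (at_right 0)"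
    by (rule filterlim_compose) (rule filterlim_inverse_at_top_right)
  then have r: "(flat_exp m \<longlongrightarrow> 0) (at_right 0)"
    by (rule Lim_transform_eventually)
       (auto simp: flat_exp_def exp_minus field_simps eventually_at_right_less eventually_at_filter)
  have l: "(flat_exp m \<longlongrightarrow> 0) (at_left 0)"
    by (rule Lim_transform_eventually[OF tendsto_const])
       (auto simp: flat_exp_def eventually_at_filter)
  show ?thesis using l r by (simp add: filterlim_split_at)
qed

lemma DERIV_flat_exp:
  "(flat_exp m has_real_derivative flat_exp (m + 2) t - m * flat_exp (m + 1) t) (at t)"
proof (cases t "0::real" rule: linorder_cases)
  case less
  have "(flat_exp m has_real_derivative 0) (at t)"
    by (rule has_field_derivative_transform_within_open[of "\<lambda>_. 0" _ _ "{..<0}"])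
       (use less in \<open>auto simp: flat_exp_def\<close>)
  then show ?thesis using less by (simp add: flat_exp_def)
next
  case equal
  \<comment> \<open>At the origin the difference quotient is itself the next member of the
    family.\<close>
  have "(\<lambda>h. (flat_exp m (0 + h) - flat_exp m 0) / h) = flat_exp (Suc m)"
    by (auto simp: flat_exp_def fun_eq_iff field_simps)
  then show ?thesis using flat_exp_tendsto_0[of "Suc m"] equal
    by (simp add: DERIV_def) (simp add: flat_exp_def)
next
  case greater
  have "((\<lambda>t. exp (- inverse t) * inverse t ^ m) has_real_derivative
      flat_exp (m + 2) t - m * flat_exp (m + 1) t) (at t)"
    using greater
    by (auto intro!: derivative_eq_intros simp: flat_exp_def field_simps power2_eq_square)
       (cases m; simp add: field_simps)
  then show ?thesis
    by (rule has_field_derivative_transform_within_open[of _ _ _ "{0<..}"])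
       (use greater in \<open>auto simp: flat_exp_def\<close>)
qed

text \<open>Dilation by \<open>s\<close> and centre \<open>w\<close> are built into the argument, so
  rescaled kernels are covered without a chain rule for \<open>Ck\<close>.\<close>

lemma Ck_bump: "Ck k (\<lambda>x. flat_exp m (1 - (s *\<^sub>R x - w) \<bullet> (s *\<^sub>R x - w)))"
proof (induction k arbitrary: m)
  case 0
  have "continuous_on UNIV (flat_exp m)"
    using DERIV_flat_exp by (meson DERIV_isCont continuous_at_imp_continuous_on)
  then have "continuous_on UNIV (flat_exp m \<circ> (\<lambda>x. 1 - (s *\<^sub>R x - w) \<bullet> (s *\<^sub>R x - w)))"
    by (intro continuous_on_compose continuous_intros) (auto elim: continuous_on_subset)
  then show ?case by (simp add: o_def)
next
  case (Suc k)
  let ?r = "\<lambda>x. 1 - (s *\<^sub>R x - w) \<bullet> (s *\<^sub>R x - w)"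
  let ?F' = "\<lambda>x. flat_exp (m + 2) (?r x) + (- m) * flat_exp (m + 1) (?r x)"
  show ?case
  proof (rule Ck_SucI)
    fix x
    have 1: "(?r has_derivative (\<lambda>h. - 2 * s * ((s *\<^sub>R x - w) \<bullet> h))) (at x)"
      by (auto intro!: derivative_eq_intros simp: fun_eq_iff inner_commute algebra_simps)
    show "((\<lambda>x. flat_exp m (?r x)) has_derivative (\<lambda>h. ?F' x * (- 2 * s * ((s *\<^sub>R x - w) \<bullet> h)))) (at x)"
      using has_derivative_compose[OF 1 DERIV_flat_exp[of m "?r x", unfolded has_field_derivative_def]]
      by simp
  next
    fix b :: 'a
    show "Ck k (\<lambda>x. ?F' x * (- 2 * s * ((s *\<^sub>R x - w) \<bullet> b)))"
      by (intro Ck_mult Ck_add Ck_const Ck_inner Suc.IH)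
  qed
qed

section \<open>Gradients and mollifiers\<close>

text \<open>A vector field in place of the derivative as a linear map, so that it can be integrated.
  The class is C1 rather than smooth because the cutoffs used below are built from squares of
  positive parts.\<close>

definition C1_grad :: "('a::euclidean_space \<Rightarrow> real) \<Rightarrow> ('a \<Rightarrow> 'a) \<Rightarrow> bool" where
  "C1_grad f f' \<longleftrightarrow> (\<forall>x. (f has_derivative (\<lambda>h. f' x \<bullet> h)) (at x)) \<and> continuous_on UNIV f'"

definition grad :: "('a::euclidean_space \<Rightarrow> real) \<Rightarrow> 'a \<Rightarrow> 'a" where
  "grad f x = (\<Sum>b\<in>Basis. frechet_derivative f (at x) b *\<^sub>R b)"

lemma C1_gradD: "C1_grad f f' \<Longrightarrow> (f has_derivative (\<lambda>h. f' x \<bullet> h)) (at x)"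
  by (simp add: C1_grad_def)

lemma C1_grad_frechet: "C1_grad f f' \<Longrightarrow> frechet_derivative f (at x) h = f' x \<bullet> h"
  using frechet_derivative_at[OF C1_gradD] by metis

lemma C1_grad_continuous: "C1_grad f f' \<Longrightarrow> continuous_on S f"
  by (meson C1_gradD continuous_at_imp_continuous_on has_derivative_continuous)

lemma C1_grad_continuous': "C1_grad f f' \<Longrightarrow> continuous_on S f'"
  unfolding C1_grad_def using continuous_on_subset by blast

lemma C1_grad_unique: "C1_grad f f' \<Longrightarrow> grad f = f'"
  by (simp add: grad_def fun_eq_iff C1_grad_frechet euclidean_representation)

lemma Ck_imp_C1_grad:
  assumes "Ck (Suc 0) f" shows "C1_grad f (grad f)"
proof -
  have d: "(f has_derivative frechet_derivative f (at x)) (at x)" for x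
    using assms Ck_Suc_has_derivative by blast
  have "frechet_derivative f (at x) h = grad f x \<bullet> h" for x h
  proof -
    interpret linear "frechet_derivative f (at x)"
      using d has_derivative_linear by blast
    have "frechet_derivative f (at x) h = frechet_derivative f (at x) (\<Sum>b\<in>Basis. (h \<bullet> b) *\<^sub>R b)"
      by (simp add: euclidean_representation)
    also have "\<dots> = grad f x \<bullet> h"
      by (simp add: sum scale grad_def inner_sum_left inner_commute[of h] mult.commute)
    finally show ?thesis .
  qed
  then have "frechet_derivative f (at x) = (\<lambda>h. grad f x \<bullet> h)" for x by blast
  moreover have "continuous_on UNIV (grad f)"
    unfolding grad_def using assms by (intro continuous_intros) auto
  ultimately show ?thesis using d by (simp add: C1_grad_def)
qed

lemma C1_grad_eq_0:
  assumes "C1_grad f f'" "\<And>x. x \<notin> S \<Longrightarrow> f x = 0" "closed S" "x \<notin> S"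
  shows "f' x = 0"
proof -
  have "((\<lambda>x. 0) has_derivative (\<lambda>h. f' x \<bullet> h)) (at x)"
    by (rule has_derivative_transform_within_open[OF C1_gradD[OF assms(1)], of "- S"])
       (use assms in auto)
  then have "(\<lambda>h. f' x \<bullet> h) = (\<lambda>h. 0)"
    using has_derivative_unique has_derivative_const by metis
  then show ?thesis by (metis inner_eq_zero_iff)
qed

lemma C1_grad_lipschitz:
  assumes "C1_grad f f'" "\<And>x. norm (f' x) \<le> M"
  shows "\<bar>f x - f y\<bar> \<le> M * norm (x - y)"
proof -
  have "norm (f x - f y) \<le> M * norm (x - y)"
  proof (rule differentiable_bound[where S=UNIV and f'="\<lambda>x h. f' x \<bullet> h"])
    show "onorm (\<lambda>h. f' x \<bullet> h) \<le> M" for x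
      by (rule onorm_le) (metis Cauchy_Schwarz_ineq2 assms(2) mult_right_mono norm_ge_zero order_trans real_norm_def)
  qed (use assms C1_gradD in auto)
  then show ?thesis by simp
qed

lemma C1_grad_mult:
  assumes "C1_grad f f'" "C1_grad g g'"
  shows "C1_grad (\<lambda>x. f x * g x) (\<lambda>x. f x *\<^sub>R g' x + g x *\<^sub>R f' x)"
  unfolding C1_grad_def
proof (intro conjI allI)
  show "((\<lambda>x. f x * g x) has_derivative (\<lambda>h. (f x *\<^sub>R g' x + g x *\<^sub>R f' x) \<bullet> h)) (at x)" for x
    using has_derivative_mult[OF C1_gradD[OF assms(1)] C1_gradD[OF assms(2)], of x]
    by (simp add: inner_add_left mult.commute)
qed (intro continuous_intros C1_grad_continuous[OF assms(1)] C1_grad_continuous'[OF assms(1)]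
     C1_grad_continuous[OF assms(2)] C1_grad_continuous'[OF assms(2)])

lemma C1_grad_add:
  assumes "C1_grad f f'" "C1_grad g g'"
  shows "C1_grad (\<lambda>x. f x + g x) (\<lambda>x. f' x + g' x)"
  using assms by (auto simp: C1_grad_def inner_add_left intro!: has_derivative_add continuous_intros)

lemma C1_grad_diff:
  assumes "C1_grad f f'" "C1_grad g g'"
  shows "C1_grad (\<lambda>x. f x - g x) (\<lambda>x. f' x - g' x)"
  using assms by (auto simp: C1_grad_def inner_diff_left intro!: has_derivative_diff continuous_intros)

lemma C1_grad_const: "C1_grad (\<lambda>x. c) (\<lambda>x. 0)"
  by (auto simp: C1_grad_def)

lemma C1_grad_compose:
  assumes "C1_grad f f'" "\<And>s. (T has_real_derivative T' s) (at s)" "continuous_on UNIV T'"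
  shows "C1_grad (\<lambda>x. T (f x)) (\<lambda>x. T' (f x) *\<^sub>R f' x)"
  unfolding C1_grad_def
proof (intro conjI allI)
  show "((\<lambda>x. T (f x)) has_derivative (\<lambda>h. (T' (f x) *\<^sub>R f' x) \<bullet> h)) (at x)" for x
    using has_derivative_compose[OF C1_gradD[OF assms(1)] assms(2)[unfolded has_field_derivative_def]]
    by simp
  show "continuous_on UNIV (\<lambda>x. T' (f x) *\<^sub>R f' x)"
    by (intro continuous_intros continuous_on_compose2[OF assms(3)] C1_grad_continuous[OF assms(1)]
        C1_grad_continuous'[OF assms(1)]) auto
qed

lemma C1_grad_reflect:
  assumes "C1_grad K K'" shows "C1_grad (\<lambda>y. K (x - y)) (\<lambda>y. - K' (x - y))"
  unfolding C1_grad_def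
proof (intro conjI allI)
  show "((\<lambda>y. K (x - y)) has_derivative (\<lambda>h. (- K' (x - y)) \<bullet> h)) (at y)" for y
  proof -
    have "((\<lambda>y. x - y) has_derivative (\<lambda>h. - h)) (at y)"
      by (auto intro!: derivative_eq_intros)
    from has_derivative_compose[OF this C1_gradD[OF assms]] show ?thesis by simp
  qed
  show "continuous_on UNIV (\<lambda>y. - K' (x - y))"
    by (intro continuous_intros continuous_on_compose2[OF C1_grad_continuous'[OF assms, of UNIV]]) auto
qed

lemma bounded_continuous_support:
  fixes f :: "'a::euclidean_space \<Rightarrow> 'b::real_normed_vector"
  assumes "continuous_on UNIV f" "\<And>x. x \<notin> S \<Longrightarrow> f x = 0" "bounded S"
  obtains M where "M > 0" "\<And>x. norm (f x) \<le> M"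
proof -
  have "compact (f ` closure S)"
    using assms by (intro compact_continuous_image) (auto intro: continuous_on_subset)
  then have "bounded (f ` closure S)" by (rule compact_imp_bounded)
  then obtain M where M: "M > 0" "\<forall>y\<in>f ` closure S. norm y \<le> M"
    unfolding bounded_pos by blast
  have "norm (f x) \<le> M" for x
  proof (cases "x \<in> S")
    case True
    then show ?thesis using M closure_subset by blast
  next
    case False
    then show ?thesis using M assms(2) by simp
  qed
  then show ?thesis using that M(1) by blast
qed

lemma integrable_continuous_support:
  fixes f :: "'a::euclidean_space \<Rightarrow> 'b::euclidean_space"
  assumes "continuous_on UNIV f" "\<And>x. x \<notin> S \<Longrightarrow> f x = 0" "bounded S"
  shows "integrable lborel f"
proof -
  have "integrable lborel (\<lambda>x. indicator (closure S) x *\<^sub>R f x)"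
    using assms by (intro borel_integrable_compact) (auto intro: continuous_on_subset)
  moreover have "(\<lambda>x. indicator (closure S) x *\<^sub>R f x) = f"
    using assms(2) closure_subset[of S] by (fastforce simp: indicator_def)
  ultimately show ?thesis by simp
qed

lemma integral_lborel_affine:
  fixes f :: "'a::euclidean_space \<Rightarrow> 'b::{banach, second_countable_topology}"
  assumes [measurable]: "f \<in> borel_measurable borel" and c: "c \<noteq> 0"
  shows "integral\<^sup>L lborel f = \<bar>c\<bar> ^ DIM('a) *\<^sub>R (\<integral>x. f (t + c *\<^sub>R x) \<partial>lborel)"
  by (subst lborel_affine[OF c, of t]) (simp add: integral_density integral_distr)

lemma nn_integral_lborel_affine:
  fixes f :: "'a::euclidean_space \<Rightarrow> ennreal"
  assumes [measurable]: "f \<in> borel_measurable borel" and c: "c \<noteq> 0"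
  shows "integral\<^sup>N lborel f = \<bar>c\<bar> ^ DIM('a) * (\<integral>\<^sup>+x. f (t + c *\<^sub>R x) \<partial>lborel)"
  by (subst lborel_affine[OF c, of t]) (simp add: nn_integral_density nn_integral_distr nn_integral_cmult ennreal_power)

text \<open>Difference quotients have integral zero by translation invariance.\<close>

lemma integral_C1_grad_eq_0:
  fixes f :: "'a::euclidean_space \<Rightarrow> real"
  assumes f: "C1_grad f f'" and 0: "\<And>x. x \<notin> S \<Longrightarrow> f x = 0" and S: "bounded S"
  shows "integral\<^sup>L lborel f' = 0"
proof -
  obtain R where R: "S \<subseteq> cball 0 R" using bounded_subset_ballD[OF S, of 0] ball_subset_cball by blast
  have f0: "f x = 0" if "x \<notin> cball 0 R" for x using 0 R that by blast
  have f'0: "f' x = 0" if "x \<notin> cball 0 R" for x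
    using C1_grad_eq_0[OF f, of "cball 0 R"] f0 that by blast
  note cf = C1_grad_continuous[OF f, of UNIV] and cf' = C1_grad_continuous'[OF f, of UNIV]
  have if': "integrable lborel f'" and iff: "integrable lborel f"
    using integrable_continuous_support[OF cf' _ bounded_cball[of 0 R]] f'0
      integrable_continuous_support[OF cf _ bounded_cball[of 0 R]] f0 by blast+
  have [measurable]: "f \<in> borel_measurable borel" "f' \<in> borel_measurable borel"
    using cf cf' by (auto intro: borel_measurable_continuous_onI)
  obtain M where M: "M > 0" "\<And>x. norm (f' x) \<le> M"
    using bounded_continuous_support[OF cf' f'0 bounded_cball[of 0 R]] by blast
  have "integral\<^sup>L lborel f' \<bullet> b = 0" if b: "b \<in> Basis" for b
  proof -
    \<comment> \<open>Difference quotients with step \<open>1 / (n + 1)\<close>; the factor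
      \<open>1\<close> in front of \<open>x\<close> gives the shift the form of an affine change of
      variables.\<close>
    define s where "s n x = (f (inverse (Suc n) *\<^sub>R b + 1 *\<^sub>R x) - f x) * Suc n" for n x
    \<comment> \<open>The gradient bound \<open>M\<close> also bounds the quotients, and shifts of
      length at most 1 keep their supports in the ball of radius \<open>R + 1\<close>.\<close>
    define w where "w x = indicator (cball 0 (R + 1)) x * M" for x :: 'a
    have b1: "norm b = 1" using b by simp
    have [measurable]: "s n \<in> borel_measurable borel" for n
      unfolding s_def[abs_def] by measurable
    have "(\<lambda>n. integral\<^sup>L lborel (s n)) \<longlonglongrightarrow> (\<integral>x. f' x \<bullet> b \<partial>lborel)"
    proof (rule integral_dominated_convergence[where w=w])
      show "integrable lborel w"
        unfolding w_def by (intro integrable_mult_left integrable_real_indicator)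
          (use emeasure_bounded_finite[OF bounded_cball, of 0 "R + 1"] in auto)
      show "AE x in lborel. (\<lambda>n. s n x) \<longlonglongrightarrow> f' x \<bullet> b"
      proof (rule AE_I2)
        fix x
        have "((\<lambda>t. f (x + t *\<^sub>R b)) has_derivative (\<lambda>t. f' x \<bullet> (t *\<^sub>R b))) (at 0)"
          by (rule has_derivative_compose[of "\<lambda>t. x + t *\<^sub>R b" "\<lambda>t. t *\<^sub>R b" 0 UNIV f])
             (auto intro!: derivative_eq_intros C1_gradD[OF f])
        then have "((\<lambda>t. f (x + t *\<^sub>R b)) has_real_derivative f' x \<bullet> b) (at 0)"
          by (simp add: has_field_derivative_def mult.commute[of _ "f' x \<bullet> b"])
        then have "((\<lambda>h. (f (x + h *\<^sub>R b) - f x) / h) \<longlongrightarrow> f' x \<bullet> b) (at 0)"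
          by (simp add: DERIV_def)
        moreover have "filterlim (\<lambda>n. inverse (real (Suc n))) (at 0) sequentially"
          by (auto simp: filterlim_at LIMSEQ_inverse_real_of_nat simp del: of_nat_Suc)
        ultimately have "(\<lambda>n. (f (x + inverse (Suc n) *\<^sub>R b) - f x) / inverse (Suc n)) \<longlonglongrightarrow> f' x \<bullet> b"
          by (rule filterlim_compose)
        then show "(\<lambda>n. s n x) \<longlonglongrightarrow> f' x \<bullet> b"
          by (simp add: s_def add.commute divide_inverse)
      qed
      show "AE x in lborel. norm (s n x) \<le> w x" for n
      proof (rule AE_I2)
        fix x
        have le: "norm (inverse (real (Suc n)) *\<^sub>R b) = inverse (Suc n)"
          using b1 by simp
        show "norm (s n x) \<le> w x"
        proof (cases "x \<in> cball 0 (R + 1)")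
          case True
          have "\<bar>f (inverse (Suc n) *\<^sub>R b + x) - f x\<bar> \<le> M * inverse (Suc n)"
            using C1_grad_lipschitz[OF f M(2), of "inverse (Suc n) *\<^sub>R b + x" x] le by simp
          then have "\<bar>f (inverse (Suc n) *\<^sub>R b + x) - f x\<bar> * Suc n \<le> M * inverse (Suc n) * Suc n"
            by (intro mult_right_mono) auto
          also have "M * inverse (Suc n) * Suc n = M" by (simp del: of_nat_Suc)
          finally show ?thesis using True by (simp add: s_def w_def abs_mult del: of_nat_Suc)
        next
          case False
          have "norm x \<le> norm (inverse (Suc n) *\<^sub>R b + x) + norm (inverse (real (Suc n)) *\<^sub>R b)"
            by (metis add.commute add_diff_cancel_right' norm_triangle_sub norm_minus_commute norm_triangle_ineq4)
          moreover have "inverse (real (Suc n)) \<le> 1" by (simp add: divide_simps)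
          ultimately have "norm (inverse (Suc n) *\<^sub>R b + x) > R" using False le by simp
          then have "f (inverse (Suc n) *\<^sub>R b + x) = 0" "f x = 0"
            using False by (auto intro!: f0)
          then show ?thesis using M(1) by (simp add: s_def w_def)
        qed
      qed
    qed auto
    moreover have "integral\<^sup>L lborel (s n) = 0" for n
    proof -
      let ?t = "inverse (real (Suc n)) *\<^sub>R b"
      have "integral\<^sup>L lborel f = (\<integral>x. f (?t + 1 *\<^sub>R x) \<partial>lborel)"
        using integral_lborel_affine[of f 1 ?t] by simp
      moreover have "integrable lborel (\<lambda>x. f (?t + 1 *\<^sub>R x))"
      proof (rule integrable_continuous_support)
        show "continuous_on UNIV (\<lambda>x. f (?t + 1 *\<^sub>R x))"
          by (intro continuous_on_compose2[OF cf] continuous_intros) auto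
        show "f (?t + 1 *\<^sub>R x) = 0" if "x \<notin> (\<lambda>y. - ?t + y) ` cball 0 R" for x
        proof (rule f0)
          show "?t + 1 *\<^sub>R x \<notin> cball 0 R"
            using that image_eqI[of x "\<lambda>y. - ?t + y" "?t + 1 *\<^sub>R x" "cball 0 R"] by auto
        qed
        show "bounded ((\<lambda>y. - ?t + y) ` cball 0 R)" by (rule bounded_translation) simp
      qed
      ultimately show ?thesis unfolding s_def using iff by simp
    qed
    ultimately have "(\<integral>x. f' x \<bullet> b \<partial>lborel) = 0"
      by (simp add: LIMSEQ_const_iff)
    then show ?thesis using if' by simp
  qed
  then show ?thesis by (metis euclidean_all_zero_iff)
qed

text \<open>The off-centre support makes convolution move a set by
  \<open>\<delta> *\<^sub>R w\<close> and then fatten it by \<delta>; \<open>w = 0\<close> is the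
  usual centred kernel. \<open>A\<close> is meant to be chosen before \<delta>, so that the gradient
  bound is a true rate.\<close>

definition mollifier :: "'a::euclidean_space \<Rightarrow> real \<Rightarrow> real \<Rightarrow> ('a \<Rightarrow> real) \<Rightarrow> ('a \<Rightarrow> 'a) \<Rightarrow> bool" where
  "mollifier w A \<delta> K K' \<longleftrightarrow> smooth K \<and> C1_grad K K' \<and> (\<forall>z. 0 \<le> K z) \<and>
     (\<forall>z. z \<notin> cball (\<delta> *\<^sub>R w) \<delta> \<longrightarrow> K z = 0 \<and> K' z = 0) \<and>
     integral\<^sup>L lborel K = 1 \<and> (\<integral>z. norm (K' z) \<partial>lborel) \<le> A / \<delta>"

lemma ex_mollifier:
  fixes w :: "'a::euclidean_space"
  obtains A where "A > 0" "\<And>\<delta>. \<delta> > 0 \<Longrightarrow> \<exists>K K'. mollifier w A \<delta> K K'"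
proof -
  define \<eta> where "\<eta> s x = flat_exp 0 (1 - (s *\<^sub>R x - w) \<bullet> (s *\<^sub>R x - w))" for s x
  have sm: "Ck k (\<eta> s)" for k s unfolding \<eta>_def by (rule Ck_bump)
  define \<eta>' where "\<eta>' = grad (\<eta> 1)"
  have C: "C1_grad (\<eta> 1) \<eta>'" unfolding \<eta>'_def by (intro Ck_imp_C1_grad sm)
  have d2: "(s *\<^sub>R x - w) \<bullet> (s *\<^sub>R x - w) = (dist w (s *\<^sub>R x))\<^sup>2" for s x
    by (metis dist_commute dist_norm power2_norm_eq_inner)
  have pos: "\<eta> s x > 0" if "dist w (s *\<^sub>R x) < 1" for s x
    using that by (auto simp: \<eta>_def flat_exp_def d2 abs_square_less_1)
  have zero: "\<eta> s x = 0" if "dist w (s *\<^sub>R x) > 1" for s x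
    using one_less_power[OF that, of 2] by (simp add: \<eta>_def flat_exp_def d2)
  have nn: "\<eta> s x \<ge> 0" for s x by (auto simp: \<eta>_def flat_exp_def)
  have z1: "\<eta> 1 x = 0" if "x \<notin> cball w 1" for x using zero[of 1 x] that by auto
  have z1': "\<eta>' x = 0" if "x \<notin> cball w 1" for x using C1_grad_eq_0[OF C, of "cball w 1"] z1 that by blast
  note c = C1_grad_continuous[OF C, of UNIV] and c' = C1_grad_continuous'[OF C, of UNIV]
  have i: "integrable lborel (\<eta> 1)" using integrable_continuous_support[OF c z1 bounded_cball[of w 1]] by blast
  have [measurable]: "\<eta> 1 \<in> borel_measurable borel" "\<eta>' \<in> borel_measurable borel"
    using c c' by (auto intro: borel_measurable_continuous_onI)
  define I where "I = integral\<^sup>L lborel (\<eta> 1)"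
  have "I \<noteq> 0"
  proof
    assume "I = 0"
    then have "AE x in lborel. \<eta> 1 x = 0"
      unfolding I_def by (subst (asm) integral_nonneg_eq_0_iff_AE) (auto simp: i nn)
    then have "AE x in lebesgue. x \<notin> ball w 1"
      by (intro AE_completion) (use pos[of 1] in \<open>force elim!: eventually_mono\<close>)
    then have "ball w 1 \<in> null_sets lebesgue"
      by (subst AE_iff_null_sets) auto
    then have "negligible (ball w 1)" by (simp add: negligible_iff_null_sets)
    then show False using open_not_negligible[of "ball w 1"] by auto
  qed
  moreover have "I \<ge> 0" unfolding I_def using nn by simp
  ultimately have I: "I > 0" by simp
  define J where "J = (\<integral>z. norm (\<eta>' z) \<partial>lborel)"
  have J: "J \<ge> 0" unfolding J_def by simp
  \<comment> \<open>\<open>J / I\<close> is the actual constant; adding 1 to \<open>J\<close> makes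
    it positive.\<close>
  have "\<exists>K K'. mollifier w ((J + 1) / I) \<delta> K K'" if \<delta>: "\<delta> > 0" for \<delta>
  proof -
    define n where "n = DIM('a)"
    \<comment> \<open>Unit mass forces the factor \<open>\<delta> ^ n\<close> in the denominator;
      the gradient carries one more power of \<delta>, which leaves \<open>1 / \<delta>\<close>
      after integration.\<close>
    define K where "K z = inverse (I * \<delta> ^ n) * \<eta> (inverse \<delta>) z" for z
    define K' where "K' z = inverse (I * \<delta> ^ Suc n) *\<^sub>R \<eta>' (inverse \<delta> *\<^sub>R z)" for z
    have eq: "\<eta> (inverse \<delta>) z = \<eta> 1 (inverse \<delta> *\<^sub>R z)" for z by (simp add: \<eta>_def)
    have dd: "dist w (inverse \<delta> *\<^sub>R z) = dist (\<delta> *\<^sub>R w) z / \<delta>" for z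
    proof -
      have "\<delta> *\<^sub>R w - z = \<delta> *\<^sub>R (w - inverse \<delta> *\<^sub>R z)" using \<delta> by (simp add: algebra_simps)
      then show ?thesis using \<delta> by (simp add: dist_norm)
    qed
    have z0: "z \<notin> cball (\<delta> *\<^sub>R w) \<delta> \<Longrightarrow> inverse \<delta> *\<^sub>R z \<notin> cball w 1" for z
      using \<delta> by (simp add: dd)
    have "smooth K" unfolding smooth_def K_def by (intro allI Ck_mult Ck_const sm)
    moreover have "C1_grad K K'"
      unfolding C1_grad_def
    proof (intro conjI allI)
      fix x :: 'a
      have "((\<lambda>z. inverse \<delta> *\<^sub>R z) has_derivative (\<lambda>h. inverse \<delta> *\<^sub>R h)) (at x)"
        by (auto intro!: derivative_eq_intros)
      from has_derivative_compose[OF this C1_gradD[OF C, of "inverse \<delta> *\<^sub>R x"]]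
      have "((\<lambda>x. inverse (I * \<delta> ^ n) * \<eta> 1 (inverse \<delta> *\<^sub>R x)) has_derivative
        (\<lambda>h. inverse (I * \<delta> ^ n) * (\<eta>' (inverse \<delta> *\<^sub>R x) \<bullet> (inverse \<delta> *\<^sub>R h)))) (at x)"
        by (rule has_derivative_mult_right)
      then show "(K has_derivative (\<lambda>h. K' x \<bullet> h)) (at x)"
        unfolding K_def[abs_def] K'_def eq by (simp add: mult_ac)
      show "continuous_on UNIV K'" unfolding K'_def
        by (intro continuous_intros continuous_on_compose2[OF c']) auto
    qed
    moreover have "K z \<ge> 0" for z unfolding K_def using nn I \<delta> by simp
    moreover have "K z = 0 \<and> K' z = 0" if "z \<notin> cball (\<delta> *\<^sub>R w) \<delta>" for z
      using z1[OF z0[OF that]] z1'[OF z0[OF that]] by (simp add: K_def K'_def eq)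
    moreover have "integral\<^sup>L lborel K = 1"
    proof -
      have "I = inverse \<delta> ^ n * (\<integral>x. \<eta> 1 (inverse \<delta> *\<^sub>R x) \<partial>lborel)"
        unfolding I_def n_def using integral_lborel_affine[of "\<eta> 1" "inverse \<delta>" 0] \<delta> by simp
      then have "I * \<delta> ^ n = (\<integral>x. \<eta> 1 (inverse \<delta> *\<^sub>R x) \<partial>lborel)"
        using \<delta> by (simp add: field_simps power_inverse)
      moreover have "I * \<delta> ^ n \<noteq> 0" using I \<delta> by simp
      ultimately show ?thesis unfolding K_def eq by simp
    qed
    moreover have "(\<integral>z. norm (K' z) \<partial>lborel) \<le> ((J + 1) / I) / \<delta>"
    proof -
      have "J = inverse \<delta> ^ n * (\<integral>x. norm (\<eta>' (inverse \<delta> *\<^sub>R x)) \<partial>lborel)"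
        unfolding J_def n_def using integral_lborel_affine[of "\<lambda>x. norm (\<eta>' x)" "inverse \<delta>" 0] \<delta> by simp
      then have "(\<integral>z. norm (K' z) \<partial>lborel) = J / I / \<delta>"
        unfolding K'_def using I \<delta> by (simp add: field_simps power_inverse abs_mult)
      also have "\<dots> \<le> ((J + 1) / I) / \<delta>" using I \<delta> by (simp add: divide_right_mono)
      finally show ?thesis .
    qed
    ultimately show ?thesis unfolding mollifier_def by blast
  qed
  moreover have "(J + 1) / I > 0" using I J by simp
  ultimately show ?thesis using that by blast
qed

section \<open>Convolution\<close>

lemma continuous_imp_lebesgue_measurable:
  fixes f :: "'a::euclidean_space \<Rightarrow> 'b::euclidean_space"
  shows "continuous_on UNIV f \<Longrightarrow> f \<in> borel_measurable lebesgue"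
  by (intro measurable_completion) (simp add: borel_measurable_continuous_onI)

text \<open>Truncation in height and radius leaves a bounded function \<open>F k\<close> supported
  in a ball, and this is an almost everywhere limit of continuous functions. Forcing these into a
  common ball of the domain and of the range supplies a majorant, so dominated convergence applies
  to both steps.\<close>

lemma ex_continuous_support_approx:
  fixes f :: "'a::euclidean_space \<Rightarrow> 'b::euclidean_space"
  assumes f: "integrable lebesgue f" and e: "e > 0"
  obtains h R where "continuous_on UNIV h" "\<And>x. x \<notin> cball 0 R \<Longrightarrow> h x = 0"
    "(\<integral>\<^sup>+x. norm (f x - h x) \<partial>lebesgue) \<le> ennreal e"
proof -
  have fm [measurable]: "f \<in> borel_measurable lebesgue" using f by simp
  have [measurable]: "cball (0::'a) r \<in> sets lebesgue" for r by simp
  define F where "F k x = (if norm x \<le> real k \<and> norm (f x) \<le> real k then f x else 0)" for k x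
  have Fm: "F k \<in> borel_measurable lebesgue" for k
  proof -
    have "F k = (\<lambda>x. if x \<in> cball 0 (real k) \<and> norm (f x) \<le> real k then f x else 0)"
      by (simp add: F_def fun_eq_iff)
    also have "\<dots> \<in> borel_measurable lebesgue" by measurable
    finally show ?thesis .
  qed
  have "(\<lambda>k. \<integral>\<^sup>+x. norm (f x - F k x) \<partial>lebesgue) \<longlonglongrightarrow> 0"
  proof (rule nn_integral_dominated_convergence_norm[where w="\<lambda>x. norm (f x)"])
    show "AE x in lebesgue. (\<lambda>k. F k x) \<longlonglongrightarrow> f x"
    proof (rule AE_I2)
      fix x
      obtain k0 where k0: "max (norm x) (norm (f x)) \<le> real k0" using real_arch_simple by blast
      have "eventually (\<lambda>k. F k x = f x) sequentially"
        using eventually_ge_at_top[of k0] by eventually_elim (use k0 in \<open>auto simp: F_def\<close>)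
      then show "(\<lambda>k. F k x) \<longlonglongrightarrow> f x" by (rule tendsto_eventually)
    qed
    show "(\<integral>\<^sup>+x. norm (f x) \<partial>lebesgue) < \<infinity>" using f by (simp add: integrable_iff_bounded)
    show "AE x in lebesgue. norm (F j x) \<le> norm (f x)" for j by (simp add: F_def)
  qed (use Fm in auto)
  then have "eventually (\<lambda>k. (\<integral>\<^sup>+x. norm (f x - F k x) \<partial>lebesgue) < ennreal (e/2)) sequentially"
    using e by (intro order_tendstoD) auto
  then obtain k where k: "(\<integral>\<^sup>+x. norm (f x - F k x) \<partial>lebesgue) < ennreal (e/2)"
    using eventually_happens'[OF sequentially_bot] by blast
  have "F k measurable_on UNIV"
    using Fm[of k] by (simp add: measurable_on_iff_borel_measurable lebesgue_on_UNIV_eq)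
  then obtain N g where N: "negligible N" and gc: "\<And>n. continuous_on UNIV (g n)"
    and g: "\<And>x. x \<notin> N \<Longrightarrow> (\<lambda>n. g n x) \<longlonglongrightarrow> F k x"
    unfolding measurable_on_def by auto
  \<comment> \<open>\<open>c\<close> is 1 wherever \<open>F k\<close> can be nonzero, and the
    projection \<open>p\<close> fixes every value of \<open>F k\<close>; hence neither changes the
    limit.\<close>
  define c where "c x = max 0 (min 1 (real k + 1 - norm x))" for x :: 'a
  define p where "p = closest_point (cball (0::'b) (real k))"
  have pn: "norm (p v) \<le> real k" for v
    using closest_point_in_set[of "cball (0::'b) (real k)" v] by (simp add: p_def)
  have pc: "continuous_on UNIV p"
    unfolding p_def by (intro continuous_on_closest_point) auto
  define h where "h n x = c x *\<^sub>R p (g n x)" for n x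
  have hc: "continuous_on UNIV (h n)" for n
    unfolding h_def c_def by (intro continuous_intros continuous_on_compose2[OF pc gc]) auto
  have h0: "h n x = 0" if "x \<notin> cball 0 (real k + 1)" for n x
    using that by (simp add: h_def c_def)
  have hb: "norm (h n x) \<le> indicator (cball (0::'a) (real k + 1)) x * real k" for n x
  proof (cases "x \<in> cball 0 (real k + 1)")
    case True
    have "\<bar>c x\<bar> * norm (p (g n x)) \<le> 1 * real k"
      using pn by (intro mult_mono) (auto simp: c_def)
    then show ?thesis using True by (simp add: h_def)
  qed (simp add: h0)
  have "(\<lambda>n. \<integral>\<^sup>+x. norm (F k x - h n x) \<partial>lebesgue) \<longlonglongrightarrow> 0"
  proof (rule nn_integral_dominated_convergence_norm[where w="\<lambda>x. indicator (cball (0::'a) (real k + 1)) x * real k"])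
    show "AE x in lebesgue. (\<lambda>n. h n x) \<longlonglongrightarrow> F k x"
    proof -
      have "AE x in lebesgue. x \<notin> N"
        using N by (simp add: negligible_iff_null_sets AE_not_in)
      then show ?thesis
      proof eventually_elim
        fix x assume "x \<notin> N"
        have "(\<lambda>n. p (g n x)) \<longlonglongrightarrow> p (F k x)"
          using continuous_on_tendsto_compose[OF pc g[OF \<open>x \<notin> N\<close>]] by simp
        also have "p (F k x) = F k x"
          unfolding p_def by (rule closest_point_self) (simp add: F_def)
        finally have "(\<lambda>n. c x *\<^sub>R p (g n x)) \<longlonglongrightarrow> c x *\<^sub>R F k x"
          by (intro tendsto_intros)
        moreover have "c x *\<^sub>R F k x = F k x" by (auto simp: F_def c_def)
        ultimately show "(\<lambda>n. h n x) \<longlonglongrightarrow> F k x" by (simp add: h_def)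
      qed
    qed
    have "(\<integral>\<^sup>+x. ennreal (indicator (cball (0::'a) (real k + 1)) x * real k) \<partial>lebesgue)
        = (\<integral>\<^sup>+x. ennreal (real k) * indicator (cball (0::'a) (real k + 1)) x \<partial>lebesgue)"
      by (intro nn_integral_cong) (simp add: indicator_def)
    also have "\<dots> = ennreal (real k) * emeasure lebesgue (cball (0::'a) (real k + 1))"
      by (rule nn_integral_cmult_indicator) simp
    also have "\<dots> < \<infinity>"
      using emeasure_bounded_finite[OF bounded_cball, of "0::'a" "real k + 1"]
      by (simp add: ennreal_mult_less_top)
    finally show "(\<integral>\<^sup>+x. ennreal (indicator (cball (0::'a) (real k + 1)) x * real k) \<partial>lebesgue) < \<infinity>" .
  qed (use Fm hb hc in \<open>auto intro: continuous_imp_lebesgue_measurable\<close>)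
  then have "eventually (\<lambda>n. (\<integral>\<^sup>+x. norm (F k x - h n x) \<partial>lebesgue) < ennreal (e/2)) sequentially"
    using e by (intro order_tendstoD) auto
  then obtain n where n: "(\<integral>\<^sup>+x. norm (F k x - h n x) \<partial>lebesgue) < ennreal (e/2)"
    using eventually_happens'[OF sequentially_bot] by blast
  have [measurable]: "h n \<in> borel_measurable lebesgue" "F k \<in> borel_measurable lebesgue"
    using hc Fm by (auto intro: continuous_imp_lebesgue_measurable)
  have "(\<integral>\<^sup>+x. norm (f x - h n x) \<partial>lebesgue)
      \<le> (\<integral>\<^sup>+x. ennreal (norm (f x - F k x)) + ennreal (norm (F k x - h n x)) \<partial>lebesgue)"
    by (intro nn_integral_mono) (metis diff_add_cancel ennreal_leI ennreal_plus norm_ge_zero norm_triangle_ineq add_diff_eq)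
  also have "\<dots> = (\<integral>\<^sup>+x. norm (f x - F k x) \<partial>lebesgue) + (\<integral>\<^sup>+x. norm (F k x - h n x) \<partial>lebesgue)"
    by (rule nn_integral_add) auto
  also have "\<dots> \<le> ennreal (e/2) + ennreal (e/2)"
    using k n by (intro add_mono) auto
  also have "\<dots> = ennreal e" using e by (simp flip: ennreal_plus)
  finally show ?thesis using that hc h0 by blast
qed

definition conv :: "('a::euclidean_space \<Rightarrow> real) \<Rightarrow> ('a \<Rightarrow> 'b::euclidean_space) \<Rightarrow> 'a \<Rightarrow> 'b" where
  "conv K f x = (\<integral>y. K (x - y) *\<^sub>R f y \<partial>lebesgue)"

lemma uniformly_continuous_support:
  fixes K :: "'a::euclidean_space \<Rightarrow> 'b::real_normed_vector"
  assumes "continuous_on UNIV K" "\<And>x. x \<notin> S \<Longrightarrow> K x = 0" "bounded S" "e > 0"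
  obtains d where "d > 0" "\<And>x y. dist x y < d \<Longrightarrow> norm (K x - K y) < e"
proof -
  obtain R where R: "S \<subseteq> ball 0 R" using bounded_subset_ballD[OF assms(3)] by blast
  have "uniformly_continuous_on (cball 0 (R + 1)) K"
    using assms(1) by (intro compact_uniformly_continuous) (auto intro: continuous_on_subset)
  then obtain d where d: "d > 0" "\<And>x y. x \<in> cball 0 (R+1) \<Longrightarrow> y \<in> cball 0 (R+1) \<Longrightarrow> dist y x < d \<Longrightarrow> dist (K y) (K x) < e"
    unfolding uniformly_continuous_on_def using assms(4) by metis
  have K0: "K z = 0" if "norm z \<ge> R" for z using assms(2) R that by force
  \<comment> \<open>Points at distance below 1 either both lie in the compact ball of radius
    \<open>R + 1\<close> or both lie where \<open>K\<close> vanishes.\<close>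
  have "norm (K x - K y) < e" if "dist x y < min d 1" for x y
  proof (cases "norm x \<le> R + 1 \<and> norm y \<le> R + 1")
    case True
    then show ?thesis using d(2)[of y x] that by (simp add: dist_norm)
  next
    case False
    have "norm x \<le> norm y + dist x y" "norm y \<le> norm x + dist x y"
      using norm_triangle_sub[of x y] norm_triangle_sub[of y x] by (auto simp: dist_norm norm_minus_commute)
    then have "norm x \<ge> R" "norm y \<ge> R" using False that by auto
    then show ?thesis using K0 assms(4) by simp
  qed
  then show ?thesis using that[of "min d 1"] d(1) by simp
qed

lemma conv_integrable:
  fixes f :: "'a::euclidean_space \<Rightarrow> 'b::euclidean_space"
  assumes "continuous_on UNIV K" "\<And>x. \<bar>K x\<bar> \<le> M" "integrable lebesgue f"
  shows "integrable lebesgue (\<lambda>y. K (x - y) *\<^sub>R f y)"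
proof (rule Bochner_Integration.integrable_bound[where f="\<lambda>y. M *\<^sub>R f y"])
  have [measurable]: "(\<lambda>y. K (x - y)) \<in> borel_measurable lebesgue"
    by (intro continuous_imp_lebesgue_measurable continuous_on_compose2[OF assms(1)] continuous_intros) auto
  have [measurable]: "f \<in> borel_measurable lebesgue" using assms by simp
  show "(\<lambda>y. K (x - y) *\<^sub>R f y) \<in> borel_measurable lebesgue" by measurable
  show "AE y in lebesgue. norm (K (x - y) *\<^sub>R f y) \<le> norm (M *\<^sub>R f y)"
    using assms(2) by (intro AE_I2) (auto intro!: mult_right_mono order_trans[OF assms(2)])
qed (use assms in auto)

lemma conv_integrable_support:
  fixes f :: "'a::euclidean_space \<Rightarrow> 'b::euclidean_space"
  assumes "continuous_on UNIV K" "\<And>x. x \<notin> S \<Longrightarrow> K x = 0" "bounded S" "integrable lebesgue f"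
  shows "integrable lebesgue (\<lambda>y. K (x - y) *\<^sub>R f y)"
proof -
  obtain M where "\<And>x. norm (K x) \<le> M" using bounded_continuous_support[OF assms(1-3)] by blast
  then show ?thesis using assms by (intro conv_integrable[where M=M]) auto
qed

lemma conv_continuous:
  fixes f :: "'a::euclidean_space \<Rightarrow> 'b::euclidean_space"
  assumes K: "continuous_on UNIV K" "\<And>x. x \<notin> S \<Longrightarrow> K x = 0" "bounded S" and f: "integrable lebesgue f"
  shows "continuous_on UNIV (conv K f)"
proof -
  define I where "I = (\<integral>y. norm (f y) \<partial>lebesgue)"
  have I: "I \<ge> 0" by (simp add: I_def)
  note int = conv_integrable_support[OF K f]
  have "\<exists>d>0. \<forall>x'. dist x' x < d \<longrightarrow> dist (conv K f x') (conv K f x) < e" if e: "e > 0" for x e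
  proof -
    have "e / (I + 1) > 0" using e I by simp
    then obtain d where d: "d > 0" "\<And>x y. dist x y < d \<Longrightarrow> norm (K x - K y) < e / (I + 1)"
      using uniformly_continuous_support[OF K] by blast
    have "dist (conv K f x') (conv K f x) < e" if "dist x' x < d" for x'
    proof -
      have "conv K f x' - conv K f x = (\<integral>y. (K (x' - y) - K (x - y)) *\<^sub>R f y \<partial>lebesgue)"
        unfolding conv_def by (simp add: int scaleR_diff_left)
      also have "norm \<dots> \<le> (\<integral>y. e / (I + 1) * norm (f y) \<partial>lebesgue)"
      proof (rule Bochner_Integration.integral_norm_bound_integral)
        show "integrable lebesgue (\<lambda>y. (K (x' - y) - K (x - y)) *\<^sub>R f y)"
          using int by (simp add: scaleR_diff_left)
        show "norm ((K (x' - y) - K (x - y)) *\<^sub>R f y) \<le> e / (I + 1) * norm (f y)" for y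
          unfolding norm_scaleR using d(2)[of "x' - y" "x - y"] that
          by (intro mult_right_mono) (auto simp: dist_norm)
      qed (use f in auto)
      also have "\<dots> = e / (I + 1) * I" by (simp add: I_def)
      also have "\<dots> < e" using e I by (simp add: field_simps)
      finally show ?thesis by (simp add: dist_norm)
    qed
    then show ?thesis using d(1) by blast
  qed
  then show ?thesis unfolding continuous_on_iff by blast
qed

text \<open>The gradient of \<open>K\<close> is uniformly continuous, so the linearisation error of
  \<open>K\<close> is small relative to \<open>norm h\<close> uniformly in the base point, and
  integration against \<open>f\<close> preserves this. The componentwise formula says that
  derivatives of a convolution are convolutions again, which drives the induction for higher
  derivatives.\<close>

lemma conv_C1_grad:
  fixes f :: "'a::euclidean_space \<Rightarrow> real"
  assumes K: "C1_grad K K'" "\<And>x. x \<notin> S \<Longrightarrow> K x = 0" "bounded S" "closed S" and f: "integrable lebesgue f"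
  shows "C1_grad (conv K f) (\<lambda>x. \<integral>y. f y *\<^sub>R K' (x - y) \<partial>lebesgue)"
    and "\<And>x. integrable lebesgue (\<lambda>y. f y *\<^sub>R K' (x - y))"
    and "\<And>x b. (\<integral>y. f y *\<^sub>R K' (x - y) \<partial>lebesgue) \<bullet> b = conv (\<lambda>z. K' z \<bullet> b) f x"
proof -
  define I where "I = (\<integral>y. norm (f y) \<partial>lebesgue)"
  have I: "I \<ge> 0" by (simp add: I_def)
  note Kc = C1_grad_continuous[OF K(1), of UNIV] and K'c = C1_grad_continuous'[OF K(1), of UNIV]
  have K'0: "K' x = 0" if "x \<notin> S" for x using C1_grad_eq_0[OF K(1,2,4)] that by blast
  note int = conv_integrable_support[OF Kc K(2,3) f]
  have fm [measurable]: "f \<in> borel_measurable lebesgue" using f by simp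
  obtain M where M: "\<And>x. norm (K' x) \<le> M" using bounded_continuous_support[OF K'c K'0 K(3)] by blast
  show int': "integrable lebesgue (\<lambda>y. f y *\<^sub>R K' (x - y))" for x
  proof (rule Bochner_Integration.integrable_bound[where f="\<lambda>y. M *\<^sub>R f y"])
    have [measurable]: "(\<lambda>y. K' (x - y)) \<in> borel_measurable lebesgue"
      by (intro continuous_imp_lebesgue_measurable continuous_on_compose2[OF K'c] continuous_intros) auto
    show "(\<lambda>y. f y *\<^sub>R K' (x - y)) \<in> borel_measurable lebesgue" by measurable
    show "AE y in lebesgue. norm (f y *\<^sub>R K' (x - y)) \<le> norm (M *\<^sub>R f y)"
      using M by (intro AE_I2) (auto simp: abs_mult mult.commute[of "\<bar>f _\<bar>"] intro!: mult_right_mono order_trans[OF M])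
  qed (use f in auto)
  show comp: "(\<integral>y. f y *\<^sub>R K' (x - y) \<partial>lebesgue) \<bullet> b = conv (\<lambda>z. K' z \<bullet> b) f x" for x b
    using integral_inner_left[OF int', of x b] by (simp add: conv_def mult.commute)
  show "C1_grad (conv K f) (\<lambda>x. \<integral>y. f y *\<^sub>R K' (x - y) \<partial>lebesgue)"
    unfolding C1_grad_def
  proof (intro conjI allI)
    show "continuous_on UNIV (\<lambda>x. \<integral>y. f y *\<^sub>R K' (x - y) \<partial>lebesgue)"
      by (subst continuous_on_componentwise, unfold comp, intro ballI conv_continuous[OF _ _ K(3) f])
         (auto intro!: continuous_intros K'c simp: K'0)
    fix x
    let ?D = "\<integral>y. f y *\<^sub>R K' (x - y) \<partial>lebesgue"
    show "(conv K f has_derivative (\<lambda>h. ?D \<bullet> h)) (at x)"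
      unfolding has_derivative_at_alt
    proof (intro conjI allI impI)
      show "bounded_linear (\<lambda>h. ?D \<bullet> h)" by (rule bounded_linear_inner_right)
      fix e :: real assume e: "e > 0"
      have "e / (I + 1) > 0" using e I by simp
      then obtain d where d: "d > 0" "\<And>x y. dist x y < d \<Longrightarrow> norm (K' x - K' y) < e / (I + 1)"
        using uniformly_continuous_support[OF K'c K'0 K(3)] by blast
      have key: "norm (K (z + h) - K z - K' z \<bullet> h) \<le> norm h * (e / (I + 1))" if "norm h < d" for z h
      proof -
        have "norm (K (z + h) - K z - K' z \<bullet> (z + h - z)) \<le> norm (z + h - z) * (e / (I + 1))"
        proof (rule differentiable_bound_linearization[where S="ball z d" and f'="\<lambda>x h. K' x \<bullet> h"])
          show "z + t *\<^sub>R (z + h - z) \<in> ball z d" if "t \<in> {0..1}" for t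
          proof -
            have "\<bar>t\<bar> * norm h \<le> 1 * norm h" using that by (intro mult_right_mono) auto
            then show ?thesis using \<open>norm h < d\<close> by (simp add: dist_norm)
          qed
          show "(K has_derivative (\<bullet>) (K' y)) (at y within ball z d)" for y
            by (rule has_derivative_at_withinI[OF C1_gradD[OF K(1)]])
          show "onorm ((\<bullet>) (K' y) - (\<bullet>) (K' z)) \<le> e / (I + 1)" if "y \<in> ball z d" for y
          proof (rule onorm_le)
            fix v
            have "norm (((\<bullet>) (K' y) - (\<bullet>) (K' z)) v) = \<bar>(K' y - K' z) \<bullet> v\<bar>" by (simp add: inner_diff_left)
            also have "\<dots> \<le> norm (K' y - K' z) * norm v" by (rule Cauchy_Schwarz_ineq2)
            also have "\<dots> \<le> e / (I + 1) * norm v"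
              using d(2)[of y z] that by (intro mult_right_mono) (auto simp: dist_commute)
            finally show "norm (((\<bullet>) (K' y) - (\<bullet>) (K' z)) v) \<le> e / (I + 1) * norm v" .
          qed
        qed (use d in auto)
        then show ?thesis by simp
      qed
      have "norm (conv K f x' - conv K f x - ?D \<bullet> (x' - x)) \<le> e * norm (x' - x)" if "norm (x' - x) < d" for x'
      proof -
        define h where "h = x' - x"
        have x': "x' = x + h" by (simp add: h_def)
        have i3: "integrable lebesgue (\<lambda>y. f y * (K' (x - y) \<bullet> h))"
          using integrable_inner_left[OF int', of x h] by simp
        have 3: "?D \<bullet> h = (\<integral>y. f y * (K' (x - y) \<bullet> h) \<partial>lebesgue)"
          using integral_inner_left[OF int', of x h] by simp
        have "conv K f x' - conv K f x - ?D \<bullet> h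
            = (\<integral>y. (K (x - y + h) - K (x - y) - K' (x - y) \<bullet> h) * f y \<partial>lebesgue)"
          unfolding conv_def 3 using int[of x] int[of x'] i3
          by (simp add: x' left_diff_distrib algebra_simps)
        also have "norm \<dots> \<le> (\<integral>y. (norm h * (e / (I + 1))) * norm (f y) \<partial>lebesgue)"
        proof (rule Bochner_Integration.integral_norm_bound_integral)
          show "integrable lebesgue (\<lambda>y. (K (x - y + h) - K (x - y) - K' (x - y) \<bullet> h) * f y)"
            using int[of x] int[of x'] i3 by (simp add: x' left_diff_distrib algebra_simps)
          show "norm ((K (x - y + h) - K (x - y) - K' (x - y) \<bullet> h) * f y) \<le> norm h * (e / (I + 1)) * norm (f y)" for y
            unfolding norm_mult using key[of h "x - y"] that
            by (intro mult_right_mono) (simp_all add: h_def)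
        qed (use f in auto)
        also have "\<dots> = (norm h * (e / (I + 1))) * I" by (simp add: I_def)
        also have "\<dots> \<le> e * norm h" using e I by (simp add: field_simps mult_left_mono)
        finally show ?thesis by (simp add: h_def)
      qed
      then show "\<exists>d>0. \<forall>y. norm (y - x) < d \<longrightarrow> norm (conv K f y - conv K f x - ?D \<bullet> (y - x)) \<le> e * norm (y - x)"
        using d(1) by blast
    qed
  qed
qed

lemma Ck_Suc_0: "Ck (Suc k) f \<Longrightarrow> Ck (Suc 0) f"
  by (induction k) (blast dest: Ck_SucD)+

lemma conv_Ck:
  fixes f :: "'a::euclidean_space \<Rightarrow> real"
  assumes "Ck k K" "\<And>x. x \<notin> S \<Longrightarrow> K x = 0" "bounded S" "closed S" "integrable lebesgue f"
  shows "Ck k (conv K f)"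
  using assms
proof (induction k arbitrary: K)
  case 0
  then show ?case using conv_continuous[of K S f] by simp
next
  case (Suc k)
  have K: "C1_grad K (grad K)" using Suc.prems(1) by (intro Ck_imp_C1_grad Ck_Suc_0)
  note * = conv_C1_grad[OF K Suc.prems(2-5)]
  show ?case
  proof (rule Ck_SucI)
    show "(conv K f has_derivative (\<lambda>h. (\<integral>y. f y *\<^sub>R grad K (x - y) \<partial>lebesgue) \<bullet> h)) (at x)" for x
      by (rule C1_gradD[OF *(1)])
    fix b :: 'a assume b: "b \<in> Basis"
    have "Ck k (\<lambda>z. grad K z \<bullet> b)"
      using Suc.prems(1) b by (simp flip: C1_grad_frechet[OF K])
    then show "Ck k (\<lambda>x. (\<integral>y. f y *\<^sub>R grad K (x - y) \<partial>lebesgue) \<bullet> b)"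
      using Suc.IH[of "\<lambda>z. grad K z \<bullet> b"] Suc.prems(3-5) C1_grad_eq_0[OF K Suc.prems(2,4)]
      by (simp add: *(3))
  qed
qed

lemma conv_smooth:
  fixes f :: "'a::euclidean_space \<Rightarrow> real"
  assumes "smooth K" "\<And>x. x \<notin> S \<Longrightarrow> K x = 0" "bounded S" "closed S" "integrable lebesgue f"
  shows "smooth (conv K f)"
  using assms conv_Ck unfolding smooth_def by blast

section \<open>Uniqueness of weak gradients\<close>

lemma integrable_continuous_support_lebesgue:
  fixes f :: "'a::euclidean_space \<Rightarrow> 'b::euclidean_space"
  assumes "continuous_on UNIV f" "\<And>x. x \<notin> S \<Longrightarrow> f x = 0" "bounded S"
  shows "integrable lebesgue f"
  using integrable_continuous_support[of f S] assms
  by (simp add: integrable_completion borel_measurable_continuous_onI)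

text \<open>Tonelli together with translation invariance. The interchange takes place over
  \<open>lborel\<close>, so \<open>h\<close> is first exchanged for a Borel function that agrees
  with it almost everywhere.\<close>

lemma nn_integral_conv:
  fixes K :: "'a::euclidean_space \<Rightarrow> real" and h :: "'a \<Rightarrow> ennreal"
  assumes [measurable]: "K \<in> borel_measurable borel" and h: "h \<in> borel_measurable lebesgue"
  shows "(\<integral>\<^sup>+x. (\<integral>\<^sup>+y. ennreal (K (x - y)) * h y \<partial>lebesgue) \<partial>lebesgue) = (\<integral>\<^sup>+z. ennreal (K z) \<partial>lborel) * (\<integral>\<^sup>+y. h y \<partial>lebesgue)"
proof -
  obtain h' where [measurable]: "h' \<in> borel_measurable lborel" and h': "AE x in lborel. h x = h' x"
    using completion_ex_borel_measurable[OF h] by blast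
  have "(\<integral>\<^sup>+y. ennreal (K (x - y)) * h y \<partial>lebesgue) = (\<integral>\<^sup>+y. ennreal (K (x - y)) * h' y \<partial>lborel)" for x
    unfolding nn_integral_completion by (rule nn_integral_cong_AE) (use h' in eventually_elim, simp)
  then have "(\<integral>\<^sup>+x. (\<integral>\<^sup>+y. ennreal (K (x - y)) * h y \<partial>lebesgue) \<partial>lebesgue)
      = (\<integral>\<^sup>+x. (\<integral>\<^sup>+y. ennreal (K (x - y)) * h' y \<partial>lborel) \<partial>lborel)"
    by (simp add: nn_integral_completion)
  also have "\<dots> = (\<integral>\<^sup>+y. (\<integral>\<^sup>+x. ennreal (K (x - y)) * h' y \<partial>lborel) \<partial>lborel)"
    by (rule lborel_pair.Fubini') measurable
  also have "\<dots> = (\<integral>\<^sup>+y. (\<integral>\<^sup>+z. ennreal (K z) \<partial>lborel) * h' y \<partial>lborel)"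
  proof (rule nn_integral_cong)
    fix y :: 'a
    have "(\<integral>\<^sup>+x. ennreal (K (x - y)) * h' y \<partial>lborel) = (\<integral>\<^sup>+x. ennreal (K (- y + 1 *\<^sub>R x)) \<partial>lborel) * h' y"
      by (simp add: nn_integral_multc)
    also have "(\<integral>\<^sup>+x. ennreal (K (- y + 1 *\<^sub>R x)) \<partial>lborel) = (\<integral>\<^sup>+z. ennreal (K z) \<partial>lborel)"
      using nn_integral_lborel_affine[of "\<lambda>x. ennreal (K x)" 1 "- y"] by simp
    finally show "(\<integral>\<^sup>+x. ennreal (K (x - y)) * h' y \<partial>lborel) = (\<integral>\<^sup>+z. ennreal (K z) \<partial>lborel) * h' y" .
  qed
  also have "\<dots> = (\<integral>\<^sup>+z. ennreal (K z) \<partial>lborel) * (\<integral>\<^sup>+y. h' y \<partial>lborel)"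
    by (rule nn_integral_cmult) simp
  also have "(\<integral>\<^sup>+y. h' y \<partial>lborel) = (\<integral>\<^sup>+y. h y \<partial>lebesgue)"
    unfolding nn_integral_completion by (rule nn_integral_cong_AE) (use h' in eventually_elim, simp)
  finally show ?thesis .
qed

lemma integral_reflect_lebesgue:
  fixes K :: "'a::euclidean_space \<Rightarrow> 'b::euclidean_space"
  assumes K: "continuous_on UNIV K"
  shows "(\<integral>y. K (x - y) \<partial>lebesgue) = integral\<^sup>L lborel K"
proof -
  have [measurable]: "K \<in> borel_measurable borel" by (rule borel_measurable_continuous_onI[OF K])
  have "integral\<^sup>L lborel K = (\<integral>y. K (x + (-1) *\<^sub>R y) \<partial>lborel)"
    using integral_lborel_affine[of K "-1" x] by simp
  also have "\<dots> = (\<integral>y. K (x - y) \<partial>lebesgue)" by (subst integral_completion) simp_all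
  finally show ?thesis ..
qed

lemma mollifierD:
  assumes "mollifier w A \<delta> K K'" "\<delta> > 0"
  shows "smooth K" "C1_grad K K'" "continuous_on S K" "continuous_on S K'" "0 \<le> K z"
    "integral\<^sup>L lborel K = 1" "(\<integral>z. norm (K' z) \<partial>lborel) \<le> A / \<delta>"
    "z \<notin> cball (\<delta> *\<^sub>R w) \<delta> \<Longrightarrow> K z = 0" "z \<notin> cball (\<delta> *\<^sub>R w) \<delta> \<Longrightarrow> K' z = 0"
    "\<delta> * (norm w + 1) < norm z \<Longrightarrow> K z = 0" "\<delta> * (norm w + 1) < norm z \<Longrightarrow> K' z = 0"
    "integrable lborel K" "(\<integral>\<^sup>+z. ennreal (K z) \<partial>lborel) = 1" "K \<in> borel_measurable borel"
proof -
  show *: "smooth K" "C1_grad K K'" "0 \<le> K z"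
    "integral\<^sup>L lborel K = 1" "(\<integral>z. norm (K' z) \<partial>lborel) \<le> A / \<delta>" for z
    using assms by (auto simp: mollifier_def)
  show 0: "K z = 0" "K' z = 0" if "z \<notin> cball (\<delta> *\<^sub>R w) \<delta>" for z
    using that assms by (auto simp: mollifier_def)
  show c: "continuous_on S K" "continuous_on S K'" for S
    using C1_grad_continuous C1_grad_continuous' *(2) by blast+
  have "z \<notin> cball (\<delta> *\<^sub>R w) \<delta>" if "\<delta> * (norm w + 1) < norm z" for z
  proof
    assume "z \<in> cball (\<delta> *\<^sub>R w) \<delta>"
    then have "norm z \<le> norm (\<delta> *\<^sub>R w) + \<delta>"
      using norm_triangle_sub[of z "\<delta> *\<^sub>R w"] by (auto simp: dist_norm norm_minus_commute)
    then show False using that assms(2) by (simp add: algebra_simps)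
  qed
  then show "\<delta> * (norm w + 1) < norm z \<Longrightarrow> K z = 0" "\<delta> * (norm w + 1) < norm z \<Longrightarrow> K' z = 0"
    using 0 by blast+
  show i: "integrable lborel K"
    using integrable_continuous_support[OF c(1) 0(1) bounded_cball] by blast
  show "(\<integral>\<^sup>+z. ennreal (K z) \<partial>lborel) = 1"
    using nn_integral_eq_integral[OF i] * by simp
  show "K \<in> borel_measurable borel" by (rule borel_measurable_continuous_onI[OF c(1)])
qed

text \<open>The vanishing integral of \<open>K'\<close> is the key item: it permits subtracting a
  constant from a function that is integrated against \<open>K'\<close>.\<close>

lemma mollifier_integral_reflect:
  assumes "mollifier w A \<delta> K K'" "\<delta> > 0"
  shows "(\<integral>y. K (x - y) \<partial>lebesgue) = 1" "integrable lebesgue (\<lambda>y. K (x - y))"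
    "(\<integral>y. norm (K' (x - y)) \<partial>lebesgue) \<le> A / \<delta>" "integrable lebesgue (\<lambda>y. K' (x - y))"
    "(\<integral>y. K' (x - y) \<partial>lebesgue) = 0"
proof -
  note m = mollifierD[OF assms]
  have c: "continuous_on UNIV (\<lambda>z. norm (K' z))" by (intro continuous_intros m)
  show "(\<integral>y. K (x - y) \<partial>lebesgue) = 1" "(\<integral>y. norm (K' (x - y)) \<partial>lebesgue) \<le> A / \<delta>"
    using integral_reflect_lebesgue[OF m(3)] integral_reflect_lebesgue[OF c] m(6,7) by auto
  have "integral\<^sup>L lborel K' = 0"
    using integral_C1_grad_eq_0[OF m(2) m(8) bounded_cball] by blast
  then show "(\<integral>y. K' (x - y) \<partial>lebesgue) = 0"
    using integral_reflect_lebesgue[OF m(4)] by auto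
  have z: "x - y \<notin> cball (\<delta> *\<^sub>R w) \<delta>" if "y \<notin> cball (x - \<delta> *\<^sub>R w) \<delta>" for y
    using that by (simp add: dist_norm algebra_simps norm_minus_commute)
  have cd: "continuous_on UNIV (\<lambda>y. x - y)" by (intro continuous_intros)
  have cc: "continuous_on UNIV (\<lambda>y. K (x - y))" "continuous_on UNIV (\<lambda>y. K' (x - y))"
    using continuous_on_compose2[OF m(3)[of UNIV] cd] continuous_on_compose2[OF m(4)[of UNIV] cd] by simp_all
  have "integrable lborel (\<lambda>y. K (x - y))" "integrable lborel (\<lambda>y. K' (x - y))"
    using integrable_continuous_support[OF cc(1) _ bounded_cball[of "x - \<delta> *\<^sub>R w" \<delta>]]
     integrable_continuous_support[OF cc(2) _ bounded_cball[of "x - \<delta> *\<^sub>R w" \<delta>]] m(8,9) z by blast+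
  then show "integrable lebesgue (\<lambda>y. K (x - y))" "integrable lebesgue (\<lambda>y. K' (x - y))"
    by (simp_all add: integrable_completion)
qed

lemma mollifier_conv_integrable:
  fixes f :: "'a::euclidean_space \<Rightarrow> 'b::euclidean_space"
  assumes "mollifier w A \<delta> K K'" "\<delta> > 0" "integrable lebesgue f"
  shows "integrable lebesgue (\<lambda>y. K (x - y) *\<^sub>R f y)"
  using conv_integrable_support[of K "cball (\<delta> *\<^sub>R w) \<delta>" f x] mollifierD[OF assms(1,2)] assms(3) by blast

lemma mollifier_conv_continuous:
  fixes f :: "'a::euclidean_space \<Rightarrow> 'b::euclidean_space"
  assumes "mollifier w A \<delta> K K'" "\<delta> > 0" "integrable lebesgue f"
  shows "continuous_on UNIV (conv K f)"
  using conv_continuous[of K "cball (\<delta> *\<^sub>R w) \<delta>" f] mollifierD[OF assms(1,2)] assms(3) by blast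

lemma norm_conv_le:
  fixes f :: "'a::euclidean_space \<Rightarrow> 'b::euclidean_space"
  assumes "mollifier w A \<delta> K K'" "\<delta> > 0" "integrable lebesgue f"
  shows "ennreal (norm (conv K f x)) \<le> (\<integral>\<^sup>+y. ennreal (K (x - y)) * ennreal (norm (f y)) \<partial>lebesgue)"
proof -
  have "ennreal (norm (conv K f x)) \<le> (\<integral>\<^sup>+y. ennreal (norm (K (x - y) *\<^sub>R f y)) \<partial>lebesgue)"
    unfolding conv_def by (intro integral_norm_bound_ennreal mollifier_conv_integrable[OF assms])
  also have "\<dots> = (\<integral>\<^sup>+y. ennreal (K (x - y)) * ennreal (norm (f y)) \<partial>lebesgue)"
    using mollifierD(5)[OF assms(1,2)] by (intro nn_integral_cong) (simp add: ennreal_mult)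
  finally show ?thesis .
qed

lemma conv_L1_le:
  fixes f :: "'a::euclidean_space \<Rightarrow> 'b::euclidean_space"
  assumes "mollifier w A \<delta> K K'" "\<delta> > 0" "integrable lebesgue f"
  shows "(\<integral>\<^sup>+x. norm (conv K f x) \<partial>lebesgue) \<le> (\<integral>\<^sup>+x. norm (f x) \<partial>lebesgue)"
proof -
  have [measurable]: "f \<in> borel_measurable lebesgue" using assms(3) by simp
  note m = mollifierD[OF assms(1,2)]
  have "(\<integral>\<^sup>+x. norm (conv K f x) \<partial>lebesgue)
      \<le> (\<integral>\<^sup>+x. (\<integral>\<^sup>+y. ennreal (K (x - y)) * ennreal (norm (f y)) \<partial>lebesgue) \<partial>lebesgue)"
    by (intro nn_integral_mono norm_conv_le[OF assms])
  also have "\<dots> = (\<integral>\<^sup>+x. norm (f x) \<partial>lebesgue)"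
    by (subst nn_integral_conv) (use m(13,14) in auto)
  finally show ?thesis .
qed

text \<open>Convolution does not increase the L1 norm, so it suffices to treat a uniformly
  continuous \<open>h\<close> of bounded support that is close to \<open>f\<close>. The threshold is
  uniform over all kernels for the given \<open>w\<close> and \<open>A\<close>; thus one kernel can
  later serve two functions at once.\<close>

lemma conv_tendsto_L1:
  fixes f :: "'a::euclidean_space \<Rightarrow> 'b::euclidean_space"
  assumes f: "integrable lebesgue f" and e: "e > 0"
  obtains d where "d > 0"
    "\<And>\<delta> K K'. 0 < \<delta> \<Longrightarrow> \<delta> < d \<Longrightarrow> mollifier w A \<delta> K K' \<Longrightarrow> (\<integral>\<^sup>+x. norm (conv K f x - f x) \<partial>lebesgue) \<le> ennreal e"
proof -
  have e3: "e / 3 > 0" using e by simp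
  obtain h R where hc: "continuous_on UNIV h" and h0: "\<And>x. x \<notin> cball 0 R \<Longrightarrow> h x = 0"
    and fh: "(\<integral>\<^sup>+x. norm (f x - h x) \<partial>lebesgue) \<le> ennreal (e / 3)"
    using ex_continuous_support_approx[OF f e3] by blast
  have hi: "integrable lebesgue h"
    using integrable_continuous_support_lebesgue[OF hc _ bounded_cball[of 0 R]] h0 by blast
  have fhi: "integrable lebesgue (\<lambda>x. f x - h x)" using f hi by simp
  have [measurable]: "f \<in> borel_measurable lebesgue" "h \<in> borel_measurable lebesgue" using f hi by auto
  define V where "V = measure lebesgue (cball (0::'a) (R + 1))"
  have V: "V \<ge> 0" by (simp add: V_def)
  have eV: "e / 3 / (V + 1) > 0" using e V by simp
  obtain d where d: "d > 0" "\<And>x y. dist x y < d \<Longrightarrow> norm (h x - h y) < e / 3 / (V + 1)"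
    using uniformly_continuous_support[OF hc h0 bounded_cball eV] by blast
  \<comment> \<open>Below this threshold the kernel lives within \<open>min d 1\<close> of the
    origin: \<open>d\<close> controls the oscillation of \<open>h\<close>, and 1 keeps
    \<open>conv K h\<close> inside the ball of radius \<open>R + 1\<close>, whose volume is
    \<open>V\<close>.\<close>
  define d' where "d' = min d 1 / (norm w + 2)"
  have nw: "norm w + 2 > 0" by (simp add: add_nonneg_pos)
  have d': "d' > 0" using d nw by (simp add: d'_def)
  have "(\<integral>\<^sup>+x. norm (conv K f x - f x) \<partial>lebesgue) \<le> ennreal e"
    if \<delta>: "0 < \<delta>" "\<delta> < d'" and mo: "mollifier w A \<delta> K K'" for \<delta> K K'
  proof -
    note m = mollifierD[OF mo \<delta>(1)]
    have small: "\<delta> * (norm w + 1) < min d 1"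
    proof -
      have "\<delta> * (norm w + 1) \<le> \<delta> * (norm w + 2)" using \<delta> by simp
      also have "\<dots> < min d 1" using \<delta>(2) nw by (simp add: d'_def field_simps)
      finally show ?thesis .
    qed
    have hh: "norm (conv K h x - h x) \<le> e / 3 / (V + 1) * indicator (cball 0 (R + 1)) x" for x
    proof (cases "x \<in> cball 0 (R + 1)")
      case True
      have i1: "integrable lebesgue (\<lambda>y. K (x - y) *\<^sub>R h y)"
        by (rule mollifier_conv_integrable[OF mo \<delta>(1) hi])
      have i2: "integrable lebesgue (\<lambda>y. K (x - y) *\<^sub>R h x)"
        by (intro integrable_scaleR_left mollifier_integral_reflect[OF mo \<delta>(1)])
      have "conv K h x - h x = (\<integral>y. K (x - y) *\<^sub>R (h y - h x) \<partial>lebesgue)"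
        unfolding scaleR_diff_right conv_def using i1 i2 mollifier_integral_reflect[OF mo \<delta>(1)]
        by simp
      also have "norm \<dots> \<le> (\<integral>y. K (x - y) * (e / 3 / (V + 1)) \<partial>lebesgue)"
      proof (rule Bochner_Integration.integral_norm_bound_integral)
        show "integrable lebesgue (\<lambda>y. K (x - y) *\<^sub>R (h y - h x))"
          unfolding scaleR_diff_right using i1 i2 by simp
        show "integrable lebesgue (\<lambda>y. K (x - y) * (e / 3 / (V + 1)))"
          by (intro integrable_mult_left mollifier_integral_reflect[OF mo \<delta>(1)])
        show "norm (K (x - y) *\<^sub>R (h y - h x)) \<le> K (x - y) * (e / 3 / (V + 1))" for y
        proof (cases "norm (x - y) \<le> \<delta> * (norm w + 1)")
          case True
          then have "norm (h y - h x) < e / 3 / (V + 1)"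
            using d(2)[of y x] small by (simp add: dist_norm norm_minus_commute)
          then show ?thesis unfolding norm_scaleR using m(5)[of "x - y"] by (intro mult_mono) auto
        qed (use m(10) in auto)
      qed
      also have "\<dots> = e / 3 / (V + 1)" using mollifier_integral_reflect(1)[OF mo \<delta>(1)] by simp
      finally show ?thesis using True by simp
    next
      case False
      have "K (x - y) *\<^sub>R h y = 0" for y
      proof (cases "y \<in> cball 0 R")
        case True
        have "norm x \<le> norm (x - y) + norm y" by (metis diff_add_cancel norm_triangle_ineq)
        then have "norm (x - y) > \<delta> * (norm w + 1)" using True False small by simp
        then show ?thesis using m(10) by simp
      qed (simp add: h0)
      then have "(\<lambda>y. K (x - y) *\<^sub>R h y) = (\<lambda>y. 0)" by blast
      then have "conv K h x = 0" by (simp only: conv_def) simp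
      moreover have "h x = 0" using False by (intro h0) simp
      ultimately show ?thesis using False by simp
    qed
    have cm: "conv K f \<in> borel_measurable lebesgue" "conv K h \<in> borel_measurable lebesgue"
        "conv K (\<lambda>x. f x - h x) \<in> borel_measurable lebesgue"
      by (intro continuous_imp_lebesgue_measurable mollifier_conv_continuous[OF mo \<delta>(1)] f hi fhi)+
    note [measurable] = cm
    have diff: "conv K f x = conv K (\<lambda>x. f x - h x) x + conv K h x" for x
      unfolding conv_def scaleR_diff_right using mollifier_conv_integrable[OF mo \<delta>(1) f] mollifier_conv_integrable[OF mo \<delta>(1) hi] by simp
    have "norm (conv K f x - f x) \<le> norm (conv K (\<lambda>x. f x - h x) x) + norm (conv K h x - h x) + norm (f x - h x)" for x
    proof -
      have "conv K f x - f x = conv K (\<lambda>x. f x - h x) x + (conv K h x - h x) - (f x - h x)"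
        by (simp add: diff)
      then show ?thesis
        using norm_triangle_ineq4[of "conv K (\<lambda>x. f x - h x) x + (conv K h x - h x)" "f x - h x"]
          norm_triangle_ineq[of "conv K (\<lambda>x. f x - h x) x" "conv K h x - h x"] by simp
    qed
    then have "(\<integral>\<^sup>+x. norm (conv K f x - f x) \<partial>lebesgue) \<le>
        (\<integral>\<^sup>+x. ennreal (norm (conv K (\<lambda>x. f x - h x) x)) + ennreal (norm (conv K h x - h x)) + ennreal (norm (f x - h x)) \<partial>lebesgue)"
      by (intro nn_integral_mono) (simp flip: ennreal_plus)
    also have "\<dots> = (\<integral>\<^sup>+x. norm (conv K (\<lambda>x. f x - h x) x) \<partial>lebesgue) + (\<integral>\<^sup>+x. norm (conv K h x - h x) \<partial>lebesgue)
         + (\<integral>\<^sup>+x. norm (f x - h x) \<partial>lebesgue)"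
      by (simp add: nn_integral_add)
    also have "\<dots> \<le> ennreal (e / 3) + ennreal (e / 3) + ennreal (e / 3)"
    proof (intro add_mono)
      show "(\<integral>\<^sup>+x. norm (conv K (\<lambda>x. f x - h x) x) \<partial>lebesgue) \<le> ennreal (e / 3)"
        using conv_L1_le[OF mo \<delta>(1) fhi] fh by (rule order_trans)
      have "(\<integral>\<^sup>+x. norm (conv K h x - h x) \<partial>lebesgue)
          \<le> (\<integral>\<^sup>+x. ennreal (e / 3 / (V + 1)) * indicator (cball (0::'a) (R + 1)) x \<partial>lebesgue)"
        by (intro nn_integral_mono order_trans[OF ennreal_leI[OF hh]]) (auto simp: indicator_def)
      also have "\<dots> = ennreal (e / 3 / (V + 1)) * emeasure lebesgue (cball (0::'a) (R + 1))"
        by (rule nn_integral_cmult_indicator) simp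
      also have "emeasure lebesgue (cball (0::'a) (R + 1)) = ennreal V"
        unfolding V_def by (rule emeasure_eq_ennreal_measure) (use emeasure_bounded_finite[OF bounded_cball, of "0::'a" "R + 1"] in auto)
      also have "ennreal (e / 3 / (V + 1)) * ennreal V = ennreal (e / 3 / (V + 1) * V)"
        using e V by (intro ennreal_mult[symmetric]) auto
      also have "\<dots> \<le> ennreal (e / 3)"
        using e V by (intro ennreal_leI) (simp add: field_simps)
      finally show "(\<integral>\<^sup>+x. norm (conv K h x - h x) \<partial>lebesgue) \<le> ennreal (e / 3)" .
    qed (rule fh)
    also have "\<dots> = ennreal e" using e by (simp flip: ennreal_plus)
    finally show ?thesis .
  qed
  then show ?thesis using that d' by blast
qed

lemma Ck_reflect: "Ck k K \<Longrightarrow> Ck k (\<lambda>y. K (x - y))"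
proof (induction k arbitrary: K)
  case 0
  then show ?case by (auto intro!: continuous_on_compose2[of UNIV K] continuous_intros)
next
  case (Suc k)
  show ?case
  proof (rule Ck_SucI)
    show "((\<lambda>y. K (x - y)) has_derivative (\<lambda>h. - frechet_derivative K (at (x - y)) h)) (at y)" for y
    proof -
      have "((\<lambda>y. x - y) has_derivative (\<lambda>h. - h)) (at y)"
        by (auto intro!: derivative_eq_intros)
      from has_derivative_compose[OF this Ck_Suc_has_derivative[OF Suc.prems, of "x - y"]]
      show ?thesis
        using linear_neg[OF has_derivative_linear[OF Ck_Suc_has_derivative[OF Suc.prems]]] by simp
    qed
    fix b :: 'a assume "b \<in> Basis"
    then have "Ck k (\<lambda>y. frechet_derivative K (at (x - y)) b)"
      using Suc.prems by (intro Suc.IH[of "\<lambda>z. frechet_derivative K (at z) b"]) auto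
    then show "Ck k (\<lambda>y. - frechet_derivative K (at (x - y)) b)"
      using Ck_mult[OF Ck_const[of k "-1"]] by fastforce
  qed
qed

section \<open>Test functions and the fundamental lemma\<close>

lemma test_functionsI:
  assumes "smooth \<phi>" "\<And>x. x \<notin> S \<Longrightarrow> \<phi> x = 0" "compact S" "S \<subseteq> \<Omega>"
  shows "\<phi> \<in> test_functions \<Omega>"
proof -
  have "closure {x. \<phi> x \<noteq> 0} \<subseteq> S"
    using assms(2) by (intro closure_minimal compact_imp_closed assms) blast
  then show ?thesis
    using assms unfolding test_functions_def
    by (auto simp: compact_eq_bounded_closed intro: bounded_subset dest: subsetD)
qed

lemma test_functionE:
  assumes "\<phi> \<in> test_functions \<Omega>"
  obtains S where "compact S" "S \<subseteq> \<Omega>" "\<And>x. x \<notin> S \<Longrightarrow> \<phi> x = 0" "\<And>x. x \<notin> S \<Longrightarrow> grad \<phi> x = 0"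
    "C1_grad \<phi> (grad \<phi>)"
proof -
  let ?S = "closure {x. \<phi> x \<noteq> 0}"
  have C: "C1_grad \<phi> (grad \<phi>)"
    using assms by (intro Ck_imp_C1_grad) (simp add: test_functions_def smooth_def)
  have 0: "\<phi> x = 0" if "x \<notin> ?S" for x using that closure_subset[of "{x. \<phi> x \<noteq> 0}"] by blast
  moreover have "grad \<phi> x = 0" if "x \<notin> ?S" for x
    using C1_grad_eq_0[OF C 0 closed_closure] that by blast
  moreover have "compact ?S" "?S \<subseteq> \<Omega>" using assms by (auto simp: test_functions_def)
  ultimately show ?thesis using that C by blast
qed

lemma locally_integrable_mult:
  fixes f :: "'a::euclidean_space \<Rightarrow> 'b::euclidean_space" and \<phi> :: "'a \<Rightarrow> real"
  assumes f: "f locally_integrable_on \<Omega>" and \<phi>: "continuous_on UNIV \<phi>"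
    and S: "compact S" "S \<subseteq> \<Omega>" "\<And>x. x \<notin> S \<Longrightarrow> \<phi> x = 0"
  shows "integrable lebesgue (\<lambda>x. \<phi> x *\<^sub>R f x)" "set_integrable lebesgue \<Omega> (\<lambda>x. \<phi> x *\<^sub>R f x)"
    "(LINT x:\<Omega>|lebesgue. \<phi> x *\<^sub>R f x) = (\<integral>x. \<phi> x *\<^sub>R f x \<partial>lebesgue)"
proof -
  have fS: "integrable lebesgue (\<lambda>x. indicator S x *\<^sub>R f x)"
    using f S by (simp add: locally_integrable_on_def set_integrable_def)
  obtain M where M: "\<And>x. norm (\<phi> x) \<le> M"
    using bounded_continuous_support[OF \<phi> S(3) compact_imp_bounded[OF S(1)]] by blast
  have eq: "\<phi> x *\<^sub>R indicator S x *\<^sub>R f x = \<phi> x *\<^sub>R f x" "indicator \<Omega> x *\<^sub>R \<phi> x *\<^sub>R f x = \<phi> x *\<^sub>R f x" for x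
    using S by (auto simp: indicator_def)
  have "integrable lebesgue (\<lambda>x. \<phi> x *\<^sub>R indicator S x *\<^sub>R f x)"
  proof (rule Bochner_Integration.integrable_bound[where f="\<lambda>x. M *\<^sub>R indicator S x *\<^sub>R f x"])
    have [measurable]: "\<phi> \<in> borel_measurable lebesgue" by (rule continuous_imp_lebesgue_measurable[OF \<phi>])
    show "(\<lambda>x. \<phi> x *\<^sub>R indicator S x *\<^sub>R f x) \<in> borel_measurable lebesgue"
      by (intro borel_measurable_scaleR[of \<phi>] borel_measurable_integrable[OF fS]) auto
    show "AE x in lebesgue. norm (\<phi> x *\<^sub>R indicator S x *\<^sub>R f x) \<le> norm (M *\<^sub>R indicator S x *\<^sub>R f x)"
      unfolding norm_scaleR by (intro AE_I2 mult_right_mono order_trans[OF _ abs_ge_self] mult_nonneg_nonneg) (use M in auto)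
  qed (intro integrable_scaleR_right fS)
  then show i: "integrable lebesgue (\<lambda>x. \<phi> x *\<^sub>R f x)" by (simp only: eq)
  show "set_integrable lebesgue \<Omega> (\<lambda>x. \<phi> x *\<^sub>R f x)"
    "(LINT x:\<Omega>|lebesgue. \<phi> x *\<^sub>R f x) = (\<integral>x. \<phi> x *\<^sub>R f x \<partial>lebesgue)"
    using i unfolding set_integrable_def set_lebesgue_integral_def eq by auto
qed

text \<open>Fundamental lemma of the calculus of variations. Reflected kernels are test functions,
  so the mollifications of a truncation of \<open>g\<close> vanish on a small ball, while they
  converge to it in L1. Countably many such balls cover the open set by Lindelof.\<close>

lemma AE_zero_if_test_integrals_zero:
  fixes g :: "'a::euclidean_space \<Rightarrow> real"
  assumes \<Omega>: "open \<Omega>" and g: "g locally_integrable_on \<Omega>"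
    and 0: "\<And>\<phi>. \<phi> \<in> test_functions \<Omega> \<Longrightarrow> (LINT x:\<Omega>|lebesgue. g x * \<phi> x) = 0"
  shows "AE x in lebesgue. x \<in> \<Omega> \<longrightarrow> g x = 0"
proof -
  have loc: "AE x in lebesgue. x \<in> ball x0 r \<longrightarrow> g x = 0" if r: "r > 0" "cball x0 (2 * r) \<subseteq> \<Omega>" for x0 r
  proof -
    \<comment> \<open>The doubled radius leaves room for the kernels: around each point of
      \<open>ball x0 r\<close> their supports meet only points where \<open>f\<close> equals
      \<open>g\<close>.\<close>
    define f where "f x = indicator (cball x0 (2 * r)) x *\<^sub>R g x" for x
    have f: "integrable lebesgue f"
      using g r unfolding locally_integrable_on_def f_def set_integrable_def by simp
    then have [measurable]: "f \<in> borel_measurable lebesgue" by simp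
    have [measurable]: "ball x0 r \<in> sets lebesgue" by simp
    obtain A where A: "\<And>\<delta>. \<delta> > 0 \<Longrightarrow> \<exists>K K'. mollifier (0::'a) A \<delta> K K'" using ex_mollifier by blast
    have small: "(\<integral>\<^sup>+x. indicator (ball x0 r) x * ennreal (norm (f x)) \<partial>lebesgue) \<le> ennreal e" if e: "e > 0" for e
    proof -
      obtain d where d: "d > 0" "\<And>\<delta> K K'. 0 < \<delta> \<Longrightarrow> \<delta> < d \<Longrightarrow> mollifier (0::'a) A \<delta> K K' \<Longrightarrow>
          (\<integral>\<^sup>+x. norm (conv K f x - f x) \<partial>lebesgue) \<le> ennreal e"
        using conv_tendsto_L1[OF f e, of "0::'a" A] by metis
      define \<delta> where "\<delta> = min d r / 2"
      have \<delta>: "\<delta> > 0" "\<delta> < d" "\<delta> < r" using d(1) r by (auto simp: \<delta>_def)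
      obtain K K' where mo: "mollifier (0::'a) A \<delta> K K'" using A[OF \<delta>(1)] by blast
      note m = mollifierD[OF mo \<delta>(1)]
      have "conv K f x = 0" if x: "x \<in> ball x0 r" for x
      proof -
        have K0: "K (x - y) = 0" if "y \<notin> cball x \<delta>" for y
          using m(8)[of "x - y"] that by (simp add: dist_norm norm_minus_commute)
        have sub: "cball x \<delta> \<subseteq> cball x0 (2 * r)"
        proof
          fix y assume "y \<in> cball x \<delta>"
          then show "y \<in> cball x0 (2 * r)"
            using dist_triangle[of x0 y x] x \<delta>(3) by (simp add: dist_commute)
        qed
        have "(\<lambda>y. K (x - y)) \<in> test_functions \<Omega>"
        proof (rule test_functionsI[OF _ K0])
          show "smooth (\<lambda>y. K (x - y))" using m(1) Ck_reflect unfolding smooth_def by blast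
        qed (use sub r in auto)
        then have "(LINT y:\<Omega>|lebesgue. g y * K (x - y)) = 0" by (rule 0)
        moreover
        have "indicator \<Omega> y *\<^sub>R (g y * K (x - y)) = K (x - y) *\<^sub>R f y" for y
        proof (cases "y \<in> cball x \<delta>")
          case True
          then have "y \<in> cball x0 (2 * r)" "y \<in> \<Omega>" using sub r(2) by auto
          then show ?thesis by (simp add: f_def)
        qed (use K0 in auto)
        then have "(\<lambda>y. indicator \<Omega> y *\<^sub>R (g y * K (x - y))) = (\<lambda>y. K (x - y) *\<^sub>R f y)" by blast
        ultimately show ?thesis by (simp only: conv_def set_lebesgue_integral_def)
      qed
      then have "(\<integral>\<^sup>+x. indicator (ball x0 r) x * ennreal (norm (f x)) \<partial>lebesgue)
          \<le> (\<integral>\<^sup>+x. norm (conv K f x - f x) \<partial>lebesgue)"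
        by (intro nn_integral_mono) (auto simp: indicator_def)
      also have "\<dots> \<le> ennreal e" by (rule d(2)[OF \<delta>(1,2) mo])
      finally show ?thesis .
    qed
    have "(\<integral>\<^sup>+x. indicator (ball x0 r) x * ennreal (norm (f x)) \<partial>lebesgue) \<le> 0"
      by (rule ennreal_le_epsilon) (simp only: add_0 small)
    then have "(\<integral>\<^sup>+x. indicator (ball x0 r) x * ennreal (norm (f x)) \<partial>lebesgue) = 0" by simp
    then have "AE x in lebesgue. indicator (ball x0 r) x * ennreal (norm (f x)) = 0"
      by (subst (asm) nn_integral_0_iff_AE) measurable
    then show ?thesis
    proof eventually_elim
      fix x assume *: "indicator (ball x0 r) x * ennreal (norm (f x)) = 0"
      show "x \<in> ball x0 r \<longrightarrow> g x = 0"
      proof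
        assume "x \<in> ball x0 r"
        moreover from this have "x \<in> cball x0 (2 * r)" using r by simp
        ultimately show "g x = 0" using * by (auto simp: f_def)
      qed
    qed
  qed
  define F where "F = {ball x r | x r. r > 0 \<and> cball x (2 * r) \<subseteq> \<Omega>}"
  have "\<Omega> \<subseteq> \<Union>F"
  proof
    fix x assume "x \<in> \<Omega>"
    then obtain e where e: "e > 0" "cball x e \<subseteq> \<Omega>" using \<Omega> open_contains_cball by blast
    then have "ball x (e/2) \<in> F" unfolding F_def by (intro CollectI exI[of _ x] exI[of _ "e/2"]) auto
    then show "x \<in> \<Union>F" using e by (intro UnionI[of "ball x (e/2)"]) auto
  qed
  moreover obtain F' where F': "F' \<subseteq> F" "countable F'" "\<Union>F' = \<Union>F"
    using Lindelof[of F] unfolding F_def by blast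
  moreover have "AE x in lebesgue. \<forall>B\<in>F'. x \<in> B \<longrightarrow> g x = 0"
    using F'(1) loc by (intro AE_ball_countable'[OF _ F'(2)]) (auto simp: F_def)
  ultimately show ?thesis by (auto elim!: eventually_mono)
qed

section \<open>Calculus of weak gradients\<close>

lemma locally_integrable_diff:
  "f locally_integrable_on \<Omega> \<Longrightarrow> g locally_integrable_on \<Omega> \<Longrightarrow> (\<lambda>x. f x - g x) locally_integrable_on \<Omega>"
  by (simp add: locally_integrable_on_def)

lemma locally_integrable_add:
  "f locally_integrable_on \<Omega> \<Longrightarrow> g locally_integrable_on \<Omega> \<Longrightarrow> (\<lambda>x. f x + g x) locally_integrable_on \<Omega>"
  by (simp add: locally_integrable_on_def)

lemma locally_integrable_inner:
  "f locally_integrable_on \<Omega> \<Longrightarrow> (\<lambda>x. f x \<bullet> b) locally_integrable_on \<Omega>"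
  unfolding locally_integrable_on_def set_integrable_def
  using integrable_inner_left[of b lebesgue "\<lambda>x. indicator _ x *\<^sub>R f x"] by simp

text \<open>Since test functions vanish off \<Omega>, the defining identity becomes one between
  integrals over the whole space, where integrability is explicit and linearity applies.
  \<open>has_weak_gradientI\<close> is the way back.\<close>

lemma has_weak_gradient_integrals:
  assumes "has_weak_gradient \<Omega> u g" "\<phi> \<in> test_functions \<Omega>" "b \<in> Basis"
  shows "integrable lebesgue (\<lambda>x. (grad \<phi> x \<bullet> b) * u x)" "integrable lebesgue (\<lambda>x. \<phi> x * (g x \<bullet> b))"
    "(\<integral>x. (grad \<phi> x \<bullet> b) * u x \<partial>lebesgue) = - (\<integral>x. \<phi> x * (g x \<bullet> b) \<partial>lebesgue)"
proof -
  obtain S where S: "compact S" "S \<subseteq> \<Omega>" "\<And>x. x \<notin> S \<Longrightarrow> \<phi> x = 0" "\<And>x. x \<notin> S \<Longrightarrow> grad \<phi> x = 0"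
    and C: "C1_grad \<phi> (grad \<phi>)" using test_functionE[OF assms(2)] by metis
  have 1: "u locally_integrable_on \<Omega>" "(\<lambda>x. g x \<bullet> b) locally_integrable_on \<Omega>"
    using assms(1) by (auto simp: has_weak_gradient_def intro: locally_integrable_inner)
  have c: "continuous_on UNIV (\<lambda>x. grad \<phi> x \<bullet> b)"
    by (intro continuous_intros C1_grad_continuous'[OF C])
  note * = locally_integrable_mult[OF 1(1) c S(1,2)]
  note ** = locally_integrable_mult[OF 1(2) C1_grad_continuous[OF C] S(1,2)]
  show "integrable lebesgue (\<lambda>x. (grad \<phi> x \<bullet> b) * u x)" "integrable lebesgue (\<lambda>x. \<phi> x * (g x \<bullet> b))"
    using *(1) **(1) S(3,4) by auto
  show "(\<integral>x. (grad \<phi> x \<bullet> b) * u x \<partial>lebesgue) = - (\<integral>x. \<phi> x * (g x \<bullet> b) \<partial>lebesgue)"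
  proof -
    have "(LINT x:\<Omega>|lebesgue. u x * frechet_derivative \<phi> (at x) b) = - (LINT x:\<Omega>|lebesgue. (g x \<bullet> b) * \<phi> x)"
      using assms by (simp add: has_weak_gradient_def)
    then show ?thesis
      using *(3) **(3) S(3,4) by (simp add: C1_grad_frechet[OF C] mult.commute)
  qed
qed

lemma has_weak_gradientI:
  assumes "u locally_integrable_on \<Omega>" "g locally_integrable_on \<Omega>"
    "\<And>\<phi> b. \<phi> \<in> test_functions \<Omega> \<Longrightarrow> b \<in> Basis \<Longrightarrow>
      (\<integral>x. (grad \<phi> x \<bullet> b) * u x \<partial>lebesgue) = - (\<integral>x. \<phi> x * (g x \<bullet> b) \<partial>lebesgue)"
  shows "has_weak_gradient \<Omega> u g"
  unfolding has_weak_gradient_def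
proof (intro conjI ballI assms)
  fix \<phi> and b :: 'a assume \<phi>: "\<phi> \<in> test_functions \<Omega>" and b: "b \<in> Basis"
  obtain S where S: "compact S" "S \<subseteq> \<Omega>" "\<And>x. x \<notin> S \<Longrightarrow> \<phi> x = 0" "\<And>x. x \<notin> S \<Longrightarrow> grad \<phi> x = 0"
    and C: "C1_grad \<phi> (grad \<phi>)" using test_functionE[OF \<phi>] by metis
  have c: "continuous_on UNIV (\<lambda>x. grad \<phi> x \<bullet> b)"
    by (intro continuous_intros C1_grad_continuous'[OF C])
  note * = locally_integrable_mult[OF assms(1) c S(1,2)]
  note ** = locally_integrable_mult[OF locally_integrable_inner[OF assms(2), of b] C1_grad_continuous[OF C] S(1,2)]
  show "(LINT x:\<Omega>|lebesgue. u x * frechet_derivative \<phi> (at x) b) = - (LINT x:\<Omega>|lebesgue. (g x \<bullet> b) * \<phi> x)"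
    using *(3) **(3) S(3,4) assms(3)[OF \<phi> b] by (simp add: C1_grad_frechet[OF C] mult.commute)
qed

lemma weak_gradient_unique:
  assumes \<Omega>: "open \<Omega>" and g: "has_weak_gradient \<Omega> u g" and h: "has_weak_gradient \<Omega> u h"
  shows "AE x in lebesgue. x \<in> \<Omega> \<longrightarrow> g x = h x"
proof -
  have "AE x in lebesgue. x \<in> \<Omega> \<longrightarrow> (g x - h x) \<bullet> b = 0" if b: "b \<in> Basis" for b
  proof (rule AE_zero_if_test_integrals_zero[OF \<Omega>])
    show l: "(\<lambda>x. (g x - h x) \<bullet> b) locally_integrable_on \<Omega>"
      using g h by (auto simp: has_weak_gradient_def intro: locally_integrable_inner locally_integrable_diff)
    fix \<phi> assume \<phi>: "\<phi> \<in> test_functions \<Omega>"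
    obtain S where S: "compact S" "S \<subseteq> \<Omega>" "\<And>x. x \<notin> S \<Longrightarrow> \<phi> x = 0" "\<And>x. x \<notin> S \<Longrightarrow> grad \<phi> x = 0"
      and C: "C1_grad \<phi> (grad \<phi>)" using test_functionE[OF \<phi>] by metis
    note 1 = has_weak_gradient_integrals[OF g \<phi> b] and 2 = has_weak_gradient_integrals[OF h \<phi> b]
    have "(LINT x:\<Omega>|lebesgue. (g x - h x) \<bullet> b * \<phi> x) = (\<integral>x. \<phi> x * (g x \<bullet> b) - \<phi> x * (h x \<bullet> b) \<partial>lebesgue)"
      using locally_integrable_mult(3)[OF l C1_grad_continuous[OF C] S(1,2)] S(3)
      by (simp add: mult.commute inner_diff_left algebra_simps)
    also have "\<dots> = 0" using 1 2 by simp
    finally show "(LINT x:\<Omega>|lebesgue. (g x - h x) \<bullet> b * \<phi> x) = 0" .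
  qed
  then have "AE x in lebesgue. \<forall>b\<in>Basis. x \<in> \<Omega> \<longrightarrow> (g x - h x) \<bullet> b = 0"
    by (intro AE_finite_allI) auto
  then show ?thesis
    by eventually_elim (metis euclidean_all_zero_iff right_minus_eq)
qed

text \<open>Lets any explicit weak gradient stand in for the one picked by
  \<open>SOME\<close>.\<close>

lemma weak_gradient_AE:
  assumes "open \<Omega>" "has_weak_gradient \<Omega> u g"
  shows "AE x in lebesgue. x \<in> \<Omega> \<longrightarrow> weak_gradient \<Omega> u x = g x"
  unfolding weak_gradient_def
  by (rule weak_gradient_unique[OF assms(1) someI[of "has_weak_gradient \<Omega> u", OF assms(2)] assms(2)])

lemma has_weak_gradient_add:
  assumes "has_weak_gradient \<Omega> u g" "has_weak_gradient \<Omega> v h"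
  shows "has_weak_gradient \<Omega> (\<lambda>x. u x + v x) (\<lambda>x. g x + h x)"
proof (rule has_weak_gradientI)
  show "(\<lambda>x. u x + v x) locally_integrable_on \<Omega>" "(\<lambda>x. g x + h x) locally_integrable_on \<Omega>"
    using assms by (auto simp: has_weak_gradient_def intro: locally_integrable_add)
  fix \<phi> and b :: 'a assume "\<phi> \<in> test_functions \<Omega>" "b \<in> Basis"
  from has_weak_gradient_integrals[OF assms(1) this] has_weak_gradient_integrals[OF assms(2) this]
  show "(\<integral>x. (grad \<phi> x \<bullet> b) * (u x + v x) \<partial>lebesgue) = - (\<integral>x. \<phi> x * ((g x + h x) \<bullet> b) \<partial>lebesgue)"
    by (simp add: distrib_left inner_add_left)
qed

lemma has_weak_gradient_diff:
  assumes "has_weak_gradient \<Omega> u g" "has_weak_gradient \<Omega> v h"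
  shows "has_weak_gradient \<Omega> (\<lambda>x. u x - v x) (\<lambda>x. g x - h x)"
proof (rule has_weak_gradientI)
  show "(\<lambda>x. u x - v x) locally_integrable_on \<Omega>" "(\<lambda>x. g x - h x) locally_integrable_on \<Omega>"
    using assms by (auto simp: has_weak_gradient_def intro: locally_integrable_diff)
  fix \<phi> and b :: 'a assume "\<phi> \<in> test_functions \<Omega>" "b \<in> Basis"
  from has_weak_gradient_integrals[OF assms(1) this] has_weak_gradient_integrals[OF assms(2) this]
  show "(\<integral>x. (grad \<phi> x \<bullet> b) * (u x - v x) \<partial>lebesgue) = - (\<integral>x. \<phi> x * ((g x - h x) \<bullet> b) \<partial>lebesgue)"
    by (simp add: right_diff_distrib inner_diff_left)
qed

lemma continuous_imp_locally_integrable: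
  fixes f :: "'a::euclidean_space \<Rightarrow> 'b::euclidean_space"
  assumes "continuous_on UNIV f" shows "f locally_integrable_on \<Omega>"
  unfolding locally_integrable_on_def set_integrable_def
proof (intro allI impI)
  fix K :: "'a set" assume K: "compact K \<and> K \<subseteq> \<Omega>"
  then have [measurable]: "K \<in> sets borel" by (simp add: compact_imp_closed)
  have [measurable]: "f \<in> borel_measurable borel" using assms by (rule borel_measurable_continuous_onI)
  have "integrable lborel (\<lambda>x. indicator K x *\<^sub>R f x)"
    using K assms by (intro borel_integrable_compact) (auto intro: continuous_on_subset)
  then show "integrable lebesgue (\<lambda>x. indicator K x *\<^sub>R f x)"
    by (subst integrable_completion) auto
qed

text \<open>Integration by parts: the product of \<open>u\<close> with a test function is C1 with
  bounded support, so its gradient has integral zero.\<close>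

lemma C1_grad_has_weak_gradient:
  assumes u: "C1_grad u u'" shows "has_weak_gradient \<Omega> u u'"
proof (rule has_weak_gradientI)
  show "u locally_integrable_on \<Omega>" "u' locally_integrable_on \<Omega>"
    by (intro continuous_imp_locally_integrable C1_grad_continuous[OF u] C1_grad_continuous'[OF u])+
  fix \<phi> and b :: 'a assume \<phi>: "\<phi> \<in> test_functions \<Omega>" and "b \<in> Basis"
  obtain S where S: "compact S" "S \<subseteq> \<Omega>" "\<And>x. x \<notin> S \<Longrightarrow> \<phi> x = 0" "\<And>x. x \<notin> S \<Longrightarrow> grad \<phi> x = 0"
    and C: "C1_grad \<phi> (grad \<phi>)" using test_functionE[OF \<phi>] by metis
  note cont = C1_grad_continuous[OF C] C1_grad_continuous'[OF C] C1_grad_continuous[OF u] C1_grad_continuous'[OF u]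
  have bS: "bounded S" by (rule compact_imp_bounded[OF S(1)])
  have i1: "integrable lebesgue (\<lambda>x. \<phi> x *\<^sub>R u' x)"
    by (rule integrable_continuous_support_lebesgue[OF _ _ bS]) (use S in \<open>auto intro!: continuous_intros cont\<close>)
  have i2: "integrable lebesgue (\<lambda>x. u x *\<^sub>R grad \<phi> x)"
    by (rule integrable_continuous_support_lebesgue[OF _ _ bS]) (use S in \<open>auto intro!: continuous_intros cont\<close>)
  have "(\<integral>x. \<phi> x *\<^sub>R u' x + u x *\<^sub>R grad \<phi> x \<partial>lborel) = 0"
    by (rule integral_C1_grad_eq_0[OF C1_grad_mult[OF C u] _ bS]) (use S in auto)
  then have "(\<integral>x. \<phi> x *\<^sub>R u' x + u x *\<^sub>R grad \<phi> x \<partial>lebesgue) = 0"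
    by (subst integral_completion) (auto intro!: borel_measurable_continuous_onI continuous_intros cont)
  then have "(\<integral>x. u x *\<^sub>R grad \<phi> x \<partial>lebesgue) = - (\<integral>x. \<phi> x *\<^sub>R u' x \<partial>lebesgue)"
    using i1 i2 by (simp add: eq_neg_iff_add_eq_0 add.commute)
  then have "(\<integral>x. u x *\<^sub>R grad \<phi> x \<partial>lebesgue) \<bullet> b = - (\<integral>x. \<phi> x *\<^sub>R u' x \<partial>lebesgue) \<bullet> b" by simp
  then show "(\<integral>x. (grad \<phi> x \<bullet> b) * u x \<partial>lebesgue) = - (\<integral>x. \<phi> x * (u' x \<bullet> b) \<partial>lebesgue)"
    using integral_inner_left[OF i1, of b] integral_inner_left[OF i2, of b] by (simp add: mult.commute)
qed

section \<open>Zero extensions of functions in \<open>W11_0\<close>\<close>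

text \<open>Integrability of \<open>v\<close> and \<open>g\<close> over the whole space allows tests
  that are bounded with bounded gradient instead of compactly supported. Reflected kernels are such
  tests, and so are products of tests with C1 cutoffs. Zero boundary values are encoded by requiring
  the identity across the boundary of \<Omega>.\<close>

definition global_weak_gradient :: "('a::euclidean_space \<Rightarrow> real) \<Rightarrow> ('a \<Rightarrow> 'a) \<Rightarrow> bool" where
  "global_weak_gradient v g \<longleftrightarrow> integrable lebesgue v \<and> integrable lebesgue g \<and>
     (\<forall>\<eta> \<eta>' M. C1_grad \<eta> \<eta>' \<longrightarrow> (\<forall>x. \<bar>\<eta> x\<bar> \<le> M \<and> norm (\<eta>' x) \<le> M) \<longrightarrow>
        (\<integral>x. v x *\<^sub>R \<eta>' x \<partial>lebesgue) = - (\<integral>x. \<eta> x *\<^sub>R g x \<partial>lebesgue))"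

lemma integrable_bounded_mult:
  fixes f :: "'a::euclidean_space \<Rightarrow> 'b::euclidean_space" and c :: "'a \<Rightarrow> real"
  assumes f: "integrable lebesgue f" and "c \<in> borel_measurable lebesgue" "\<And>x. \<bar>c x\<bar> \<le> M"
  shows "integrable lebesgue (\<lambda>x. c x *\<^sub>R f x)"
proof (rule Bochner_Integration.integrable_bound[where f="\<lambda>x. M *\<^sub>R f x"])
  show "(\<lambda>x. c x *\<^sub>R f x) \<in> borel_measurable lebesgue" using assms by (intro borel_measurable_scaleR) auto
  show "AE x in lebesgue. norm (c x *\<^sub>R f x) \<le> norm (M *\<^sub>R f x)"
    unfolding norm_scaleR by (intro AE_I2 mult_right_mono order_trans[OF assms(3) abs_ge_self]) auto
qed (intro integrable_scaleR_right f)

lemma integrable_bounded_mult':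
  fixes f :: "'a::euclidean_space \<Rightarrow> real" and c :: "'a \<Rightarrow> 'b::euclidean_space"
  assumes f: "integrable lebesgue f" and "c \<in> borel_measurable lebesgue" "\<And>x. norm (c x) \<le> M"
  shows "integrable lebesgue (\<lambda>x. f x *\<^sub>R c x)"
proof (rule Bochner_Integration.integrable_bound[where f="\<lambda>x. M * f x"])
  show "(\<lambda>x. f x *\<^sub>R c x) \<in> borel_measurable lebesgue" using assms by (intro borel_measurable_scaleR) auto
  have "norm (c x) * \<bar>f x\<bar> \<le> \<bar>M\<bar> * \<bar>f x\<bar>" for x
    by (intro mult_right_mono order_trans[OF assms(3) abs_ge_self]) auto
  then show "AE x in lebesgue. norm (f x *\<^sub>R c x) \<le> norm (M * f x)"
    by (simp add: abs_mult mult.commute)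
qed (intro integrable_mult_right f)

text \<open>Test the identity for \<open>v\<close> with the product of \<beta> and \<eta>; the term
  in which the derivative falls on \<beta> becomes the second summand of the new gradient.\<close>

lemma global_weak_gradient_mult:
  fixes v :: "'a::euclidean_space \<Rightarrow> real"
  assumes vg: "global_weak_gradient v g" and \<beta>: "C1_grad \<beta> \<beta>'" and M: "\<And>x. \<bar>\<beta> x\<bar> \<le> M" "\<And>x. norm (\<beta>' x) \<le> M"
  shows "global_weak_gradient (\<lambda>x. \<beta> x * v x) (\<lambda>x. \<beta> x *\<^sub>R g x + v x *\<^sub>R \<beta>' x)"
proof -
  have v: "integrable lebesgue v" and g: "integrable lebesgue g" using vg by (auto simp: global_weak_gradient_def)
  have [measurable]: "\<beta> \<in> borel_measurable lebesgue" "\<beta>' \<in> borel_measurable lebesgue"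
    by (intro continuous_imp_lebesgue_measurable C1_grad_continuous[OF \<beta>] C1_grad_continuous'[OF \<beta>])+
  have i1: "integrable lebesgue (\<lambda>x. \<beta> x * v x)" using integrable_bounded_mult[OF v, of \<beta> M] M by simp
  have i2: "integrable lebesgue (\<lambda>x. \<beta> x *\<^sub>R g x)" using integrable_bounded_mult[OF g, of \<beta> M] M by simp
  have i3: "integrable lebesgue (\<lambda>x. v x *\<^sub>R \<beta>' x)" using integrable_bounded_mult'[OF v, of \<beta>' M] M by simp
  have M0: "M \<ge> 0" using M(1)[of undefined] by linarith
  show ?thesis
    unfolding global_weak_gradient_def
  proof (intro conjI allI impI)
    fix \<eta> :: "'a \<Rightarrow> real" and \<eta>' N assume \<eta>: "C1_grad \<eta> \<eta>'" and "\<forall>x. \<bar>\<eta> x\<bar> \<le> N \<and> norm (\<eta>' x) \<le> N"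
    then have N: "\<bar>\<eta> x\<bar> \<le> N" "norm (\<eta>' x) \<le> N" for x by auto
    have N0: "N \<ge> 0" using N(1)[of undefined] by linarith
    have [measurable]: "\<eta> \<in> borel_measurable lebesgue" "\<eta>' \<in> borel_measurable lebesgue"
      by (intro continuous_imp_lebesgue_measurable C1_grad_continuous[OF \<eta>] C1_grad_continuous'[OF \<eta>])+
    let ?p = "\<lambda>x. \<beta> x * \<eta> x" and ?p' = "\<lambda>x. \<beta> x *\<^sub>R \<eta>' x + \<eta> x *\<^sub>R \<beta>' x"
    have "\<bar>?p x\<bar> \<le> 2 * M * N \<and> norm (?p' x) \<le> 2 * M * N" for x
    proof
      have 1: "\<bar>\<beta> x\<bar> * \<bar>\<eta> x\<bar> \<le> M * N" using M N M0 N0 by (intro mult_mono) auto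
      then show "\<bar>?p x\<bar> \<le> 2 * M * N" using mult_nonneg_nonneg[OF M0 N0] unfolding abs_mult by linarith
      have "\<bar>\<beta> x\<bar> * norm (\<eta>' x) \<le> M * N" "\<bar>\<eta> x\<bar> * norm (\<beta>' x) \<le> N * M"
        using M N M0 N0 by (intro mult_mono; auto)+
      then show "norm (?p' x) \<le> 2 * M * N"
        using norm_triangle_ineq[of "\<beta> x *\<^sub>R \<eta>' x" "\<eta> x *\<^sub>R \<beta>' x"] mult.commute[of M N]
        unfolding norm_scaleR by linarith
    qed
    then have *: "(\<integral>x. v x *\<^sub>R ?p' x \<partial>lebesgue) = - (\<integral>x. ?p x *\<^sub>R g x \<partial>lebesgue)"
      using vg C1_grad_mult[OF \<beta> \<eta>] unfolding global_weak_gradient_def by blast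
    have j1: "integrable lebesgue (\<lambda>x. (\<beta> x * v x) *\<^sub>R \<eta>' x)" using integrable_bounded_mult'[OF i1, of \<eta>' N] N by simp
    have j2: "integrable lebesgue (\<lambda>x. \<eta> x *\<^sub>R (v x *\<^sub>R \<beta>' x))" using integrable_bounded_mult[OF i3, of \<eta> N] N by simp
    have j3: "integrable lebesgue (\<lambda>x. \<eta> x *\<^sub>R (\<beta> x *\<^sub>R g x))" using integrable_bounded_mult[OF i2, of \<eta> N] N by simp
    have "(\<integral>x. v x *\<^sub>R ?p' x \<partial>lebesgue) = (\<integral>x. (\<beta> x * v x) *\<^sub>R \<eta>' x \<partial>lebesgue) + (\<integral>x. \<eta> x *\<^sub>R (v x *\<^sub>R \<beta>' x) \<partial>lebesgue)"
      using j1 j2 by (subst Bochner_Integration.integral_add[symmetric]) (simp_all add: scaleR_add_right mult.commute)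
    moreover have "(\<integral>x. \<eta> x *\<^sub>R (\<beta> x *\<^sub>R g x + v x *\<^sub>R \<beta>' x) \<partial>lebesgue)
       = (\<integral>x. \<eta> x *\<^sub>R (\<beta> x *\<^sub>R g x) \<partial>lebesgue) + (\<integral>x. \<eta> x *\<^sub>R (v x *\<^sub>R \<beta>' x) \<partial>lebesgue)"
      using j3 j2 by (simp add: scaleR_add_right)
    ultimately show "(\<integral>x. (\<beta> x * v x) *\<^sub>R \<eta>' x \<partial>lebesgue) = - (\<integral>x. \<eta> x *\<^sub>R (\<beta> x *\<^sub>R g x + v x *\<^sub>R \<beta>' x) \<partial>lebesgue)"
      using * by (simp add: mult.commute algebra_simps)
  qed (use i1 i2 i3 in auto)
qed

text \<open>Testing with \<open>\<lambda>y. K (x - y)\<close> moves the derivative between kernel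
  and function. The gradient of the mollification is thus the mollified gradient, which suits
  Jensen, and also an integral of \<open>v\<close> against \<open>K'\<close>, which suits bounds in
  terms of \<open>v\<close>.\<close>

lemma conv_global_weak_gradient:
  fixes v :: "'a::euclidean_space \<Rightarrow> real"
  assumes vg: "global_weak_gradient v g" and mo: "mollifier w A \<delta> K K'" and \<delta>: "\<delta> > 0"
  shows "C1_grad (conv K v) (conv K g)" "conv K g x = (\<integral>y. v y *\<^sub>R K' (x - y) \<partial>lebesgue)"
    "integrable lebesgue (\<lambda>y. v y *\<^sub>R K' (x - y))"
proof -
  note m = mollifierD[OF mo \<delta>]
  have v: "integrable lebesgue v" using vg by (auto simp: global_weak_gradient_def)
  have b: "bounded (cball (\<delta> *\<^sub>R w) \<delta>)" "closed (cball (\<delta> *\<^sub>R w) \<delta>)" by auto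
  note C = conv_C1_grad[OF m(2) m(8) b v]
  obtain M1 where M1: "\<And>x. norm (K x) \<le> M1" using bounded_continuous_support[OF m(3) m(8) b(1)] by blast
  obtain M2 where M2: "\<And>x. norm (K' x) \<le> M2" using bounded_continuous_support[OF m(4) m(9) b(1)] by blast
  have eq: "conv K g x = (\<integral>y. v y *\<^sub>R K' (x - y) \<partial>lebesgue)" for x
  proof -
    have "\<forall>y. \<bar>K (x - y)\<bar> \<le> max M1 M2 \<and> norm (- K' (x - y)) \<le> max M1 M2"
      using M1 M2 by (auto simp: le_max_iff_disj)
    then have "(\<integral>y. v y *\<^sub>R (- K' (x - y)) \<partial>lebesgue) = - (\<integral>y. K (x - y) *\<^sub>R g y \<partial>lebesgue)"
      using vg C1_grad_reflect[OF m(2), of x] unfolding global_weak_gradient_def by blast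
    then show ?thesis by (simp add: conv_def)
  qed
  then show "conv K g x = (\<integral>y. v y *\<^sub>R K' (x - y) \<partial>lebesgue)" .
  have "conv K g = (\<lambda>x. \<integral>y. v y *\<^sub>R K' (x - y) \<partial>lebesgue)" using eq by blast
  then show "C1_grad (conv K v) (conv K g)" using C(1) by simp
  show "integrable lebesgue (\<lambda>y. v y *\<^sub>R K' (x - y))" using C(2) by simp
qed

text \<open>As \<open>K'\<close> has integral zero, \<open>v y\<close> may be replaced by
  \<open>v y - v x\<close>. On the support of the kernel this increment is controlled by the modulus
  of continuity at scale \<open>\<delta> * (norm w + 1)\<close>, and the L1 bound on
  \<open>K'\<close> gives the factor \<open>A / \<delta>\<close>.\<close>

lemma norm_conv_gradient_le:
  fixes v :: "'a::euclidean_space \<Rightarrow> real"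
  assumes vg: "global_weak_gradient v g" and mo: "mollifier w A \<delta> K K'" and \<delta>: "\<delta> > 0"
    and H: "\<And>x y. \<bar>v x - v y\<bar> \<le> H * norm (x - y) powr \<gamma>" "H \<ge> 0" "\<gamma> \<ge> 0"
  shows "norm (conv K g x) \<le> H * (\<delta> * (norm w + 1)) powr \<gamma> * (A / \<delta>)"
proof -
  note m = mollifierD[OF mo \<delta>] and mi = mollifier_integral_reflect[OF mo \<delta>]
  note C = conv_global_weak_gradient[OF vg mo \<delta>]
  have i: "integrable lebesgue (\<lambda>y. (v y - v x) *\<^sub>R K' (x - y))"
    unfolding scaleR_diff_left using C(3)[of x] mi(4)[of x] by simp
  have "conv K g x = (\<integral>y. (v y - v x) *\<^sub>R K' (x - y) \<partial>lebesgue)"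
    unfolding scaleR_diff_left C(2) using C(3)[of x] mi(4)[of x] mi(5)[of x] by simp
  also have "norm \<dots> \<le> (\<integral>y. (H * (\<delta> * (norm w + 1)) powr \<gamma>) * norm (K' (x - y)) \<partial>lebesgue)"
  proof (rule Bochner_Integration.integral_norm_bound_integral[OF i])
    show "integrable lebesgue (\<lambda>y. (H * (\<delta> * (norm w + 1)) powr \<gamma>) * norm (K' (x - y)))"
      using mi(4)[of x] by auto
    show "norm ((v y - v x) *\<^sub>R K' (x - y)) \<le> (H * (\<delta> * (norm w + 1)) powr \<gamma>) * norm (K' (x - y))" for y
    proof (cases "norm (x - y) \<le> \<delta> * (norm w + 1)")
      case True
      have "\<bar>v y - v x\<bar> \<le> H * norm (x - y) powr \<gamma>"
        using H(1)[of y x] by (simp add: norm_minus_commute)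
      also have "\<dots> \<le> H * (\<delta> * (norm w + 1)) powr \<gamma>"
        using True H by (intro mult_left_mono powr_mono2) auto
      finally show ?thesis unfolding norm_scaleR by (intro mult_right_mono) auto
    qed (use m(11) in auto)
  qed
  also have "\<dots> = (H * (\<delta> * (norm w + 1)) powr \<gamma>) * (\<integral>y. norm (K' (x - y)) \<partial>lebesgue)" by simp
  also have "\<dots> \<le> H * (\<delta> * (norm w + 1)) powr \<gamma> * (A / \<delta>)"
    using H mi(3) by (intro mult_left_mono) auto
  finally show ?thesis .
qed

text \<open>Mollifications of \<open>v\<close> by short kernels have zero gradient on the half ball
  and so are constant there. Being L1-close to \<open>v\<close>, this constant must be near both
  \<open>s\<close> and \<open>t\<close>.\<close>

lemma no_jump:
  fixes v :: "'a::euclidean_space \<Rightarrow> real"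
  assumes vg: "global_weak_gradient v g" and g0: "\<And>x. x \<in> ball x0 r \<Longrightarrow> g x = 0"
    and U: "open U" "U \<noteq> {}" "U \<subseteq> ball x0 (r / 2)" "\<And>x. x \<in> U \<Longrightarrow> v x = s"
    and V: "open V" "V \<noteq> {}" "V \<subseteq> ball x0 (r / 2)" "\<And>x. x \<in> V \<Longrightarrow> v x = t"
  shows "s = t"
proof (rule ccontr)
  assume "s \<noteq> t"
  have r: "r > 0" using U(2,3) by (metis ball_eq_empty half_gt_zero_iff linorder_not_less subset_empty)
  have v: "integrable lebesgue v" using vg by (auto simp: global_weak_gradient_def)
  define \<mu> where "\<mu> = min (measure lebesgue U) (measure lebesgue V)"
  have meas: "emeasure lebesgue W = ennreal (measure lebesgue W)" "measure lebesgue W > 0"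
    if "open W" "W \<noteq> {}" "W \<subseteq> ball x0 (r / 2)" for W
  proof -
    have b: "bounded W" using that(3) bounded_ball bounded_subset by blast
    show "emeasure lebesgue W = ennreal (measure lebesgue W)"
      using emeasure_bounded_finite[OF b] that(1) by (intro emeasure_eq_ennreal_measure) auto
    have "\<not> negligible W" using open_not_negligible that by blast
    then have "emeasure lebesgue W \<noteq> 0"
      using that(1) by (auto simp: negligible_iff_null_sets null_sets_def)
    then show "measure lebesgue W > 0"
      using \<open>emeasure lebesgue W = ennreal (measure lebesgue W)\<close>
      by (metis ennreal_0 less_eq_real_def measure_nonneg)
  qed
  have \<mu>: "\<mu> > 0" using meas U V by (simp add: \<mu>_def)
  \<comment> \<open>Both sets have measure at least \<mu>, so L1-closeness \<open>e\<close> yields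
    \<open>\<mu> * \<bar>s - t\<bar> \<le> 2 * e\<close>; dividing by 3 makes this a
    contradiction.\<close>
  define e where "e = \<mu> * \<bar>s - t\<bar> / 3"
  have e: "e > 0" using \<mu> \<open>s \<noteq> t\<close> by (simp add: e_def)
  obtain A where A: "\<And>\<delta>. \<delta> > 0 \<Longrightarrow> \<exists>K K'. mollifier (0::'a) A \<delta> K K'" using ex_mollifier by blast
  obtain d where d: "d > 0" "\<And>\<delta> K K'. 0 < \<delta> \<Longrightarrow> \<delta> < d \<Longrightarrow> mollifier (0::'a) A \<delta> K K' \<Longrightarrow>
          (\<integral>\<^sup>+x. norm (conv K v x - v x) \<partial>lebesgue) \<le> ennreal e"
    using conv_tendsto_L1[OF v e, of "0::'a" A] by metis
  define \<delta> where "\<delta> = min d (r / 2) / 2"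
  have \<delta>: "\<delta> > 0" "\<delta> < d" "\<delta> < r / 2" using d(1) r by (auto simp: \<delta>_def min_def)
  obtain K K' where mo: "mollifier (0::'a) A \<delta> K K'" using A[OF \<delta>(1)] by blast
  note m = mollifierD[OF mo \<delta>(1)]
  note C = conv_global_weak_gradient[OF vg mo \<delta>(1)]
  have zero: "conv K g x = 0" if x: "x \<in> ball x0 (r / 2)" for x
  proof -
    have "K (x - y) *\<^sub>R g y = 0" for y
    proof (cases "dist x y \<le> \<delta>")
      case True
      then have "y \<in> ball x0 r" using dist_triangle[of x0 y x] x \<delta>(3) by simp
      then show ?thesis using g0 by simp
    next
      case False
      then show ?thesis using m(8)[of "x - y"] by (simp add: dist_norm norm_minus_commute)
    qed
    then have "(\<lambda>y. K (x - y) *\<^sub>R g y) = (\<lambda>y. 0)" by blast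
    then show ?thesis by (simp only: conv_def) simp
  qed
  have const: "conv K v x = conv K v x0" if x: "x \<in> ball x0 (r / 2)" for x
  proof (rule has_derivative_zero_unique[OF convex_ball, where f="conv K v"])
    show "(conv K v has_derivative (\<lambda>h. 0)) (at y within ball x0 (r / 2))" if "y \<in> ball x0 (r / 2)" for y
      using C1_gradD[OF C(1), of y] zero[OF that] has_derivative_at_withinI by fastforce
  qed (use x r in auto)
  define c where "c = conv K v x0"
  have est: "\<mu> * \<bar>c - s\<bar> \<le> e"
    if W: "open W" "W \<noteq> {}" "W \<subseteq> ball x0 (r / 2)" "\<And>x. x \<in> W \<Longrightarrow> v x = s" "\<mu> \<le> measure lebesgue W" for W s
  proof -
    have "ennreal (\<mu> * \<bar>c - s\<bar>) \<le> ennreal (\<bar>c - s\<bar> * measure lebesgue W)"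
      using mult_right_mono[OF W(5), of "\<bar>c - s\<bar>"] by (intro ennreal_leI) (simp add: mult.commute)
    also have "\<dots> = ennreal \<bar>c - s\<bar> * emeasure lebesgue W"
      using meas[OF W(1-3)] by (simp add: ennreal_mult)
    also have "\<dots> = (\<integral>\<^sup>+x. ennreal \<bar>c - s\<bar> * indicator W x \<partial>lebesgue)"
      using W(1) by (intro nn_integral_cmult_indicator[symmetric]) simp
    also have "\<dots> \<le> (\<integral>\<^sup>+x. norm (conv K v x - v x) \<partial>lebesgue)"
      using W const by (intro nn_integral_mono) (auto simp: indicator_def c_def subset_eq)
    also have "\<dots> \<le> ennreal e" by (rule d(2)[OF \<delta>(1,2) mo])
    finally show ?thesis using e by simp
  qed
  have "\<mu> * \<bar>c - s\<bar> \<le> e" "\<mu> * \<bar>c - t\<bar> \<le> e"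
    using est[OF U] est[OF V] by (auto simp: \<mu>_def)
  moreover have "\<mu> * \<bar>s - t\<bar> \<le> \<mu> * (\<bar>c - s\<bar> + \<bar>c - t\<bar>)"
    using \<mu> by (intro mult_left_mono) auto
  ultimately have "\<mu> * \<bar>s - t\<bar> \<le> 2 * e" by (simp add: distrib_left)
  then show False using e by (simp add: e_def)
qed


lemma W11_weak_gradient_integrable:
  assumes \<Omega>: "open \<Omega>" and u: "u \<in> W11 \<Omega>"
  shows "has_weak_gradient \<Omega> u (weak_gradient \<Omega> u)" "integrable lebesgue (\<lambda>x. indicator \<Omega> x *\<^sub>R u x)"
    "integrable lebesgue (\<lambda>x. indicator \<Omega> x *\<^sub>R weak_gradient \<Omega> u x)"
proof -
  obtain g where g: "has_weak_gradient \<Omega> u g" "set_integrable lebesgue \<Omega> g"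
    using u by (auto simp: W11_def)
  show "has_weak_gradient \<Omega> u (weak_gradient \<Omega> u)"
    unfolding weak_gradient_def by (rule someI[of "has_weak_gradient \<Omega> u", OF g(1)])
  show "integrable lebesgue (\<lambda>x. indicator \<Omega> x *\<^sub>R u x)"
    using u by (simp add: W11_def set_integrable_def)
  have "AE x in lebesgue. indicator \<Omega> x *\<^sub>R g x = indicator \<Omega> x *\<^sub>R weak_gradient \<Omega> u x"
    using weak_gradient_AE[OF \<Omega> g(1)] by eventually_elim (auto simp: indicator_def)
  moreover have i: "integrable lebesgue (\<lambda>x. indicator \<Omega> x *\<^sub>R g x)" using g(2) by (simp add: set_integrable_def)
  ultimately show "integrable lebesgue (\<lambda>x. indicator \<Omega> x *\<^sub>R weak_gradient \<Omega> u x)"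
    using integrable_cong_AE_imp[OF i] borel_measurable_AE[OF borel_measurable_integrable[OF i]] by (metis (no_types, lifting) AE_mp AE_I2)
qed

lemma test_functions_W11:
  assumes \<psi>: "\<psi> \<in> test_functions \<Omega>"
  shows "has_weak_gradient \<Omega> \<psi> (grad \<psi>)" "integrable lebesgue \<psi>" "integrable lebesgue (grad \<psi>)"
    "indicator \<Omega> x *\<^sub>R \<psi> x = \<psi> x" "indicator \<Omega> x *\<^sub>R grad \<psi> x = grad \<psi> x" "\<psi> \<in> W11 \<Omega>"
proof -
  obtain S where S: "compact S" "S \<subseteq> \<Omega>" "\<And>x. x \<notin> S \<Longrightarrow> \<psi> x = 0" "\<And>x. x \<notin> S \<Longrightarrow> grad \<psi> x = 0"
    and C: "C1_grad \<psi> (grad \<psi>)" using test_functionE[OF \<psi>] by metis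
  show w: "has_weak_gradient \<Omega> \<psi> (grad \<psi>)" by (rule C1_grad_has_weak_gradient[OF C])
  have b: "bounded S" by (rule compact_imp_bounded[OF S(1)])
  show i: "integrable lebesgue \<psi>" "integrable lebesgue (grad \<psi>)"
    using integrable_continuous_support_lebesgue[OF C1_grad_continuous[OF C] S(3) b]
      integrable_continuous_support_lebesgue[OF C1_grad_continuous'[OF C] S(4) b] by auto
  show e: "indicator \<Omega> x *\<^sub>R \<psi> x = \<psi> x" "indicator \<Omega> x *\<^sub>R grad \<psi> x = grad \<psi> x" for x
    using S by (auto simp: indicator_def)
  have "set_integrable lebesgue \<Omega> \<psi>" "set_integrable lebesgue \<Omega> (grad \<psi>)"
    unfolding set_integrable_def e by (rule i)+
  then show "\<psi> \<in> W11 \<Omega>" using w by (auto simp: W11_def)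
qed

text \<open>Test functions vanish off \<Omega> together with their gradients, so the two set
  integrals in \<open>W11_norm\<close> are L1 distances between zero extensions on the whole
  space.\<close>

lemma W11_0_approx:
  assumes \<Omega>: "open \<Omega>" and \<phi>: "\<phi> \<in> W11_0 \<Omega>"
  obtains \<psi> where "\<And>k::nat. \<psi> k \<in> test_functions \<Omega>"
    "(\<lambda>k. \<integral>x. norm (\<psi> k x - indicator \<Omega> x *\<^sub>R \<phi> x) \<partial>lebesgue) \<longlonglongrightarrow> 0"
    "(\<lambda>k. \<integral>x. norm (grad (\<psi> k) x - indicator \<Omega> x *\<^sub>R weak_gradient \<Omega> \<phi> x) \<partial>lebesgue) \<longlonglongrightarrow> 0"
proof -
  have \<phi>W: "\<phi> \<in> W11 \<Omega>" using \<phi> by (simp add: W11_0_def)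
  note i\<phi> = W11_weak_gradient_integrable[OF \<Omega> \<phi>W]
  obtain \<psi> :: "nat \<Rightarrow> 'a \<Rightarrow> real" where \<psi>: "\<And>k. \<psi> k \<in> test_functions \<Omega>"
    and lim: "(\<lambda>k. W11_norm \<Omega> (\<lambda>x. \<psi> k x - \<phi> x)) \<longlonglongrightarrow> 0"
    using \<phi> by (auto simp: W11_0_def)
  define P where "P k = (\<integral>x. norm (\<psi> k x - indicator \<Omega> x *\<^sub>R \<phi> x) \<partial>lebesgue)" for k
  define Q where "Q k = (\<integral>x. norm (grad (\<psi> k) x - indicator \<Omega> x *\<^sub>R weak_gradient \<Omega> \<phi> x) \<partial>lebesgue)" for k
  have "W11_norm \<Omega> (\<lambda>x. \<psi> k x - \<phi> x) = P k + Q k" for k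
  proof -
    note t = test_functions_W11[OF \<psi>[of k]]
    have 1: "indicator \<Omega> x *\<^sub>R \<bar>\<psi> k x - \<phi> x\<bar> = norm (\<psi> k x - indicator \<Omega> x *\<^sub>R \<phi> x)" for x
      using t(4)[of x] by (auto simp: indicator_def)
    have e2: "indicator \<Omega> x *\<^sub>R norm (grad (\<psi> k) x - weak_gradient \<Omega> \<phi> x)
        = norm (grad (\<psi> k) x - indicator \<Omega> x *\<^sub>R weak_gradient \<Omega> \<phi> x)" for x
      using t(5)[of x] by (auto simp: indicator_def)
    have i: "integrable lebesgue (\<lambda>x. norm (grad (\<psi> k) x - indicator \<Omega> x *\<^sub>R weak_gradient \<Omega> \<phi> x))"
      using t(3) i\<phi>(3) by auto
    have ae: "AE x in lebesgue. norm (grad (\<psi> k) x - indicator \<Omega> x *\<^sub>R weak_gradient \<Omega> \<phi> x)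
        = indicator \<Omega> x *\<^sub>R norm (weak_gradient \<Omega> (\<lambda>x. \<psi> k x - \<phi> x) x)"
      using weak_gradient_AE[OF \<Omega> has_weak_gradient_diff[OF t(1) i\<phi>(1)]]
      unfolding e2[symmetric] by eventually_elim (simp add: indicator_def)
    have "(\<integral>x. indicator \<Omega> x *\<^sub>R norm (weak_gradient \<Omega> (\<lambda>x. \<psi> k x - \<phi> x) x) \<partial>lebesgue) = Q k"
      unfolding Q_def
    proof (rule integral_cong_AE[symmetric])
      show "(\<lambda>x. indicator \<Omega> x *\<^sub>R norm (weak_gradient \<Omega> (\<lambda>x. \<psi> k x - \<phi> x) x)) \<in> borel_measurable lebesgue"
        by (rule borel_measurable_AE[OF borel_measurable_integrable[OF i] ae])
    qed (use i ae in auto)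
    then show ?thesis unfolding W11_norm_def set_lebesgue_integral_def 1 P_def by simp
  qed
  then have PQ: "(\<lambda>k. P k + Q k) \<longlonglongrightarrow> 0" using lim by simp
  have "P k \<ge> 0" "Q k \<ge> 0" for k by (auto simp: P_def Q_def)
  then have "P \<longlonglongrightarrow> 0" "Q \<longlonglongrightarrow> 0"
    by (auto intro!: tendsto_sandwich[OF _ _ tendsto_const PQ] always_eventually)
  then show ?thesis using that \<psi> unfolding P_def Q_def by blast
qed

lemma DERIV_bounded_lipschitz:
  fixes T :: "real \<Rightarrow> real"
  assumes "\<And>s. (T has_real_derivative T' s) (at s)" "\<And>s. \<bar>T' s\<bar> \<le> M"
  shows "\<bar>T s - T t\<bar> \<le> M * \<bar>s - t\<bar>"
proof -
  have "norm (T s - T t) \<le> M * norm (s - t)"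
    by (rule field_differentiable_bound[where S=UNIV and f'=T']) (use assms in auto)
  then show ?thesis by simp
qed

text \<open>Chain rule up to the boundary: membership in \<open>W11_0\<close> makes the zero extension weakly
  differentiable on the whole space.\<close>

lemma W11_0_chain:
  assumes \<Omega>: "open \<Omega>" and \<phi>: "\<phi> \<in> W11_0 \<Omega>"
    and T: "\<And>s. (T has_real_derivative T' s) (at s)" "continuous_on UNIV T'" "\<And>s. \<bar>T' s\<bar> \<le> M" "T 0 = 0"
  shows "global_weak_gradient (\<lambda>x. indicator \<Omega> x * T (\<phi> x))
    (\<lambda>x. indicator \<Omega> x *\<^sub>R T' (\<phi> x) *\<^sub>R weak_gradient \<Omega> \<phi> x)"
proof -
  have M0: "M \<ge> 0" using T(3)[of 0] by linarith
  have \<phi>W: "\<phi> \<in> W11 \<Omega>" using \<phi> by (simp add: W11_0_def)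
  note i\<phi> = W11_weak_gradient_integrable[OF \<Omega> \<phi>W]
  define v where "v x = indicator \<Omega> x *\<^sub>R \<phi> x" for x
  define G where "G x = indicator \<Omega> x *\<^sub>R weak_gradient \<Omega> \<phi> x" for x
  have v: "integrable lebesgue v" and G: "integrable lebesgue G"
    using i\<phi> by (simp_all add: v_def[abs_def] G_def[abs_def])
  have eq: "indicator \<Omega> x * T (\<phi> x) = T (v x)" "indicator \<Omega> x *\<^sub>R T' (\<phi> x) *\<^sub>R weak_gradient \<Omega> \<phi> x = T' (v x) *\<^sub>R G x" for x
    using T(4) by (auto simp: v_def G_def indicator_def)
  obtain \<psi>0 where \<psi>0: "\<And>k::nat. \<psi>0 k \<in> test_functions \<Omega>"
    and l1: "(\<lambda>k. \<integral>x. norm (\<psi>0 k x - v x) \<partial>lebesgue) \<longlonglongrightarrow> 0"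
    and l2: "(\<lambda>k. \<integral>x. norm (grad (\<psi>0 k) x - G x) \<partial>lebesgue) \<longlonglongrightarrow> 0"
    using W11_0_approx[OF \<Omega> \<phi>, folded v_def G_def] by blast
  have "integrable lebesgue (\<lambda>x. \<psi>0 k x - v x)" for k using test_functions_W11[OF \<psi>0[of k]] v by simp
  \<comment> \<open>Pointwise convergence is required because \<open>T'\<close> is merely
    continuous: \<open>T' (\<psi> k x)\<close> can be handled only by dominated convergence, in
    \<open>L3\<close>.\<close>
  then obtain r :: "nat \<Rightarrow> nat" where r: "strict_mono r" and ae: "AE x in lebesgue. (\<lambda>n. \<psi>0 (r n) x - v x) \<longlonglongrightarrow> 0"
    using tendsto_L1_AE_subseq[OF _ l1] by blast
  define \<psi> where "\<psi> n = \<psi>0 (r n)" for n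
  have \<psi>: "\<psi> k \<in> test_functions \<Omega>" for k by (simp add: \<psi>_def \<psi>0)
  note t = test_functions_W11[OF \<psi>]
  have C: "C1_grad (\<psi> k) (grad (\<psi> k))" for k using test_functionE[OF \<psi>] by blast
  have cT: "continuous_on UNIV T" using T(1) by (meson DERIV_isCont continuous_at_imp_continuous_on)
  note TL = DERIV_bounded_lipschitz[OF T(1) T(3)]
  have meas [measurable]: "v \<in> borel_measurable lebesgue" "G \<in> borel_measurable lebesgue"
     "\<psi> k \<in> borel_measurable lebesgue" "grad (\<psi> k) \<in> borel_measurable lebesgue"
     "T \<in> borel_measurable borel" "T' \<in> borel_measurable borel" for k
    using v G t(2,3) cT T(2) by (auto intro: borel_measurable_continuous_onI)
  have L1: "(\<lambda>k. \<integral>\<^sup>+x. norm (\<psi> k x - v x) \<partial>lebesgue) \<longlonglongrightarrow> 0"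
  proof -
    have "(\<lambda>k. ennreal (\<integral>x. norm (\<psi> k x - v x) \<partial>lebesgue)) \<longlonglongrightarrow> ennreal 0"
      using LIMSEQ_subseq_LIMSEQ[OF l1 r] by (intro tendsto_ennrealI) (simp add: \<psi>_def o_def)
    moreover have "ennreal (\<integral>x. norm (\<psi> k x - v x) \<partial>lebesgue) = (\<integral>\<^sup>+x. norm (\<psi> k x - v x) \<partial>lebesgue)" for k
      using t(2)[of k] v by (intro nn_integral_eq_integral[symmetric]) auto
    ultimately show ?thesis by simp
  qed
  have L2: "(\<lambda>k. \<integral>\<^sup>+x. norm (grad (\<psi> k) x - G x) \<partial>lebesgue) \<longlonglongrightarrow> 0"
  proof -
    have "(\<lambda>k. ennreal (\<integral>x. norm (grad (\<psi> k) x - G x) \<partial>lebesgue)) \<longlonglongrightarrow> ennreal 0"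
      using LIMSEQ_subseq_LIMSEQ[OF l2 r] by (intro tendsto_ennrealI) (simp add: \<psi>_def o_def)
    moreover have "ennreal (\<integral>x. norm (grad (\<psi> k) x - G x) \<partial>lebesgue) = (\<integral>\<^sup>+x. norm (grad (\<psi> k) x - G x) \<partial>lebesgue)" for k
      using t(3)[of k] G by (intro nn_integral_eq_integral[symmetric]) auto
    ultimately show ?thesis by simp
  qed
  have L3: "(\<lambda>k. \<integral>\<^sup>+x. norm (T' (v x) *\<^sub>R G x - T' (\<psi> k x) *\<^sub>R G x) \<partial>lebesgue) \<longlonglongrightarrow> 0"
  proof (rule nn_integral_dominated_convergence_norm[where w="\<lambda>x. M * norm (G x)"])
    show "AE x in lebesgue. (\<lambda>k. T' (\<psi> k x) *\<^sub>R G x) \<longlonglongrightarrow> T' (v x) *\<^sub>R G x"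
      using ae
    proof eventually_elim
      fix x assume "(\<lambda>n. \<psi>0 (r n) x - v x) \<longlonglongrightarrow> 0"
      then have "(\<lambda>n. \<psi> n x) \<longlonglongrightarrow> v x" unfolding \<psi>_def by (rule LIM_zero_cancel)
      from continuous_on_tendsto_compose[OF T(2) this]
      show "(\<lambda>k. T' (\<psi> k x) *\<^sub>R G x) \<longlonglongrightarrow> T' (v x) *\<^sub>R G x"
        by (intro tendsto_intros) auto
    qed
    show "AE x in lebesgue. norm (T' (\<psi> j x) *\<^sub>R G x) \<le> M * norm (G x)" for j
      using T(3) by (intro AE_I2) (auto intro: mult_right_mono)
    have "integrable lebesgue (\<lambda>x. M * norm (G x))" using G by simp
    then show "(\<integral>\<^sup>+x. ennreal (M * norm (G x)) \<partial>lebesgue) < \<infinity>"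
      by (subst nn_integral_eq_integral) (use M0 in auto)
  qed measurable
  have Tv: "integrable lebesgue (\<lambda>x. T (v x))"
    by (rule Bochner_Integration.integrable_bound[where f="\<lambda>x. M * v x"])
       (use v TL[of "v _" 0] T(4) M0 in \<open>auto simp: abs_mult\<close>)
  have T\<psi>: "integrable lebesgue (\<lambda>x. T (\<psi> k x))" for k
    by (rule Bochner_Integration.integrable_bound[where f="\<lambda>x. M * \<psi> k x"])
       (use t(2)[of k] TL[of "\<psi> k _" 0] T(4) M0 in \<open>auto simp: abs_mult\<close>)
  have T'v: "integrable lebesgue (\<lambda>x. T' (v x) *\<^sub>R G x)"
    by (rule integrable_bounded_mult[OF G _ T(3)]) measurable
  have T'\<psi>: "integrable lebesgue (\<lambda>x. T' (\<psi> k x) *\<^sub>R grad (\<psi> k) x)" for k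
    by (rule integrable_bounded_mult[OF t(3) _ T(3)]) measurable
  show ?thesis
    unfolding eq global_weak_gradient_def
  proof (intro conjI allI impI Tv T'v)
    fix \<eta> :: "'a \<Rightarrow> real" and \<eta>' N assume \<eta>: "C1_grad \<eta> \<eta>'" and "\<forall>x. \<bar>\<eta> x\<bar> \<le> N \<and> norm (\<eta>' x) \<le> N"
    then have N: "\<bar>\<eta> x\<bar> \<le> N" "norm (\<eta>' x) \<le> N" for x by auto
    have N0: "N \<ge> 0" using N(1)[of undefined] by linarith
    have [measurable]: "\<eta> \<in> borel_measurable lebesgue" "\<eta>' \<in> borel_measurable lebesgue"
      by (intro continuous_imp_lebesgue_measurable C1_grad_continuous[OF \<eta>] C1_grad_continuous'[OF \<eta>])+
    have i1: "integrable lebesgue (\<lambda>x. T (v x) *\<^sub>R \<eta>' x)" "integrable lebesgue (\<lambda>x. T (\<psi> k x) *\<^sub>R \<eta>' x)" for k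
      using integrable_bounded_mult'[OF Tv _ N(2)] integrable_bounded_mult'[OF T\<psi> _ N(2)] by auto
    have i2: "integrable lebesgue (\<lambda>x. \<eta> x *\<^sub>R T' (v x) *\<^sub>R G x)" "integrable lebesgue (\<lambda>x. \<eta> x *\<^sub>R T' (\<psi> k x) *\<^sub>R grad (\<psi> k) x)" for k
      using integrable_bounded_mult[OF T'v _ N(1)] integrable_bounded_mult[OF T'\<psi> _ N(1)] by auto
    \<comment> \<open>Exact for each test function: \<open>T 0 = 0\<close> gives
      \<open>T (\<psi> k x) * \<eta> x\<close> bounded support, even where \<eta> has none, so its
      gradient integrates to zero.\<close>
    have parts: "(\<integral>x. T (\<psi> k x) *\<^sub>R \<eta>' x \<partial>lebesgue) = - (\<integral>x. \<eta> x *\<^sub>R T' (\<psi> k x) *\<^sub>R grad (\<psi> k) x \<partial>lebesgue)" for k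
    proof -
      obtain S where S: "compact S" "\<And>x. x \<notin> S \<Longrightarrow> \<psi> k x = 0" using test_functionE[OF \<psi>[of k]] by metis
      note CT = C1_grad_compose[OF C[of k] T(1,2)]
      note CC = C1_grad_mult[OF CT \<eta>]
      have "(\<integral>x. T (\<psi> k x) *\<^sub>R \<eta>' x + \<eta> x *\<^sub>R T' (\<psi> k x) *\<^sub>R grad (\<psi> k) x \<partial>lborel) = 0"
        by (rule integral_C1_grad_eq_0[OF CC _ compact_imp_bounded[OF S(1)]]) (simp add: S(2) T(4))
      then have "(\<integral>x. T (\<psi> k x) *\<^sub>R \<eta>' x + \<eta> x *\<^sub>R T' (\<psi> k x) *\<^sub>R grad (\<psi> k) x \<partial>lebesgue) = 0"
        using C1_grad_continuous'[OF CC, of UNIV] by (subst integral_completion) (auto intro: borel_measurable_continuous_onI)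
      then show ?thesis using i1(2)[of k] i2(2)[of k] by (simp add: eq_neg_iff_add_eq_0)
    qed
    have A: "(\<lambda>k. \<integral>x. T (\<psi> k x) *\<^sub>R \<eta>' x \<partial>lebesgue) \<longlonglongrightarrow> (\<integral>x. T (v x) *\<^sub>R \<eta>' x \<partial>lebesgue)"
    proof (rule tendsto_L1_int[OF i1(2) i1(1)])
      have *: "(\<integral>\<^sup>+x. norm (T (\<psi> k x) *\<^sub>R \<eta>' x - T (v x) *\<^sub>R \<eta>' x) \<partial>lebesgue) \<le> ennreal (M * N) * (\<integral>\<^sup>+x. norm (\<psi> k x - v x) \<partial>lebesgue)" for k
      proof -
        have "norm (T (\<psi> k x) *\<^sub>R \<eta>' x - T (v x) *\<^sub>R \<eta>' x) \<le> (M * N) * norm (\<psi> k x - v x)" for x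
        proof -
          have "\<bar>T (\<psi> k x) - T (v x)\<bar> * norm (\<eta>' x) \<le> (M * \<bar>\<psi> k x - v x\<bar>) * N"
            using TL N M0 by (intro mult_mono) auto
          then show ?thesis by (simp flip: scaleR_diff_left add: mult_ac)
        qed
        then have "(\<integral>\<^sup>+x. norm (T (\<psi> k x) *\<^sub>R \<eta>' x - T (v x) *\<^sub>R \<eta>' x) \<partial>lebesgue) \<le> (\<integral>\<^sup>+x. ennreal (M * N) * ennreal (norm (\<psi> k x - v x)) \<partial>lebesgue)"
          using M0 N0 by (intro nn_integral_mono) (simp flip: ennreal_mult)
        then show ?thesis by (subst (asm) nn_integral_cmult) auto
      qed
      show "(\<lambda>k. \<integral>\<^sup>+x. norm (T (\<psi> k x) *\<^sub>R \<eta>' x - T (v x) *\<^sub>R \<eta>' x) \<partial>lebesgue) \<longlonglongrightarrow> 0"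
      proof (rule tendsto_sandwich[OF _ _ tendsto_const])
        show "(\<lambda>k. ennreal (M * N) * (\<integral>\<^sup>+x. norm (\<psi> k x - v x) \<partial>lebesgue)) \<longlonglongrightarrow> 0"
          using ennreal_tendsto_cmult[OF _ L1, of "ennreal (M * N)"] by simp
      qed (use * in auto)
    qed
    have B: "(\<lambda>k. \<integral>x. \<eta> x *\<^sub>R T' (\<psi> k x) *\<^sub>R grad (\<psi> k) x \<partial>lebesgue) \<longlonglongrightarrow> (\<integral>x. \<eta> x *\<^sub>R T' (v x) *\<^sub>R G x \<partial>lebesgue)"
    proof (rule tendsto_L1_int[OF i2(2) i2(1)])
      have *: "(\<integral>\<^sup>+x. norm (\<eta> x *\<^sub>R T' (\<psi> k x) *\<^sub>R grad (\<psi> k) x - \<eta> x *\<^sub>R T' (v x) *\<^sub>R G x) \<partial>lebesgue)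
          \<le> ennreal (N * M) * (\<integral>\<^sup>+x. norm (grad (\<psi> k) x - G x) \<partial>lebesgue)
           + ennreal N * (\<integral>\<^sup>+x. norm (T' (v x) *\<^sub>R G x - T' (\<psi> k x) *\<^sub>R G x) \<partial>lebesgue)" for k
      proof -
        have "norm (\<eta> x *\<^sub>R T' (\<psi> k x) *\<^sub>R grad (\<psi> k) x - \<eta> x *\<^sub>R T' (v x) *\<^sub>R G x)
            \<le> (N * M) * norm (grad (\<psi> k) x - G x) + N * norm (T' (v x) *\<^sub>R G x - T' (\<psi> k x) *\<^sub>R G x)" for x
        proof -
          \<comment> \<open>The mixed term \<open>T' (\<psi> k x) *\<^sub>R G x\<close> is inserted:
            one difference is then governed by the convergence of gradients \<open>L2\<close>, the
            other by \<open>L3\<close>.\<close>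
          have "\<eta> x *\<^sub>R T' (\<psi> k x) *\<^sub>R grad (\<psi> k) x - \<eta> x *\<^sub>R T' (v x) *\<^sub>R G x
              = (\<eta> x * T' (\<psi> k x)) *\<^sub>R (grad (\<psi> k) x - G x) - \<eta> x *\<^sub>R (T' (v x) *\<^sub>R G x - T' (\<psi> k x) *\<^sub>R G x)"
            by (simp add: algebra_simps)
          also have "norm \<dots> \<le> \<bar>\<eta> x * T' (\<psi> k x)\<bar> * norm (grad (\<psi> k) x - G x) + \<bar>\<eta> x\<bar> * norm (T' (v x) *\<^sub>R G x - T' (\<psi> k x) *\<^sub>R G x)"
            using norm_triangle_ineq4 by (metis norm_scaleR)
          also have "\<dots> \<le> (N * M) * norm (grad (\<psi> k) x - G x) + N * norm (T' (v x) *\<^sub>R G x - T' (\<psi> k x) *\<^sub>R G x)"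
            using N T(3) N0 M0 unfolding abs_mult by (intro add_mono mult_mono) auto
          finally show ?thesis .
        qed
        then have "(\<integral>\<^sup>+x. norm (\<eta> x *\<^sub>R T' (\<psi> k x) *\<^sub>R grad (\<psi> k) x - \<eta> x *\<^sub>R T' (v x) *\<^sub>R G x) \<partial>lebesgue)
          \<le> (\<integral>\<^sup>+x. ennreal (N * M) * ennreal (norm (grad (\<psi> k) x - G x)) + ennreal N * ennreal (norm (T' (v x) *\<^sub>R G x - T' (\<psi> k x) *\<^sub>R G x)) \<partial>lebesgue)"
          using M0 N0 by (intro nn_integral_mono) (simp flip: ennreal_mult ennreal_plus)
        also have "\<dots> = ennreal (N * M) * (\<integral>\<^sup>+x. norm (grad (\<psi> k) x - G x) \<partial>lebesgue)
           + ennreal N * (\<integral>\<^sup>+x. norm (T' (v x) *\<^sub>R G x - T' (\<psi> k x) *\<^sub>R G x) \<partial>lebesgue)"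
          by (subst nn_integral_add) (auto simp: nn_integral_cmult)
        finally show ?thesis .
      qed
      show "(\<lambda>k. \<integral>\<^sup>+x. norm (\<eta> x *\<^sub>R T' (\<psi> k x) *\<^sub>R grad (\<psi> k) x - \<eta> x *\<^sub>R T' (v x) *\<^sub>R G x) \<partial>lebesgue) \<longlonglongrightarrow> 0"
      proof (rule tendsto_sandwich[OF _ _ tendsto_const])
        show "(\<lambda>k. ennreal (N * M) * (\<integral>\<^sup>+x. norm (grad (\<psi> k) x - G x) \<partial>lebesgue)
           + ennreal N * (\<integral>\<^sup>+x. norm (T' (v x) *\<^sub>R G x - T' (\<psi> k x) *\<^sub>R G x) \<partial>lebesgue)) \<longlonglongrightarrow> 0"
          using tendsto_add[OF ennreal_tendsto_cmult[OF _ L2, of "ennreal (N * M)"] ennreal_tendsto_cmult[OF _ L3, of "ennreal N"]]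
          by simp
      qed (use * in auto)
    qed
    show "(\<integral>x. T (v x) *\<^sub>R \<eta>' x \<partial>lebesgue) = - (\<integral>x. \<eta> x *\<^sub>R T' (v x) *\<^sub>R G x \<partial>lebesgue)"
      using LIMSEQ_unique[OF A] tendsto_minus[OF B] unfolding parts by simp
  qed
qed


text \<open>Let \<open>h\<close> be the square of the positive part, which is C1. Then
  \<open>h (1 - s)\<close> vanishes for \<open>s \<ge> 1\<close> and is at least 1 for
  \<open>s \<le> 0\<close>, so applying the same map once more gives a C1 step from 0 to 1. Each of
  the two derivatives contributes at most 2 on the unit interval.\<close>

lemma ex_plateau:
  obtains T T' :: "real \<Rightarrow> real" where "\<And>s. (T has_real_derivative T' s) (at s)" "continuous_on UNIV T'"
    "\<And>s. \<bar>T' s\<bar> \<le> 4" "T 0 = 0" "\<And>s. s \<ge> 1 \<Longrightarrow> T s = 1" "\<And>s. s \<ge> 1 \<Longrightarrow> T' s = 0"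
    "\<And>s. s \<le> 0 \<Longrightarrow> T s = 0" "\<And>s. \<bar>T s\<bar> \<le> 1"
proof -
  define h where "h s = (max 0 s)\<^sup>2" for s :: real
  have h: "(h has_real_derivative 2 * max 0 s) (at s)" for s
  proof (cases s "0::real" rule: linorder_cases)
    case less
    have "((\<lambda>s. 0) has_real_derivative 2 * max 0 s) (at s)" using less by simp
    then show ?thesis
      by (rule has_field_derivative_transform_within_open[of _ _ _ "{..<0}"]) (use less in \<open>auto simp: h_def\<close>)
  next
    case equal
    have "((\<lambda>t. h t / t) \<longlongrightarrow> 0) (at 0)"
    proof (rule Lim_transform_eventually)
      have "((\<lambda>t. max 0 t) \<longlongrightarrow> max 0 (0::real)) (at 0)" by (intro tendsto_intros)
      then show "((\<lambda>t. max 0 t) \<longlongrightarrow> (0::real)) (at 0)" by simp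
      show "\<forall>\<^sub>F t in at 0. max 0 t = h t / t"
        by (auto simp: eventually_at_filter h_def max_def power2_eq_square)
    qed
    then show ?thesis using equal by (simp add: DERIV_def h_def)
  next
    case greater
    have "((\<lambda>s. s\<^sup>2) has_real_derivative 2 * max 0 s) (at s)"
      using greater by (auto intro!: derivative_eq_intros)
    then show ?thesis
      by (rule has_field_derivative_transform_within_open[of _ _ _ "{0<..}"]) (use greater in \<open>auto simp: h_def\<close>)
  qed
  define T where "T s = h (1 - h (1 - s))" for s
  define T' where "T' s = 2 * max 0 (1 - h (1 - s)) * (2 * max 0 (1 - s))" for s
  have hc: "continuous_on S h" for S unfolding h_def by (intro continuous_intros)
  have h1: "h s \<ge> 1" if "s \<ge> 1" for s using that by (simp add: h_def)
  have h0: "h s = 0" if "s \<le> 0" for s using that by (simp add: h_def)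
  have hp: "h s \<ge> 0" for s by (simp add: h_def)
  have h01: "0 \<le> h s \<and> h s \<le> 1" if "s \<le> 1" for s
    using that by (auto simp: h_def abs_square_le_1)
  show ?thesis
  proof
    show "(T has_real_derivative T' s) (at s)" for s
    proof -
      have 1: "((\<lambda>s. h (1 - s)) has_real_derivative - (2 * max 0 (1 - s))) (at s)"
      proof -
        have "((\<lambda>s. 1 - s) has_real_derivative -1) (at s)" by (auto intro!: derivative_eq_intros)
        from DERIV_chain2[where g="\<lambda>s. 1 - s" and Db="-1" and x=s and f=h, OF h this] show ?thesis by simp
      qed
      have 2: "((\<lambda>s. 1 - h (1 - s)) has_real_derivative 2 * max 0 (1 - s)) (at s)"
        using DERIV_diff[OF DERIV_const[of 1] 1] by simp
      show ?thesis unfolding T_def[abs_def] T'_def by (rule DERIV_chain2[OF h 2])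
    qed
    show "continuous_on UNIV T'"
      unfolding T'_def by (intro continuous_intros continuous_on_compose2[OF hc]) auto
    have z: "T' s = 0" if "s \<le> 0" for s using h1[of "1 - s"] that by (simp add: T'_def)
    show "T s = 0" if "s \<le> 0" for s using h1[of "1 - s"] that by (simp add: T_def h0)
    then show "T 0 = 0" by simp
    show o: "T s = 1" "T' s = 0" if "s \<ge> 1" for s using that by (auto simp: T_def T'_def h0) (simp add: h_def)
    show "\<bar>T s\<bar> \<le> 1" for s unfolding T_def using h01[of "1 - h (1 - s)"] hp by auto
    show "\<bar>T' s\<bar> \<le> 4" for s
    proof (cases "0 \<le> s \<and> s \<le> 1")
      case True
      have "max 0 (1 - h (1 - s)) * max 0 (1 - s) \<le> 1 * 1" using hp True by (intro mult_mono) auto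
      then show ?thesis by (simp add: T'_def abs_mult)
    next
      case False
      then show ?thesis using z o by (cases "s \<le> 0") auto
    qed
  qed
qed

text \<open>A Hoelder function in \<open>W11_0\<close> tends to zero at the boundary: otherwise composition with a
  plateau function would make a nonzero multiple of the indicator of the domain weakly differentiable
  with vanishing gradient near a boundary point.\<close>

lemma holder_W11_0_boundary:
  fixes \<Omega> :: "'a::euclidean_space set"
  assumes \<Omega>: "open \<Omega>" "lipschitz_boundary \<Omega>" and \<phi>: "\<phi> \<in> W11_0 \<Omega>"
    and H: "\<And>x y. x \<in> \<Omega> \<Longrightarrow> y \<in> \<Omega> \<Longrightarrow> \<bar>\<phi> x - \<phi> y\<bar> \<le> H * norm (x - y) powr \<gamma>" "H \<ge> 0" "\<gamma> > 0"
    and x: "x \<in> \<Omega>" and y: "y \<notin> \<Omega>"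
  shows "\<bar>\<phi> x\<bar> \<le> H * norm (x - y) powr \<gamma>"
proof (rule ccontr)
  assume contra: "\<not> \<bar>\<phi> x\<bar> \<le> H * norm (x - y) powr \<gamma>"
  \<comment> \<open>The segment leaves \<Omega> through a boundary point no farther from
    \<open>x\<close> than \<open>y\<close> is, so the contradiction can be sought at a boundary
    point.\<close>
  have "closed_segment x y \<inter> frontier \<Omega> \<noteq> {}"
    using x y by (intro connected_Int_frontier) auto
  then obtain x0 where x0: "x0 \<in> closed_segment x y" "x0 \<in> frontier \<Omega>" by blast
  have "norm (x - x0) \<le> norm (x - y)"
    using segment_bound1[OF x0(1)] by (simp add: norm_minus_commute)
  then have "H * norm (x - x0) powr \<gamma> \<le> H * norm (x - y) powr \<gamma>"
    using H by (intro mult_left_mono powr_mono2) auto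
  then have lt: "H * norm (x - x0) powr \<gamma> < \<bar>\<phi> x\<bar>" using contra by linarith
  \<comment> \<open>Half of the excess: the other half absorbs the variation of the Hoelder bound
    near \<open>x0\<close>, so there \<open>\<phi>\<close> keeps the sign of \<open>\<phi> x\<close>
    and has modulus at least \<open>c\<close>.\<close>
  define c where "c = (\<bar>\<phi> x\<bar> - H * norm (x - x0) powr \<gamma>) / 2"
  have c: "c > 0" using lt by (simp add: c_def)
  have "((\<lambda>z. H * norm (x - z) powr \<gamma>) \<longlongrightarrow> H * norm (x - x0) powr \<gamma>) (at x0)"
    using H(3) by (intro tendsto_intros tendsto_powr2) auto
  then have "\<forall>\<^sub>F z in at x0. H * norm (x - z) powr \<gamma> < \<bar>\<phi> x\<bar> - c"
    by (rule order_tendstoD(2)) (use lt in \<open>simp add: c_def field_simps\<close>)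
  then obtain r1 where r1: "r1 > 0" "\<And>z. z \<noteq> x0 \<Longrightarrow> dist z x0 < r1 \<Longrightarrow> H * norm (x - z) powr \<gamma> < \<bar>\<phi> x\<bar> - c"
    unfolding eventually_at by auto
  have x0n: "x0 \<notin> \<Omega>" using x0(2) \<Omega>(1) by (simp add: frontier_def interior_open)
  define s where "s = sgn (\<phi> x)"
  have s: "s * \<phi> x = \<bar>\<phi> x\<bar>" "\<bar>s\<bar> = 1"
  proof -
    have "\<bar>\<phi> x\<bar> > 0" by (rule le_less_trans[OF _ lt]) (use H(2) in simp)
    then show "s * \<phi> x = \<bar>\<phi> x\<bar>" "\<bar>s\<bar> = 1" by (auto simp: s_def sgn_if)
  qed
  have ge: "s * \<phi> z \<ge> c" if z: "z \<in> \<Omega>" "z \<in> ball x0 r1" for z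
  proof -
    have "z \<noteq> x0" using z x0n by auto
    then have "H * norm (x - z) powr \<gamma> < \<bar>\<phi> x\<bar> - c" using r1(2)[of z] z by (simp add: dist_commute)
    moreover have "\<bar>\<phi> x - \<phi> z\<bar> \<le> H * norm (x - z) powr \<gamma>" using H(1) x z by simp
    moreover have "\<bar>s * \<phi> x - s * \<phi> z\<bar> = \<bar>\<phi> x - \<phi> z\<bar>"
      using s(2) by (simp add: abs_mult flip: right_diff_distrib)
    ultimately show ?thesis using s(1) by linarith
  qed
  obtain T T' where T: "\<And>s. (T has_real_derivative T' s) (at s)" "continuous_on UNIV T'"
    "\<And>s. \<bar>T' s\<bar> \<le> 4" "T 0 = 0" "\<And>s. s \<ge> 1 \<Longrightarrow> T s = 1" "\<And>s. s \<ge> 1 \<Longrightarrow> T' s = 0"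
    using ex_plateau by metis
  \<comment> \<open>Scaled so that \<open>S\<close> is already on its plateau at every value of
    \<phi> taken in \<Omega> near \<open>x0\<close>: the composition is 1 inside, its extension is 0
    outside, and its gradient vanishes on both sides.\<close>
  define S where "S t = T (s / c * t)" for t
  define S' where "S' t = s / c * T' (s / c * t)" for t
  have S: "(S has_real_derivative S' t) (at t)" "\<bar>S' t\<bar> \<le> 4 / c" "S 0 = 0" for t
  proof -
    have "((\<lambda>t. s / c * t) has_real_derivative s / c) (at t)"
      using c by (auto intro!: derivative_eq_intros)
    from DERIV_chain2[OF T(1) this] show "(S has_real_derivative S' t) (at t)"
      unfolding S_def[abs_def] S'_def by (simp add: mult.commute)
    show "\<bar>S' t\<bar> \<le> 4 / c" using T(3)[of "s / c * t"] c s(2) by (simp add: S'_def abs_mult divide_right_mono)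
  qed (simp add: S_def T)
  have S'c: "continuous_on UNIV S'"
    unfolding S'_def by (intro continuous_intros continuous_on_compose2[OF T(2)]) (use c in auto)
  note w = W11_0_chain[OF \<Omega>(1) \<phi> S(1) S'c S(2) S(3)]
  have one: "s / c * \<phi> z \<ge> 1" if "z \<in> \<Omega>" "z \<in> ball x0 r1" for z
    using ge[OF that] c by (simp add: field_simps)
  obtain r2 e L g where r2: "r2 > 0" and e: "norm e = 1" and g: "L-lipschitz_on {y. y \<bullet> e = 0} g"
     and \<Omega>r: "\<Omega> \<inter> ball x0 r2 = {x \<in> ball x0 r2. g (x - (x \<bullet> e) *\<^sub>R e) < x \<bullet> e}"
    using \<Omega>(2) x0(2) unfolding lipschitz_boundary_def by meson
  have ee: "e \<bullet> e = 1" using e by (simp add: norm_eq_1)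
  define F where "F z = z \<bullet> e - g (z - (z \<bullet> e) *\<^sub>R e)" for z
  have Fc: "continuous_on UNIV F"
    unfolding F_def
    by (intro continuous_intros continuous_on_compose2[OF lipschitz_on_continuous_on[OF g]])
       (auto simp: inner_diff_left ee)
  define r where "r = min r1 r2"
  have r: "r > 0" "r \<le> r1" "r \<le> r2" using r1 r2 by (auto simp: r_def)
  have "(1::real) = 0"
  proof (rule no_jump[OF w, of x0 r])
    show "indicator \<Omega> z *\<^sub>R S' (\<phi> z) *\<^sub>R weak_gradient \<Omega> \<phi> z = 0" if "z \<in> ball x0 r" for z
    proof (cases "z \<in> \<Omega>")
      case True
      then have "S' (\<phi> z) = 0" using one[of z] that r by (simp add: S'_def T(6))
      then show ?thesis by simp
    qed simp
    show "open (\<Omega> \<inter> ball x0 (r / 2))" using \<Omega> by auto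
    show "\<Omega> \<inter> ball x0 (r / 2) \<noteq> {}"
    proof -
      have "x0 \<in> closure \<Omega>" using x0(2) by (simp add: frontier_def)
      then obtain z where "z \<in> \<Omega>" "dist z x0 < r / 2"
        using r closure_approachable half_gt_zero by metis
      then show ?thesis by (auto simp: dist_commute)
    qed
    show "indicator \<Omega> z * S (\<phi> z) = 1" if "z \<in> \<Omega> \<inter> ball x0 (r / 2)" for z
    proof -
      have "z \<in> ball x0 r1" using that r by auto
      then show ?thesis using one[of z] that by (simp add: S_def T(5))
    qed
    \<comment> \<open>The points below the graph form an open part of the complement. Since
      \<open>x0\<close> is not in \<Omega>, \<open>F x0 \<le> 0\<close>, and moving down by
      \<open>r / 4\<close> lowers \<open>F\<close> by \<open>r / 4\<close> as the horizontal
      component stays fixed.\<close>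
    define V where "V = ball x0 (r / 2) \<inter> F -` {..<0}"
    show "open V" unfolding V_def by (intro open_Int open_vimage open_lessThan Fc) simp
    show "V \<subseteq> ball x0 (r / 2)" by (simp add: V_def)
    show "V \<noteq> {}"
    proof -
      have "F x0 \<le> 0" using x0n \<Omega>r r2 by (force simp: F_def)
      moreover have "F (x0 - (r / 4) *\<^sub>R e) = F x0 - r / 4"
        by (simp add: F_def inner_diff_left ee algebra_simps)
      ultimately have "F (x0 - (r / 4) *\<^sub>R e) < 0" using r by simp
      moreover have "x0 - (r / 4) *\<^sub>R e \<in> ball x0 (r / 2)" using r e by (simp add: dist_norm)
      ultimately show ?thesis unfolding V_def by blast
    qed
    show "indicator \<Omega> z * S (\<phi> z) = 0" if "z \<in> V" for z
    proof -
      have "z \<in> ball x0 r2" "F z < 0" using that r by (auto simp: V_def)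
      have "z \<notin> \<Omega>"
      proof
        assume "z \<in> \<Omega>"
        then have "z \<in> {x \<in> ball x0 r2. g (x - (x \<bullet> e) *\<^sub>R e) < x \<bullet> e}"
          unfolding \<Omega>r[symmetric] using \<open>z \<in> ball x0 r2\<close> by blast
        then show False using \<open>F z < 0\<close> by (simp add: F_def)
      qed
      then show ?thesis by simp
    qed
  qed auto
  then show False by simp
qed

section \<open>Mollification and the double phase energy\<close>

text \<open>Convexity applied to \<open>s + t = (1 - l) * (s / (1 - l)) + l * (t / l)\<close>. The
  weights are unequal on purpose: for small \<open>l\<close> the factor at \<open>s\<close> is close
  to 1.\<close>

lemma powr_add_le_split:
  fixes s t r l :: real
  assumes "s \<ge> 0" "t \<ge> 0" "r \<ge> 1" "0 < l" "l < 1"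
  shows "(s + t) powr r \<le> (1 - l) powr (1 - r) * s powr r + l powr (1 - r) * t powr r"
proof -
  have ge1: "1 \<le> c powr (1 - r)" if "0 < c" "c < 1" for c
    using that assms powr_mono'[of "1 - r" 0 c] by simp
  consider "s = 0" | "t = 0" | "s > 0" "t > 0" using assms by linarith
  then show ?thesis
  proof cases
    case 1
    then show ?thesis using ge1[of l] assms mult_right_mono[of 1 "l powr (1 - r)" "t powr r"] by simp
  next
    case 2
    then show ?thesis using ge1[of "1 - l"] assms mult_right_mono[of 1 "(1 - l) powr (1 - r)" "s powr r"] by simp
  next
    case 3
    have eq: "c * (x / c) powr r = c powr (1 - r) * x powr r" if "c > 0" "x > 0" for c x :: real
      using that by (simp add: powr_divide powr_diff)
    have "((1 - l) *\<^sub>R (s / (1 - l)) + l *\<^sub>R (t / l)) powr r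
        \<le> (1 - l) * (s / (1 - l)) powr r + l * (t / l) powr r"
      using assms 3 by (intro convex_onD[OF powr_convex]) auto
    moreover have "(1 - l) *\<^sub>R (s / (1 - l)) + l *\<^sub>R (t / l) = s + t" using assms by simp
    ultimately show ?thesis using eq[of "1 - l" s] eq[of l t] assms 3 by simp
  qed
qed

lemma powr_above_tangent:
  fixes s t r :: real
  assumes "s \<ge> 0" "t \<ge> 0" "r > 1"
  shows "s powr r + r * s powr (r - 1) * (t - s) \<le> t powr r"
proof -
  consider "s = 0" | "s > 0" "t = 0" | "s > 0" "t > 0" using assms by linarith
  then show ?thesis
  proof cases
    case 2
    have "s powr (r - 1) * s = s powr r"
      using 2 by (metis powr_mult_base mult.commute diff_add_cancel add.commute less_eq_real_def)
    then have "s powr r + r * s powr (r - 1) * (t - s) = (1 - r) * s powr r"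
      using 2 by (simp add: algebra_simps)
    then show ?thesis using 2 assms by (simp add: mult_nonpos_nonneg)
  next
    case 3
    have "t powr r - s powr r \<ge> (r * s powr (r - 1)) * (t - s)"
    proof (rule convex_on_imp_above_tangent[OF powr_convex])
      show "((\<lambda>x. x powr r) has_real_derivative r * s powr (r - 1)) (at s within {0<..})"
        using 3 by (auto intro!: derivative_eq_intros DERIV_subset[OF has_real_derivative_powr])
    qed (use 3 assms in \<open>auto simp: interior_open\<close>)
    then show ?thesis by simp
  qed (use assms in auto)
qed

text \<open>Jensen by a supporting line: the tangent of \<open>t powr r\<close> at
  \<open>s = conv K h x\<close> is integrated against the probability density
  \<open>\<lambda>y. K (x - y)\<close>, and its linear part integrates to the value at
  \<open>s\<close>. The constant \<open>m\<close> only has to be a lower bound for the weight where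
  the kernel lives, which is how a varying coefficient enters.\<close>

lemma conv_powr_le:
  assumes mo: "mollifier w A \<delta> K K'" and \<delta>: "\<delta> > 0"
    and h: "integrable lebesgue h" "\<And>y. 0 \<le> h y" and G: "integrable lebesgue G" "\<And>y. 0 \<le> G y"
    and r: "r > 1" and m: "0 \<le> (m::real)" "\<And>y. K (x - y) \<noteq> 0 \<Longrightarrow> m * h y powr r \<le> G y"
  shows "m * conv K h x powr r \<le> conv K G x"
proof -
  note k = mollifierD[OF mo \<delta>]
  define s where "s = conv K h x"
  have s: "s \<ge> 0" unfolding s_def conv_def using k(5) h(2) by simp
  have i1: "integrable lebesgue (\<lambda>y. K (x - y))" "(\<integral>y. K (x - y) \<partial>lebesgue) = 1"
    by (rule mollifier_integral_reflect[OF mo \<delta>])+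
  have i2: "integrable lebesgue (\<lambda>y. K (x - y) * h y)" "integrable lebesgue (\<lambda>y. K (x - y) * G y)"
    using mollifier_conv_integrable[OF mo \<delta> h(1)] mollifier_conv_integrable[OF mo \<delta> G(1)] by auto
  \<comment> \<open>Intercept and slope of the tangent at \<open>s\<close>, multiplied by
    \<open>m\<close>.\<close>
  define \<alpha> where "\<alpha> = m * (s powr r - r * s powr (r - 1) * s)"
  define \<beta> where "\<beta> = m * (r * s powr (r - 1))"
  have "(\<integral>y. \<alpha> * K (x - y) + \<beta> * (K (x - y) * h y) \<partial>lebesgue) \<le> (\<integral>y. K (x - y) * G y \<partial>lebesgue)"
  proof (rule integral_mono)
    show "integrable lebesgue (\<lambda>y. \<alpha> * K (x - y) + \<beta> * (K (x - y) * h y))" using i1 i2 by simp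
    show "integrable lebesgue (\<lambda>y. K (x - y) * G y)" by (rule i2)
    fix y
    have "m * (s powr r + r * s powr (r - 1) * (h y - s)) \<le> m * h y powr r"
      by (intro mult_left_mono powr_above_tangent s h r m)
    then have "K (x - y) * (m * (s powr r + r * s powr (r - 1) * (h y - s))) \<le> K (x - y) * G y"
      using m(2)[of y] k(5)[of "x - y"] by (cases "K (x - y) = 0") (auto intro!: mult_left_mono)
    then show "\<alpha> * K (x - y) + \<beta> * (K (x - y) * h y) \<le> K (x - y) * G y"
      by (simp add: \<alpha>_def \<beta>_def algebra_simps)
  qed
  also have "(\<integral>y. \<alpha> * K (x - y) + \<beta> * (K (x - y) * h y) \<partial>lebesgue) = \<alpha> + \<beta> * s"
    using i1 i2 by (simp add: s_def conv_def)
  also have "\<alpha> + \<beta> * s = m * s powr r" by (simp add: \<alpha>_def \<beta>_def algebra_simps)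
  finally show ?thesis by (simp add: s_def conv_def)
qed

lemma norm_conv_le_conv_norm:
  fixes g :: "'a::euclidean_space \<Rightarrow> 'b::euclidean_space"
  assumes mo: "mollifier w A \<delta> K K'" and \<delta>: "\<delta> > 0" and g: "integrable lebesgue g"
  shows "norm (conv K g x) \<le> conv K (\<lambda>y. norm (g y)) x"
  unfolding conv_def
proof (rule Bochner_Integration.integral_norm_bound_integral[OF mollifier_conv_integrable[OF mo \<delta> g]])
  show "integrable lebesgue (\<lambda>y. K (x - y) *\<^sub>R norm (g y))"
    by (rule mollifier_conv_integrable[OF mo \<delta>]) (use g in auto)
  show "norm (K (x - y) *\<^sub>R g y) \<le> K (x - y) *\<^sub>R norm (g y)" for y
    using mollifierD(5)[OF mo \<delta>] by simp
qed

text \<open>The set under the closure contains all points where the convolution of a function living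
  on \<open>\<Omega> \<inter> ball x0 r\<close> with a kernel of direction \<open>w\<close> can be
  nonzero. The closure is taken because a test function needs its closed support inside \<Omega>,
  and \<open>r\<close> stays fixed as \<delta> tends to 0.\<close>

definition inward_shift :: "'a::euclidean_space set \<Rightarrow> 'a \<Rightarrow> real \<Rightarrow> 'a \<Rightarrow> bool" where
  "inward_shift \<Omega> x0 r w \<longleftrightarrow> (\<exists>d>0. \<forall>\<delta>. 0 < \<delta> \<and> \<delta> < d \<longrightarrow>
     closure {x. \<exists>y\<in>\<Omega> \<inter> ball x0 r. x - y \<in> cball (\<delta> *\<^sub>R w) \<delta>} \<subseteq> \<Omega>)"

section \<open>The energy as a modular on vector fields\<close>

locale double_phase =
  fixes \<Omega> :: "'a::euclidean_space set" and a :: "'a \<Rightarrow> real" and p q \<kappa> C :: real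
  assumes open_\<Omega>: "open \<Omega>" and bounded_\<Omega>: "bounded \<Omega>"
    and a_measurable: "(\<lambda>x. indicator \<Omega> x * a x) \<in> borel_measurable lebesgue"
    and a_nonneg: "x \<in> \<Omega> \<Longrightarrow> 0 \<le> a x"
    and C_pos: "C > 0" and Z: "x \<in> \<Omega> \<Longrightarrow> y \<in> \<Omega> \<Longrightarrow> a x \<le> C * (a y + norm (x - y) powr \<kappa>)"
    and p: "1 < p" and q: "p < q" and \<kappa>: "\<kappa> > 0"
begin

text \<open>The indicator is built in so that the energy density is defined on the whole space and
  can itself be mollified.\<close>

definition density :: "'a \<Rightarrow> 'a \<Rightarrow> real" where
  "density x \<xi> = indicator \<Omega> x * (norm \<xi> powr p + a x * norm \<xi> powr q)"

text \<open>Defined on vector fields rather than functions, so that cut-off, truncated and mollified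
  gradients can be measured without referring to chosen weak gradients. It is in general neither
  homogeneous nor subadditive; the weighted inequality \<open>N_add_le\<close> replaces the triangle
  inequality.\<close>

definition N :: "('a \<Rightarrow> 'a) \<Rightarrow> ennreal" where
  "N g = (\<integral>\<^sup>+x. ennreal (density x (g x)) \<partial>lebesgue)"

lemma q1: "q > 1" using p q by simp

lemma density_nonneg: "density x \<xi> \<ge> 0"
  using a_nonneg[of x] by (auto simp: density_def indicator_def)

lemma density_0 [simp]: "density x 0 = 0"
  by (simp add: density_def)

lemma density_measurable [measurable]:
  assumes [measurable]: "g \<in> borel_measurable lebesgue"
  shows "(\<lambda>x. density x (g x)) \<in> borel_measurable lebesgue"
proof -
  note [measurable] = a_measurable
  have [measurable]: "\<Omega> \<in> sets lebesgue" using open_\<Omega> by simp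
  have "(\<lambda>x. density x (g x)) = (\<lambda>x. indicator \<Omega> x * norm (g x) powr p + (indicator \<Omega> x * a x) * norm (g x) powr q)"
    by (simp add: density_def fun_eq_iff algebra_simps)
  also have "\<dots> \<in> borel_measurable lebesgue" by measurable
  finally show ?thesis .
qed

lemma N_cong_AE: "AE x in lebesgue. x \<in> \<Omega> \<longrightarrow> g x = h x \<Longrightarrow> N g = N h"
  unfolding N_def by (rule nn_integral_cong_AE) (auto elim!: eventually_mono simp: density_def indicator_def)

lemma N_cong: "(\<And>x. x \<in> \<Omega> \<Longrightarrow> g x = h x) \<Longrightarrow> N g = N h"
  by (rule N_cong_AE) simp

lemma density_mono: "norm \<xi> \<le> norm \<zeta> \<Longrightarrow> density x \<xi> \<le> density x \<zeta>"
  using a_nonneg[of x] p q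
  by (cases "x \<in> \<Omega>") (auto simp: density_def intro!: add_mono mult_left_mono powr_mono2)

lemma density_add_le:
  assumes "0 < l" "l < 1"
  shows "density x (\<xi> + \<zeta>) \<le> (1 - l) powr (1 - q) * density x \<xi> + l powr (1 - q) * density x \<zeta>"
proof (cases "x \<in> \<Omega>")
  case True
  \<comment> \<open>For weights below 1 the factor belonging to exponent \<open>q\<close> dominates
    the one belonging to \<open>p\<close>, so one pair of factors serves both phases.\<close>
  have mono: "c powr (1 - p) \<le> c powr (1 - q)" if "0 < c" "c < 1" for c
    using that q by (intro powr_mono') auto
  have 1: "norm (\<xi> + \<zeta>) powr r \<le> (1 - l) powr (1 - r) * norm \<xi> powr r + l powr (1 - r) * norm \<zeta> powr r"
    if "r > 1" for r
  proof -
    have "norm (\<xi> + \<zeta>) powr r \<le> (norm \<xi> + norm \<zeta>) powr r"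
      using that by (intro powr_mono2 norm_triangle_ineq) auto
    also have "\<dots> \<le> (1 - l) powr (1 - r) * norm \<xi> powr r + l powr (1 - r) * norm \<zeta> powr r"
      using assms that by (intro powr_add_le_split) auto
    finally show ?thesis .
  qed
  have "norm (\<xi> + \<zeta>) powr p \<le> (1 - l) powr (1 - q) * norm \<xi> powr p + l powr (1 - q) * norm \<zeta> powr p"
    using 1[OF p] mult_right_mono[OF mono[of "1 - l"], of "norm \<xi> powr p"] mult_right_mono[OF mono[of l], of "norm \<zeta> powr p"] assms
    by simp
  moreover have "a x * norm (\<xi> + \<zeta>) powr q \<le> a x * ((1 - l) powr (1 - q) * norm \<xi> powr q + l powr (1 - q) * norm \<zeta> powr q)"
    by (intro mult_left_mono 1 q1 a_nonneg True)
  ultimately show ?thesis using True by (simp add: density_def algebra_simps)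
qed (simp add: density_def)

lemma N_add_le:
  assumes [measurable]: "g \<in> borel_measurable lebesgue" "h \<in> borel_measurable lebesgue" and l: "0 < l" "l < 1"
  shows "N (\<lambda>x. g x + h x) \<le> ennreal ((1 - l) powr (1 - q)) * N g + ennreal (l powr (1 - q)) * N h"
proof -
  have "N (\<lambda>x. g x + h x) \<le> (\<integral>\<^sup>+x. ennreal ((1 - l) powr (1 - q)) * ennreal (density x (g x)) + ennreal (l powr (1 - q)) * ennreal (density x (h x)) \<partial>lebesgue)"
    unfolding N_def using density_add_le[OF l] density_nonneg
    by (intro nn_integral_mono) (simp flip: ennreal_mult ennreal_plus)
  also have "\<dots> = ennreal ((1 - l) powr (1 - q)) * N g + ennreal (l powr (1 - q)) * N h"
    unfolding N_def by (subst nn_integral_add) (auto simp: nn_integral_cmult)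
  finally show ?thesis .
qed

text \<open>\<open>max 1 M\<close> replaces \<open>M\<close> so that its \<open>q\<close>-th power
  dominates its \<open>p\<close>-th power as well.\<close>

lemma N_scale_le:
  assumes [measurable]: "g \<in> borel_measurable lebesgue" and c: "\<And>x. \<bar>c x\<bar> \<le> M"
  shows "N (\<lambda>x. c x *\<^sub>R g x) \<le> ennreal (max 1 M powr q) * N g"
proof -
  let ?M = "max 1 M"
  have "density x (c x *\<^sub>R g x) \<le> ?M powr q * density x (g x)" for x
  proof (cases "x \<in> \<Omega>")
    case True
    have le: "(\<bar>c x\<bar> * norm (g x)) powr r \<le> ?M powr q * norm (g x) powr r" if "r > 1" "r \<le> q" for r
    proof -
      have "(\<bar>c x\<bar> * norm (g x)) powr r \<le> (?M * norm (g x)) powr r"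
        using c[of x] that by (intro powr_mono2 mult_right_mono) auto
      also have "\<dots> = ?M powr r * norm (g x) powr r" by (simp add: powr_mult)
      also have "\<dots> \<le> ?M powr q * norm (g x) powr r" using that by (intro mult_right_mono powr_mono) auto
      finally show ?thesis .
    qed
    have "a x * (\<bar>c x\<bar> * norm (g x)) powr q \<le> a x * (?M powr q * norm (g x) powr q)"
      by (intro mult_left_mono le q1 a_nonneg True) auto
    then show ?thesis using True le[OF p] q by (simp add: density_def algebra_simps)
  qed (simp add: density_def)
  then have "N (\<lambda>x. c x *\<^sub>R g x) \<le> (\<integral>\<^sup>+x. ennreal (?M powr q) * ennreal (density x (g x)) \<partial>lebesgue)"
    unfolding N_def using density_nonneg by (intro nn_integral_mono) (simp flip: ennreal_mult)
  also have "\<dots> = ennreal (?M powr q) * N g" unfolding N_def by (rule nn_integral_cmult) measurable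
  finally show ?thesis .
qed

text \<open>The oscillation condition against one fixed point of \<Omega> bounds \<open>a\<close> on
  the bounded set \<Omega>.\<close>

lemma N_bounded_finite:
  assumes "\<And>x. norm (g x) \<le> M" shows "N g < \<infinity>"
proof -
  obtain D where D: "\<And>x. x \<in> \<Omega> \<Longrightarrow> a x \<le> D"
  proof (cases "\<Omega> = {}")
    case False
    then obtain y where y: "y \<in> \<Omega>" by blast
    obtain R where R: "\<And>x y. x \<in> \<Omega> \<Longrightarrow> y \<in> \<Omega> \<Longrightarrow> dist x y \<le> R" using bounded_\<Omega> bounded_two_points by metis
    have "a x \<le> C * (a y + R powr \<kappa>)" if x: "x \<in> \<Omega>" for x
    proof -
      have "norm (x - y) powr \<kappa> \<le> R powr \<kappa>"
        using R[OF x y] \<kappa> by (intro powr_mono2) (auto simp: dist_norm)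
      then have "C * (a y + norm (x - y) powr \<kappa>) \<le> C * (a y + R powr \<kappa>)" using C_pos by simp
      then show ?thesis using Z[OF x y] by linarith
    qed
    then show ?thesis using that by blast
  qed auto
  define B where "B = M powr p + \<bar>D\<bar> * M powr q"
  have "density x (g x) \<le> B * indicator \<Omega> x" for x
  proof (cases "x \<in> \<Omega>")
    case True
    have "norm (g x) powr p \<le> M powr p" "norm (g x) powr q \<le> M powr q"
      using p q assms[of x] by (auto intro!: powr_mono2)
    then have "norm (g x) powr p + a x * norm (g x) powr q \<le> M powr p + \<bar>D\<bar> * M powr q"
      using D[OF True] a_nonneg[OF True] by (intro add_mono mult_mono) auto
    then show ?thesis using True by (simp add: density_def B_def)
  qed (simp add: density_def)
  then have le: "ennreal (density x (g x)) \<le> ennreal (B * indicator \<Omega> x)" for x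
    by (rule ennreal_leI)
  have "ennreal (B * indicator \<Omega> x) = ennreal B * indicator \<Omega> x" for x
    by (cases "x \<in> \<Omega>") auto
  then have "N g \<le> (\<integral>\<^sup>+x. ennreal B * indicator \<Omega> x \<partial>lebesgue)"
    unfolding N_def using le by (intro nn_integral_mono) simp
  also have "\<dots> = ennreal B * emeasure lebesgue \<Omega>"
    using open_\<Omega> by (intro nn_integral_cmult_indicator) auto
  also have "\<dots> < \<infinity>"
    using emeasure_bounded_finite[OF bounded_\<Omega>] open_\<Omega> by (simp add: ennreal_mult_less_top)
  finally show ?thesis .
qed

text \<open>The heart of the matter: the Hoelder bound on \<open>v\<close> controls the oscillation of \<open>a\<close> on the
  scale of the mollifier, so Jensen's inequality survives the nonautonomous weight up to a constant.\<close>

lemma density_conv_le: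
  assumes vg: "global_weak_gradient v g" and g0: "\<And>x. x \<notin> \<Omega> \<Longrightarrow> g x = 0"
    and G: "integrable lebesgue (\<lambda>x. density x (g x))"
    and H: "\<And>x y. \<bar>v x - v y\<bar> \<le> H * norm (x - y) powr \<gamma>" "H \<ge> 0" "\<gamma> \<ge> 0" "\<kappa> \<ge> (q - p) * (1 - \<gamma>)"
    and A: "A > 0"
  obtains D where "D > 0" "\<And>\<delta> K K' x. 0 < \<delta> \<Longrightarrow> \<delta> \<le> 1 \<Longrightarrow> mollifier w A \<delta> K K' \<Longrightarrow>
     density x (conv K g x) \<le> D * conv K (\<lambda>y. density y (g y)) x"
proof -
  define R where "R = norm w + 1"
  have R: "R > 0" by (simp add: R_def add_nonneg_pos)
  \<comment> \<open>Chosen so that the mollified gradient is at most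
    \<open>B * \<delta> powr (\<gamma> - 1)\<close>, as shown in \<open>sB\<close>.\<close>
  define B where "B = H * R powr \<gamma> * A"
  have B: "B \<ge> 0" using H A by (simp add: B_def)
  \<comment> \<open>The three summands pay for the \<open>p\<close>-phase, for the part of
    \<open>a x\<close> below the local minimum up to the factor \<open>C\<close>, and for the
    oscillation of \<open>a\<close>.\<close>
  define D where "D = 1 + C + C * (R powr \<kappa> * B powr (q - p))"
  have D: "D > 0" using C_pos by (simp add: D_def add_pos_nonneg)
  have gi: "integrable lebesgue g" using vg by (simp add: global_weak_gradient_def)
  have "density x (conv K g x) \<le> D * conv K (\<lambda>y. density y (g y)) x"
    if \<delta>: "0 < \<delta>" "\<delta> \<le> 1" and mo: "mollifier w A \<delta> K K'" for \<delta> K K' x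
  proof (cases "x \<in> \<Omega>")
    case True
    note k = mollifierD[OF mo \<delta>(1)]
    define E where "E = conv K (\<lambda>y. density y (g y)) x"
    define h where "h = conv K (\<lambda>y. norm (g y)) x"
    define s where "s = norm (conv K g x)"
    have sh: "0 \<le> s" "s \<le> h" using norm_conv_le_conv_norm[OF mo \<delta>(1) gi] by (auto simp: s_def h_def)
    have hi: "integrable lebesgue (\<lambda>y. norm (g y))" using gi by simp
    have "1 * h powr p \<le> E" unfolding h_def E_def
    proof (rule conv_powr_le[OF mo \<delta>(1) hi _ G])
      show "1 * norm (g y) powr p \<le> density y (g y)" for y
        using g0[of y] a_nonneg[of y] by (cases "y \<in> \<Omega>") (auto simp: density_def)
    qed (use p density_nonneg in auto)
    moreover have "s powr p \<le> h powr p" using sh p by (intro powr_mono2) auto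
    ultimately have sp: "s powr p \<le> E" by simp
    \<comment> \<open>Dividing the oscillation condition by \<open>C\<close> shows that
      \<open>m\<close> is a lower bound for \<open>a\<close> on the points of \<Omega> within reach
      of the kernel; truncation at 0 makes it a legitimate weight for Jensen.\<close>
    define m where "m = max 0 (a x / C - (R * \<delta>) powr \<kappa>)"
    have ax: "a x \<le> C * (m + (R * \<delta>) powr \<kappa>)"
    proof -
      have "a x / C \<le> m + (R * \<delta>) powr \<kappa>" by (simp add: m_def)
      then show ?thesis using C_pos by (simp add: field_simps)
    qed
    have "m * h powr q \<le> E" unfolding h_def E_def
    proof (rule conv_powr_le[OF mo \<delta>(1) hi _ G])
      show "m * norm (g y) powr q \<le> density y (g y)" if nz: "K (x - y) \<noteq> 0" for y
      proof (cases "y \<in> \<Omega>")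
        case y: True
        have "norm (x - y) \<le> R * \<delta>" using k(10)[of "x - y"] nz by (fastforce simp: R_def mult.commute)
        then have "norm (x - y) powr \<kappa> \<le> (R * \<delta>) powr \<kappa>" using \<kappa> by (intro powr_mono2) auto
        then have "C * (a y + norm (x - y) powr \<kappa>) \<le> C * (a y + (R * \<delta>) powr \<kappa>)" using C_pos by simp
        then have "a x \<le> C * (a y + (R * \<delta>) powr \<kappa>)" using Z[OF True y] by linarith
        then have "a x / C - (R * \<delta>) powr \<kappa> \<le> a y" using C_pos by (simp add: field_simps)
        then have "m \<le> a y" using a_nonneg[OF y] by (simp add: m_def)
        then have "m * norm (g y) powr q \<le> a y * norm (g y) powr q" by (rule mult_right_mono) simp
        then show ?thesis using y by (simp add: density_def add_increasing)
      next
        case False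
        then show ?thesis using g0[of y] by (simp add: density_def)
      qed
    qed (use q1 density_nonneg in \<open>auto simp: m_def\<close>)
    moreover have "m * s powr q \<le> m * h powr q" using sh q1 by (intro mult_left_mono powr_mono2) (auto simp: m_def)
    ultimately have msq: "m * s powr q \<le> E" by simp
    have sB: "s \<le> B * \<delta> powr (\<gamma> - 1)"
    proof -
      have "s \<le> H * (\<delta> * R) powr \<gamma> * (A / \<delta>)"
        unfolding s_def R_def by (rule norm_conv_gradient_le[OF vg mo \<delta>(1) H(1-3)])
      also have "\<dots> = B * \<delta> powr (\<gamma> - 1)"
        using \<delta> R by (simp add: B_def powr_mult powr_diff)
      finally show ?thesis .
    qed
    have small: "(R * \<delta>) powr \<kappa> * s powr (q - p) \<le> R powr \<kappa> * B powr (q - p)"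
    proof -
      have "s powr (q - p) \<le> (B * \<delta> powr (\<gamma> - 1)) powr (q - p)" using sB sh q by (intro powr_mono2) auto
      also have "\<dots> = B powr (q - p) * \<delta> powr ((\<gamma> - 1) * (q - p))" using B \<delta> by (simp add: powr_mult powr_powr)
      finally have "(R * \<delta>) powr \<kappa> * s powr (q - p) \<le> (R powr \<kappa> * \<delta> powr \<kappa>) * (B powr (q - p) * \<delta> powr ((\<gamma> - 1) * (q - p)))"
        using R \<delta> by (simp add: powr_mult mult_left_mono)
      also have "\<dots> = R powr \<kappa> * B powr (q - p) * \<delta> powr (\<kappa> + (\<gamma> - 1) * (q - p))" by (simp add: powr_add mult_ac)
      also have "\<dots> \<le> R powr \<kappa> * B powr (q - p) * 1"
      proof (intro mult_left_mono)
        \<comment> \<open>The only place where the size of \<kappa> relative to \<open>q - p\<close>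
          matters: a nonnegative exponent keeps the power of \<open>\<delta> \<le> 1\<close>
          bounded.\<close>
        have "\<kappa> + (\<gamma> - 1) * (q - p) \<ge> 0" using H(4) by (simp add: algebra_simps)
        then show "\<delta> powr (\<kappa> + (\<gamma> - 1) * (q - p)) \<le> 1" using \<delta> powr_mono2[of _ \<delta> 1] by simp
      qed auto
      finally show ?thesis by simp
    qed
    have osc: "(R * \<delta>) powr \<kappa> * s powr q \<le> R powr \<kappa> * B powr (q - p) * E"
    proof -
      \<comment> \<open>The surplus power is absorbed by the oscillation of \<open>a\<close>, and
        the remaining \<open>p\<close>-th power is already controlled by Jensen.\<close>
      have "s powr q = s powr (q - p) * s powr p" by (simp flip: powr_add)
      then have "(R * \<delta>) powr \<kappa> * s powr q = ((R * \<delta>) powr \<kappa> * s powr (q - p)) * s powr p" by simp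
      also have "\<dots> \<le> (R powr \<kappa> * B powr (q - p)) * E"
        by (rule mult_mono[OF small sp]) auto
      finally show ?thesis .
    qed
    have "a x * s powr q \<le> C * (m + (R * \<delta>) powr \<kappa>) * s powr q" using ax by (rule mult_right_mono) simp
    also have "\<dots> = C * (m * s powr q + (R * \<delta>) powr \<kappa> * s powr q)" by (simp add: algebra_simps)
    also have "\<dots> \<le> C * (E + R powr \<kappa> * B powr (q - p) * E)" using msq osc C_pos by (intro mult_left_mono add_mono) auto
    finally have "s powr p + a x * s powr q \<le> D * E" using sp by (simp add: D_def algebra_simps)
    then show ?thesis using True by (simp add: density_def s_def E_def)
  next
    case False
    have "0 \<le> conv K (\<lambda>y. density y (g y)) x"
      unfolding conv_def using mollifierD(5)[OF mo \<delta>(1)] density_nonneg by (auto intro!: integral_nonneg_AE)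
    then show ?thesis using False D by (simp add: density_def)
  qed
  then show ?thesis using that D by blast
qed

end

section \<open>Cutoffs and localisation\<close>

lemma C1_grad_holder:
  fixes \<beta> :: "'b::euclidean_space \<Rightarrow> real"
  assumes \<beta>: "C1_grad \<beta> \<beta>'" and M: "\<And>x. \<bar>\<beta> x\<bar> \<le> M" "\<And>x. norm (\<beta>' x) \<le> M" and \<gamma>: "0 \<le> \<gamma>" "\<gamma> \<le> 1"
  shows "\<bar>\<beta> x - \<beta> y\<bar> \<le> 2 * M * norm (x - y) powr \<gamma>"
\<comment> \<open>At short range the gradient bound is used, at long range the bound on the values;
  this covers every exponent in the unit interval, including 0.\<close>
proof (cases "norm (x - y) \<le> 1")
  case True
  have M0: "M \<ge> 0" using M(1)[of undefined] by linarith
  have "norm (x - y) \<le> norm (x - y) powr \<gamma>"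
    using True \<gamma> powr_mono'[of \<gamma> 1 "norm (x - y)"] by (cases "x = y") auto
  then have "M * norm (x - y) \<le> M * norm (x - y) powr \<gamma>" using M0 by (rule mult_left_mono)
  also have "\<dots> \<le> 2 * M * norm (x - y) powr \<gamma>" using M0 by (intro mult_right_mono) auto
  finally show ?thesis using C1_grad_lipschitz[OF \<beta> M(2), of x y] by linarith
next
  case False
  have M0: "M \<ge> 0" using M(1)[of undefined] by linarith
  have "1 \<le> norm (x - y) powr \<gamma>" using False \<gamma> by (simp add: ge_one_powr_ge_zero)
  then have "2 * M * 1 \<le> 2 * M * norm (x - y) powr \<gamma>" using M0 by (intro mult_left_mono) auto
  then show ?thesis using M(1)[of x] M(1)[of y] by linarith
qed

lemma ex_cutoff:
  fixes x0 :: "'b::euclidean_space" and r :: real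
  assumes r: "r > 0"
  obtains \<beta> :: "'b \<Rightarrow> real" and \<beta>' M where "C1_grad \<beta> \<beta>'" "\<And>x. \<bar>\<beta> x\<bar> \<le> M" "\<And>x. norm (\<beta>' x) \<le> M"
    "\<And>x. x \<in> ball x0 (r / 2) \<Longrightarrow> \<beta> x = 1" "\<And>x. x \<notin> ball x0 r \<Longrightarrow> \<beta> x = 0"
proof -
  obtain T T' where T: "\<And>s. (T has_real_derivative T' s) (at s)" "continuous_on UNIV T'"
    "\<And>s. s \<ge> 1 \<Longrightarrow> T s = 1" "\<And>s. s \<le> 0 \<Longrightarrow> T s = 0" "\<And>s. \<bar>T s\<bar> \<le> 1"
    using ex_plateau by metis
  \<comment> \<open>The quadratic \<open>Q\<close> takes the value 1 at distance
    \<open>r / 2\<close> and 0 at distance \<open>r\<close>, so composing it with the plateau gives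
    the cutoff. The squared distance avoids a kink at the centre.\<close>
  define c where "c = 4 / (3 * r\<^sup>2)"
  define Q where "Q x = 4 / 3 - c * ((x - x0) \<bullet> (x - x0))" for x :: 'b
  have Q: "C1_grad Q (\<lambda>x. (- 2 * c) *\<^sub>R (x - x0))"
    unfolding C1_grad_def Q_def
    by (auto intro!: derivative_eq_intros continuous_intros simp: fun_eq_iff inner_commute algebra_simps)
  define \<beta> where "\<beta> x = T (Q x)" for x
  define \<beta>' where "\<beta>' x = T' (Q x) *\<^sub>R ((- 2 * c) *\<^sub>R (x - x0))" for x
  have C: "C1_grad \<beta> \<beta>'" unfolding \<beta>_def \<beta>'_def by (rule C1_grad_compose[OF Q T(1,2)])
  have Q2: "Q x = 4 / 3 - 4 / 3 * (dist x0 x / r)\<^sup>2" for x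
    using r by (simp add: Q_def c_def power_divide dist_norm norm_minus_commute[of x0 x] flip: power2_norm_eq_inner)
  have z: "\<beta> x = 0" if "x \<notin> ball x0 r" for x
  proof -
    have "1 \<le> dist x0 x / r" using that r by simp
    then have "1 \<le> (dist x0 x / r)\<^sup>2" by (rule one_le_power)
    then show ?thesis unfolding \<beta>_def by (intro T) (simp add: Q2)
  qed
  have o: "\<beta> x = 1" if "x \<in> ball x0 (r / 2)" for x
  proof -
    have "dist x0 x / r \<le> 1 / 2" using that r by (simp add: field_simps)
    then have "(dist x0 x / r)\<^sup>2 \<le> (1 / 2)\<^sup>2" using r by (intro power_mono) auto
    then show ?thesis unfolding \<beta>_def by (intro T) (simp add: Q2 power2_eq_square)
  qed
  have z': "\<beta>' x = 0" if "x \<notin> cball x0 r" for x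
    using C1_grad_eq_0[OF C, of "cball x0 r"] z that by force
  obtain M where M: "\<And>x. norm (\<beta>' x) \<le> M"
    using bounded_continuous_support[OF C1_grad_continuous'[OF C] z' bounded_cball] by blast
  show ?thesis
    by (rule that[OF C, of "max 1 M"]) (use T(5) M z o in \<open>auto simp: \<beta>_def le_max_iff_disj\<close>)
qed

context double_phase
begin

text \<open>Closeness of gradients in the modular of the difference. This notion is stable under
  sums, so it can be proved piece by piece, and \<open>u\<^sub>0\<close> does not occur in
  it.\<close>

definition approximable :: "('a \<Rightarrow> 'a) \<Rightarrow> bool" where
  "approximable g \<longleftrightarrow> (\<forall>\<epsilon>>0. \<exists>\<psi>\<in>test_functions \<Omega>. N (\<lambda>x. grad \<psi> x - g x) \<le> ennreal \<epsilon>)"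

text \<open>The class is designed to be closed under multiplication by cutoffs, hence the separate
  bound on \<open>v\<close>. For \<open>\<gamma> = 0\<close> the last condition says no more than
  boundedness: \<open>norm (x - y) powr 0\<close> is 1 for distinct points, and at
  \<open>x = y\<close> both sides are 0.\<close>

definition admissible :: "real \<Rightarrow> ('a \<Rightarrow> real) \<Rightarrow> ('a \<Rightarrow> 'a) \<Rightarrow> bool" where
  "admissible \<gamma> v g \<longleftrightarrow> global_weak_gradient v g \<and> (\<forall>x. x \<notin> \<Omega> \<longrightarrow> v x = 0 \<and> g x = 0) \<and> N g < \<infinity> \<and>
     (\<exists>B. \<forall>x. \<bar>v x\<bar> \<le> B) \<and> (\<exists>H\<ge>0. \<forall>x y. \<bar>v x - v y\<bar> \<le> H * norm (x - y) powr \<gamma>)"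

lemma density_minus [simp]: "density x (- \<xi>) = density x \<xi>"
  by (simp add: density_def)

lemma integrable_density:
  assumes [measurable]: "g \<in> borel_measurable lebesgue" and "N g < \<infinity>"
  shows "integrable lebesgue (\<lambda>x. density x (g x))"
  using assms(2) density_nonneg unfolding N_def by (intro integrableI_nonneg) auto

lemma density_tendsto_0:
  assumes "(\<lambda>n. f n) \<longlonglongrightarrow> 0" shows "(\<lambda>n. density x (f n)) \<longlonglongrightarrow> 0"
proof -
  have n: "(\<lambda>n. norm (f n)) \<longlonglongrightarrow> 0" using assms by (rule tendsto_norm_zero)
  have z: "(\<lambda>n. norm (f n) powr r) \<longlonglongrightarrow> 0" if "r > 0" for r
    by (rule tendsto_zero_powrI[OF n tendsto_const]) (use that in auto)
  have "(\<lambda>n. density x (f n)) \<longlonglongrightarrow> indicator \<Omega> x * (0 + a x * 0)"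
    unfolding density_def using p q by (intro tendsto_intros z) auto
  then show ?thesis by simp
qed

text \<open>Generalised dominated convergence. The energy density of the mollified gradient has a
  majorant that varies with the kernel, namely \<open>D\<close> times the mollified energy density,
  but these majorants converge in L1. Pointwise convergence along a subsequence then
  suffices.\<close>

lemma N_conv_small:
  assumes adm: "admissible \<gamma> v g" and \<gamma>: "\<gamma> \<ge> 0" "\<kappa> \<ge> (q - p) * (1 - \<gamma>)"
    and A: "A > 0" "\<And>\<delta>. \<delta> > 0 \<Longrightarrow> \<exists>K K'. mollifier w A \<delta> K K'" and d: "d > 0" and \<epsilon>: "\<epsilon> > 0"
  obtains \<delta> K K' where "0 < \<delta>" "\<delta> < d" "mollifier w A \<delta> K K'" "N (\<lambda>x. conv K g x - g x) \<le> ennreal \<epsilon>"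
proof -
  define G where "G x = density x (g x)" for x
  have vg: "global_weak_gradient v g" and g0: "\<And>x. x \<notin> \<Omega> \<Longrightarrow> g x = 0"
    using adm by (auto simp: admissible_def)
  have g: "integrable lebesgue g" using vg by (simp add: global_weak_gradient_def)
  have [measurable]: "g \<in> borel_measurable lebesgue" using g by simp
  have G: "integrable lebesgue G" using adm unfolding G_def by (intro integrable_density) (auto simp: admissible_def)
  have [measurable]: "G \<in> borel_measurable lebesgue" using G by simp
  have Gn: "G x \<ge> 0" for x by (simp add: G_def density_nonneg)
  obtain H where H: "H \<ge> 0" "\<And>x y. \<bar>v x - v y\<bar> \<le> H * norm (x - y) powr \<gamma>" using adm by (auto simp: admissible_def)
  obtain D where D: "D > 0" "\<And>\<delta> K K' x. 0 < \<delta> \<Longrightarrow> \<delta> \<le> 1 \<Longrightarrow> mollifier w A \<delta> K K' \<Longrightarrow>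
     density x (conv K g x) \<le> D * conv K G x"
    using density_conv_le[OF vg g0 G[unfolded G_def] H(2,1) \<gamma> A(1), of w] unfolding G_def by blast
  \<comment> \<open>One kernel has to be good for the gradient and for its energy density
    simultaneously, with an explicit rate along the sequence.\<close>
  define P where "P n \<delta> K K' \<longleftrightarrow> 0 < \<delta> \<and> \<delta> < min d 1 \<and> mollifier w A \<delta> K K' \<and>
      (\<integral>\<^sup>+x. norm (conv K g x - g x) \<partial>lebesgue) \<le> ennreal (inverse (Suc n)) \<and>
      (\<integral>\<^sup>+x. norm (conv K G x - G x) \<partial>lebesgue) \<le> ennreal (inverse (Suc n))" for n :: nat and \<delta> K K'
  have "\<exists>\<delta> K K'. P n \<delta> K K'" for n
  proof -
    have e: "inverse (real (Suc n)) > 0" by simp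
    obtain d1 where d1: "d1 > 0" "\<And>\<delta> K K'. 0 < \<delta> \<Longrightarrow> \<delta> < d1 \<Longrightarrow> mollifier w A \<delta> K K' \<Longrightarrow> (\<integral>\<^sup>+x. norm (conv K g x - g x) \<partial>lebesgue) \<le> ennreal (inverse (Suc n))"
      using conv_tendsto_L1[OF g e, of w A] by blast
    obtain d2 where d2: "d2 > 0" "\<And>\<delta> K K'. 0 < \<delta> \<Longrightarrow> \<delta> < d2 \<Longrightarrow> mollifier w A \<delta> K K' \<Longrightarrow> (\<integral>\<^sup>+x. norm (conv K G x - G x) \<partial>lebesgue) \<le> ennreal (inverse (Suc n))"
      using conv_tendsto_L1[OF G e, of w A] by blast
    define \<delta> where "\<delta> = min (min d 1) (min d1 d2) / 2"
    have "0 < \<delta>" "\<delta> < min d 1" "\<delta> < d1" "\<delta> < d2" using d d1 d2 by (auto simp: \<delta>_def)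
    then show ?thesis using A(2)[OF \<open>0 < \<delta>\<close>] d1(2) d2(2) unfolding P_def by blast
  qed
  then obtain \<delta> K K' where "\<And>n. P n (\<delta> n) (K n) (K' n)" by metis
  then have \<delta>: "\<And>n. 0 < \<delta> n" "\<And>n. \<delta> n < min d 1" and mo: "\<And>n. mollifier w A (\<delta> n) (K n) (K' n)"
    and cg: "\<And>n. (\<integral>\<^sup>+x. norm (conv (K n) g x - g x) \<partial>lebesgue) \<le> ennreal (inverse (Suc n))"
    and cG: "\<And>n. (\<integral>\<^sup>+x. norm (conv (K n) G x - G x) \<partial>lebesgue) \<le> ennreal (inverse (Suc n))"
    unfolding P_def by blast+
  have [measurable]: "conv (K n) g \<in> borel_measurable lebesgue" "conv (K n) G \<in> borel_measurable lebesgue" for n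
    by (intro continuous_imp_lebesgue_measurable mollifier_conv_continuous[OF mo \<delta>(1)] g G)+
  have gi: "integrable lebesgue (\<lambda>x. conv (K n) g x - g x)" for n
    by (rule integrableI_bounded) (use cg[of n] in \<open>auto intro: le_less_trans\<close>)
  have "(\<lambda>n. \<integral>x. norm (conv (K n) g x - g x) \<partial>lebesgue) \<longlonglongrightarrow> 0"
  proof (rule tendsto_sandwich[OF _ _ tendsto_const LIMSEQ_inverse_real_of_nat])
    have "(\<integral>x. norm (conv (K n) g x - g x) \<partial>lebesgue) \<le> inverse (Suc n)" for n
    proof -
      have "ennreal (\<integral>x. norm (conv (K n) g x - g x) \<partial>lebesgue) \<le> ennreal (inverse (Suc n))"
        using cg[of n] gi[of n] by (subst nn_integral_eq_integral[symmetric]) auto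
      then show ?thesis by simp
    qed
    then show "\<forall>\<^sub>F n in sequentially. (\<integral>x. norm (conv (K n) g x - g x) \<partial>lebesgue) \<le> inverse (real (Suc n))"
      by simp
  qed auto
  then obtain r :: "nat \<Rightarrow> nat" where r: "strict_mono r" and ae: "AE x in lebesgue. (\<lambda>n. conv (K (r n)) g x - g x) \<longlonglongrightarrow> 0"
    using tendsto_L1_AE_subseq[of lebesgue "\<lambda>n x. conv (K n) g x - g x", OF gi] by blast
  \<comment> \<open>The factor of the weighted inequality for \<open>l = 1/2\<close>, that is 2 to
    the power \<open>q - 1\<close>.\<close>
  define c where "c = (1/2) powr (1 - q)"
  have c: "c > 0" by (simp add: c_def)
  define f where "f n x = density x (conv (K (r n)) g x - g x)" for n x
  define X where "X x = c * (D + 1) * G x" for x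
  have Xn: "X x \<ge> 0" for x using c D(1) Gn by (simp add: X_def)
  have fn: "f n x \<ge> 0" for n x by (simp add: f_def density_nonneg)
  \<comment> \<open>\<open>X\<close> is the limit of the majorants. Capping \<open>f n\<close> at
    \<open>X\<close> allows ordinary dominated convergence, and whatever exceeds the cap is at most
    the L1-small distance between the mollified and the original energy density.\<close>
  have fX: "f n x \<le> min (f n x) (X x) + c * D * norm (conv (K (r n)) G x - G x)" for n x
  proof -
    have "f n x \<le> c * density x (conv (K (r n)) g x) + c * density x (- g x)"
      using density_add_le[of "1/2" x "conv (K (r n)) g x" "- g x"] unfolding f_def c_def by simp
    also have "\<dots> \<le> c * (D * conv (K (r n)) G x) + c * G x"
      using D(2)[OF \<delta>(1) _ mo, of "r n" x] \<delta>(2)[of "r n"] c by (simp add: G_def)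
    also have "\<dots> = X x + c * D * (conv (K (r n)) G x - G x)" by (simp add: X_def algebra_simps)
    also have "\<dots> \<le> X x + c * D * norm (conv (K (r n)) G x - G x)"
      using c D(1) by (intro add_left_mono mult_left_mono) auto
    finally show ?thesis using c D(1) by (auto simp: min_def)
  qed
  have lim1: "(\<lambda>n. \<integral>\<^sup>+x. ennreal (min (f n x) (X x)) \<partial>lebesgue) \<longlonglongrightarrow> (\<integral>\<^sup>+x. 0 \<partial>(lebesgue :: 'a measure))"
  proof (rule nn_integral_dominated_convergence[where w="\<lambda>x. ennreal (X x)"])
    show "(\<lambda>x. ennreal (min (f n x) (X x))) \<in> borel_measurable lebesgue" for n
      unfolding f_def X_def by measurable
    show "(\<lambda>x. ennreal (X x)) \<in> borel_measurable lebesgue" unfolding X_def by measurable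
    have "integrable lebesgue X" unfolding X_def using G by simp
    then show "(\<integral>\<^sup>+x. ennreal (X x) \<partial>lebesgue) < \<infinity>"
      using Xn by (subst nn_integral_eq_integral) auto
    show "AE x in lebesgue. (\<lambda>n. ennreal (min (f n x) (X x))) \<longlonglongrightarrow> 0"
      using ae
    proof eventually_elim
      fix x assume "(\<lambda>n. conv (K (r n)) g x - g x) \<longlonglongrightarrow> 0"
      then have "(\<lambda>n. f n x) \<longlonglongrightarrow> 0" unfolding f_def by (rule density_tendsto_0)
      then have "(\<lambda>n. min (f n x) (X x)) \<longlonglongrightarrow> 0"
        using tendsto_min[OF _ tendsto_const[of "X x"]] Xn[of x] by fastforce
      then show "(\<lambda>n. ennreal (min (f n x) (X x))) \<longlonglongrightarrow> 0"
        using tendsto_ennrealI by fastforce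
    qed
  qed (auto intro!: ennreal_leI)
  have lim2: "(\<lambda>n. ennreal (c * D) * ennreal (inverse (Suc (r n)))) \<longlonglongrightarrow> 0"
  proof -
    have "(\<lambda>n. inverse (real (Suc (r n)))) \<longlonglongrightarrow> 0"
      using LIMSEQ_subseq_LIMSEQ[OF LIMSEQ_inverse_real_of_nat r] by (simp add: o_def)
    then have "(\<lambda>n. ennreal (c * D * inverse (Suc (r n)))) \<longlonglongrightarrow> ennreal (c * D * 0)"
      by (intro tendsto_ennrealI tendsto_intros)
    then show ?thesis using c D(1) by (simp add: ennreal_mult)
  qed
  have fle: "(\<integral>\<^sup>+x. ennreal (f n x) \<partial>lebesgue)
      \<le> (\<integral>\<^sup>+x. ennreal (min (f n x) (X x)) \<partial>lebesgue) + ennreal (c * D) * ennreal (inverse (Suc (r n)))" for n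
  proof -
    have "(\<integral>\<^sup>+x. ennreal (f n x) \<partial>lebesgue)
        \<le> (\<integral>\<^sup>+x. ennreal (min (f n x) (X x)) + ennreal (c * D) * ennreal (norm (conv (K (r n)) G x - G x)) \<partial>lebesgue)"
      using fX fn Xn c D(1) by (intro nn_integral_mono) (simp flip: ennreal_mult ennreal_plus)
    also have "\<dots> = (\<integral>\<^sup>+x. ennreal (min (f n x) (X x)) \<partial>lebesgue) + ennreal (c * D) * (\<integral>\<^sup>+x. ennreal (norm (conv (K (r n)) G x - G x)) \<partial>lebesgue)"
      unfolding f_def X_def by (subst nn_integral_add) (auto simp: nn_integral_cmult)
    also have "\<dots> \<le> (\<integral>\<^sup>+x. ennreal (min (f n x) (X x)) \<partial>lebesgue) + ennreal (c * D) * ennreal (inverse (Suc (r n)))"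
      by (intro add_left_mono mult_left_mono cG) auto
    finally show ?thesis .
  qed
  have flim: "(\<lambda>n. (\<integral>\<^sup>+x. ennreal (min (f n x) (X x)) \<partial>lebesgue) + ennreal (c * D) * ennreal (inverse (Suc (r n)))) \<longlonglongrightarrow> 0"
    using tendsto_add[OF lim1 lim2] by simp
  have "(\<lambda>n. \<integral>\<^sup>+x. ennreal (f n x) \<partial>lebesgue) \<longlonglongrightarrow> 0"
    by (rule tendsto_sandwich[OF _ _ tendsto_const flim]) (simp_all only: fle zero_le eventually_True)
  then have "\<forall>\<^sub>F n in sequentially. (\<integral>\<^sup>+x. ennreal (f n x) \<partial>lebesgue) < ennreal \<epsilon>"
    using \<epsilon> by (intro order_tendstoD) auto
  then obtain n where "(\<integral>\<^sup>+x. ennreal (f n x) \<partial>lebesgue) < ennreal \<epsilon>"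
    using eventually_happens'[OF sequentially_bot] by blast
  then have "N (\<lambda>x. conv (K (r n)) g x - g x) \<le> ennreal \<epsilon>" by (simp add: N_def f_def)
  then show ?thesis using that[OF \<delta>(1) _ mo, of "r n"] \<delta>(2)[of "r n"] by simp
qed

text \<open>The mollification of \<open>v\<close> is itself the approximating test function: because
  the shift points inwards throughout the ball, its support is a compact subset of \<Omega>, and its
  gradient is the mollified \<open>g\<close>.\<close>

lemma approximable_local:
  assumes adm: "admissible \<gamma> v g" and \<gamma>: "\<gamma> \<ge> 0" "\<kappa> \<ge> (q - p) * (1 - \<gamma>)"
    and sh: "inward_shift \<Omega> x0 r w" and v0: "\<And>x. x \<notin> ball x0 r \<Longrightarrow> v x = 0"
  shows "approximable g"
  unfolding approximable_def
proof (intro allI impI)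
  fix \<epsilon> :: real assume \<epsilon>: "\<epsilon> > 0"
  obtain d where d: "d > 0" "\<And>\<delta>. 0 < \<delta> \<Longrightarrow> \<delta> < d \<Longrightarrow>
     closure {x. \<exists>y\<in>\<Omega> \<inter> ball x0 r. x - y \<in> cball (\<delta> *\<^sub>R w) \<delta>} \<subseteq> \<Omega>"
    using sh unfolding inward_shift_def by blast
  obtain A where A: "A > 0" "\<And>\<delta>. \<delta> > 0 \<Longrightarrow> \<exists>K K'. mollifier w A \<delta> K K'" using ex_mollifier[of w] by blast
  obtain \<delta> K K' where \<delta>: "0 < \<delta>" "\<delta> < d" and mo: "mollifier w A \<delta> K K'" and small: "N (\<lambda>x. conv K g x - g x) \<le> ennreal \<epsilon>"
    using N_conv_small[OF adm \<gamma> A d(1) \<epsilon>] by blast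
  note k = mollifierD[OF mo \<delta>(1)]
  have vg: "global_weak_gradient v g" and v\<Omega>: "\<And>x. x \<notin> \<Omega> \<Longrightarrow> v x = 0" using adm by (auto simp: admissible_def)
  have vi: "integrable lebesgue v" using vg by (simp add: global_weak_gradient_def)
  define S where "S = {x. \<exists>y\<in>\<Omega> \<inter> ball x0 r. x - y \<in> cball (\<delta> *\<^sub>R w) \<delta>}"
  have "conv K v \<in> test_functions \<Omega>"
  proof (rule test_functionsI)
    show "smooth (conv K v)"
      using conv_smooth[OF k(1) k(8) bounded_cball closed_cball vi] by blast
    show "closure S \<subseteq> \<Omega>" unfolding S_def by (rule d(2)[OF \<delta>])
    then have "bounded (closure S)" using bounded_\<Omega> bounded_subset by blast
    then show "compact (closure S)" by (simp add: compact_eq_bounded_closed)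
    show "conv K v x = 0" if "x \<notin> closure S" for x
    proof -
      have "x \<notin> S" using that closure_subset by blast
      have "K (x - y) *\<^sub>R v y = 0" for y
      proof (cases "v y = 0")
        case False
        then have "y \<in> \<Omega> \<inter> ball x0 r" using v0 v\<Omega> by blast
        then have "x - y \<notin> cball (\<delta> *\<^sub>R w) \<delta>" using \<open>x \<notin> S\<close> unfolding S_def by blast
        then show ?thesis using k(8) by simp
      qed simp
      then have "(\<lambda>y. K (x - y) *\<^sub>R v y) = (\<lambda>y. 0)" by blast
      then show ?thesis by (simp only: conv_def) simp
    qed
  qed
  moreover have "grad (conv K v) = conv K g"
    by (rule C1_grad_unique[OF conv_global_weak_gradient(1)[OF vg mo \<delta>(1)]])
  ultimately show "\<exists>\<psi>\<in>test_functions \<Omega>. N (\<lambda>x. grad \<psi> x - g x) \<le> ennreal \<epsilon>"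
    using small by (intro bexI[of _ "conv K v"]) simp_all
qed

lemma test_functions_add:
  assumes "\<psi> \<in> test_functions \<Omega>" "\<eta> \<in> test_functions \<Omega>"
  shows "(\<lambda>x. \<psi> x + \<eta> x) \<in> test_functions \<Omega>" "grad (\<lambda>x. \<psi> x + \<eta> x) = (\<lambda>x. grad \<psi> x + grad \<eta> x)"
proof -
  obtain S where S: "compact S" "S \<subseteq> \<Omega>" "\<And>x. x \<notin> S \<Longrightarrow> \<psi> x = 0" and C1: "C1_grad \<psi> (grad \<psi>)"
    using test_functionE[OF assms(1)] by metis
  obtain S' where S': "compact S'" "S' \<subseteq> \<Omega>" "\<And>x. x \<notin> S' \<Longrightarrow> \<eta> x = 0" and C2: "C1_grad \<eta> (grad \<eta>)"
    using test_functionE[OF assms(2)] by metis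
  have "smooth (\<lambda>x. \<psi> x + \<eta> x)" using assms by (auto simp: test_functions_def smooth_def intro: Ck_add)
  then show "(\<lambda>x. \<psi> x + \<eta> x) \<in> test_functions \<Omega>"
    by (rule test_functionsI[where S="S \<union> S'"]) (use S S' in auto)
  show "grad (\<lambda>x. \<psi> x + \<eta> x) = (\<lambda>x. grad \<psi> x + grad \<eta> x)"
    by (rule C1_grad_unique[OF C1_grad_add[OF C1 C2]])
qed

text \<open>Closedness under convergence in the modular, by the splitting with
  \<open>l = 1/2\<close>; it serves to remove the truncation of unbounded functions.\<close>

lemma approximable_perturb:
  assumes [measurable]: "g \<in> borel_measurable lebesgue"
    and *: "\<And>\<epsilon>. \<epsilon> > 0 \<Longrightarrow> \<exists>g'. approximable g' \<and> g' \<in> borel_measurable lebesgue \<and> N (\<lambda>x. g' x - g x) \<le> ennreal \<epsilon>"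
  shows "approximable g"
  unfolding approximable_def
proof (intro allI impI)
  fix \<epsilon> :: real assume \<epsilon>: "\<epsilon> > 0"
  define c where "c = (1/2) powr (1 - q)"
  have c: "c > 0" by (simp add: c_def)
  have e: "\<epsilon> / (2 * c) > 0" using \<epsilon> c by simp
  obtain g' where g': "approximable g'" and [measurable]: "g' \<in> borel_measurable lebesgue"
    and s1: "N (\<lambda>x. g' x - g x) \<le> ennreal (\<epsilon> / (2 * c))" using *[OF e] by blast
  obtain \<psi> where \<psi>: "\<psi> \<in> test_functions \<Omega>" and s2: "N (\<lambda>x. grad \<psi> x - g' x) \<le> ennreal (\<epsilon> / (2 * c))"
    using g' e unfolding approximable_def by blast
  have [measurable]: "grad \<psi> \<in> borel_measurable lebesgue" using test_functions_W11(3)[OF \<psi>] by simp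
  have "N (\<lambda>x. grad \<psi> x - g x) = N (\<lambda>x. (grad \<psi> x - g' x) + (g' x - g x))" by simp
  also have "\<dots> \<le> ennreal c * N (\<lambda>x. grad \<psi> x - g' x) + ennreal c * N (\<lambda>x. g' x - g x)"
    using N_add_le[of "\<lambda>x. grad \<psi> x - g' x" "\<lambda>x. g' x - g x" "1/2"] by (simp add: c_def)
  also have "\<dots> \<le> ennreal c * ennreal (\<epsilon> / (2 * c)) + ennreal c * ennreal (\<epsilon> / (2 * c))"
    by (intro add_mono mult_left_mono s1 s2) auto
  also have "\<dots> = ennreal \<epsilon>" using c \<epsilon> by (simp flip: ennreal_mult ennreal_plus)
  finally show "\<exists>\<psi>\<in>test_functions \<Omega>. N (\<lambda>x. grad \<psi> x - g x) \<le> ennreal \<epsilon>" using \<psi> by blast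
qed

lemma approximable_add:
  assumes [measurable]: "g \<in> borel_measurable lebesgue" "h \<in> borel_measurable lebesgue"
    and "approximable g" "approximable h"
  shows "approximable (\<lambda>x. g x + h x)"
  unfolding approximable_def
proof (intro allI impI)
  fix \<epsilon> :: real assume \<epsilon>: "\<epsilon> > 0"
  define c where "c = (1/2) powr (1 - q)"
  have c: "c > 0" by (simp add: c_def)
  have e: "\<epsilon> / (2 * c) > 0" using \<epsilon> c by simp
  obtain \<psi> where \<psi>: "\<psi> \<in> test_functions \<Omega>" and s1: "N (\<lambda>x. grad \<psi> x - g x) \<le> ennreal (\<epsilon> / (2 * c))"
    using assms(3) e unfolding approximable_def by blast
  obtain \<eta> where \<eta>: "\<eta> \<in> test_functions \<Omega>" and s2: "N (\<lambda>x. grad \<eta> x - h x) \<le> ennreal (\<epsilon> / (2 * c))"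
    using assms(4) e unfolding approximable_def by blast
  have [measurable]: "grad \<psi> \<in> borel_measurable lebesgue" "grad \<eta> \<in> borel_measurable lebesgue"
    using test_functions_W11(3)[OF \<psi>] test_functions_W11(3)[OF \<eta>] by auto
  have "N (\<lambda>x. grad (\<lambda>x. \<psi> x + \<eta> x) x - (g x + h x)) = N (\<lambda>x. (grad \<psi> x - g x) + (grad \<eta> x - h x))"
    unfolding test_functions_add(2)[OF \<psi> \<eta>] by (intro N_cong) simp
  also have "\<dots> \<le> ennreal c * N (\<lambda>x. grad \<psi> x - g x) + ennreal c * N (\<lambda>x. grad \<eta> x - h x)"
    using N_add_le[of "\<lambda>x. grad \<psi> x - g x" "\<lambda>x. grad \<eta> x - h x" "1/2"] by (simp add: c_def)
  also have "\<dots> \<le> ennreal c * ennreal (\<epsilon> / (2 * c)) + ennreal c * ennreal (\<epsilon> / (2 * c))"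
    by (intro add_mono mult_left_mono s1 s2) auto
  also have "\<dots> = ennreal \<epsilon>" using c \<epsilon> by (simp flip: ennreal_mult ennreal_plus)
  finally show "\<exists>\<psi>\<in>test_functions \<Omega>. N (\<lambda>x. grad \<psi> x - (g x + h x)) \<le> ennreal \<epsilon>"
    using test_functions_add(1)[OF \<psi> \<eta>] by blast
qed

text \<open>The cut-off gradient stays in the energy class, and the term with the derivative of
  \<beta> is bounded because \<open>v\<close> is. The modulus of continuity survives by writing the
  increment of the product as
  \<open>\<beta> x * (v x - v y) + (\<beta> x - \<beta> y) * v y\<close>.\<close>

lemma admissible_mult:
  assumes adm: "admissible \<gamma> v g" and \<gamma>: "0 \<le> \<gamma>" "\<gamma> \<le> 1"
    and \<beta>: "C1_grad \<beta> \<beta>'" and M: "\<And>x. \<bar>\<beta> x\<bar> \<le> M" "\<And>x. norm (\<beta>' x) \<le> M"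
  shows "admissible \<gamma> (\<lambda>x. \<beta> x * v x) (\<lambda>x. \<beta> x *\<^sub>R g x + v x *\<^sub>R \<beta>' x)"
proof -
  have vg: "global_weak_gradient v g" and 0: "\<And>x. x \<notin> \<Omega> \<Longrightarrow> v x = 0 \<and> g x = 0" and Ng: "N g < \<infinity>"
    using adm by (auto simp: admissible_def)
  obtain B where B: "\<And>x. \<bar>v x\<bar> \<le> B" using adm by (auto simp: admissible_def)
  obtain H where H: "H \<ge> 0" "\<And>x y. \<bar>v x - v y\<bar> \<le> H * norm (x - y) powr \<gamma>" using adm by (auto simp: admissible_def)
  have M0: "M \<ge> 0" using M(1)[of undefined] by linarith
  have B0: "B \<ge> 0" using B[of undefined] by linarith
  have [measurable]: "g \<in> borel_measurable lebesgue" "v \<in> borel_measurable lebesgue"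
    using vg by (auto simp: global_weak_gradient_def)
  have [measurable]: "\<beta> \<in> borel_measurable lebesgue" "\<beta>' \<in> borel_measurable lebesgue"
    by (intro continuous_imp_lebesgue_measurable C1_grad_continuous[OF \<beta>] C1_grad_continuous'[OF \<beta>])+
  have "N (\<lambda>x. \<beta> x *\<^sub>R g x + v x *\<^sub>R \<beta>' x) < \<infinity>"
  proof -
    have "N (\<lambda>x. \<beta> x *\<^sub>R g x) \<le> ennreal (max 1 M powr q) * N g" by (rule N_scale_le) (use M in auto)
    then have 1: "N (\<lambda>x. \<beta> x *\<^sub>R g x) < \<infinity>" using Ng by (auto simp: ennreal_mult_less_top intro: le_less_trans)
    have 2: "N (\<lambda>x. v x *\<^sub>R \<beta>' x) < \<infinity>"
      by (rule N_bounded_finite[of _ "B * M"]) (use M B B0 in \<open>auto intro!: mult_mono\<close>)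
    have "N (\<lambda>x. \<beta> x *\<^sub>R g x + v x *\<^sub>R \<beta>' x) \<le> ennreal ((1 - 1/2) powr (1 - q)) * N (\<lambda>x. \<beta> x *\<^sub>R g x) + ennreal ((1/2) powr (1 - q)) * N (\<lambda>x. v x *\<^sub>R \<beta>' x)"
      by (rule N_add_le) auto
    also have "\<dots> < \<infinity>" using 1 2 by (simp add: ennreal_mult_less_top)
    finally show ?thesis .
  qed
  moreover have "\<bar>\<beta> x * v x\<bar> \<le> M * B" for x
    unfolding abs_mult using M B M0 by (intro mult_mono) auto
  moreover have "\<bar>\<beta> x * v x - \<beta> y * v y\<bar> \<le> (M * H + 2 * M * B) * norm (x - y) powr \<gamma>" for x y
  proof -
    have "\<bar>\<beta> x - \<beta> y\<bar> \<le> 2 * M * norm (x - y) powr \<gamma>" by (rule C1_grad_holder[OF \<beta> M \<gamma>])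
    then have "\<bar>\<beta> x - \<beta> y\<bar> * \<bar>v y\<bar> \<le> (2 * M * norm (x - y) powr \<gamma>) * B"
      using B M0 by (intro mult_mono) auto
    moreover have "\<bar>\<beta> x\<bar> * \<bar>v x - v y\<bar> \<le> M * (H * norm (x - y) powr \<gamma>)"
      using M H M0 by (intro mult_mono) auto
    moreover have "\<bar>\<beta> x * v x - \<beta> y * v y\<bar> \<le> \<bar>\<beta> x\<bar> * \<bar>v x - v y\<bar> + \<bar>\<beta> x - \<beta> y\<bar> * \<bar>v y\<bar>"
    proof -
      have "\<beta> x * v x - \<beta> y * v y = \<beta> x * (v x - v y) + (\<beta> x - \<beta> y) * v y" by (simp add: algebra_simps)
      then show ?thesis by (metis abs_mult abs_triangle_ineq)
    qed
    ultimately show ?thesis by (simp add: algebra_simps)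
  qed
  moreover have "M * H + 2 * M * B \<ge> 0" using M0 B0 H by simp
  moreover note global_weak_gradient_mult[OF vg \<beta> M]
  ultimately show ?thesis using 0 unfolding admissible_def by auto
qed

text \<open>An inductive partition of unity: with a cutoff \<beta> for one ball,
  \<open>\<beta> x * v x\<close> is handled locally, while \<open>(1 - \<beta> x) * v x\<close>
  vanishes on its half ball and is therefore covered by the remaining half balls. The two gradients
  add up to \<open>g\<close> since the derivatives of the cutoffs cancel.\<close>

lemma approximable_finite_cover:
  assumes \<gamma>: "0 \<le> \<gamma>" "\<gamma> \<le> 1" "\<kappa> \<ge> (q - p) * (1 - \<gamma>)" and sh0: "inward_shift \<Omega> x1 r1 w1" and "finite F"
    and "\<And>x r. (x, r) \<in> F \<Longrightarrow> r > 0 \<and> (\<exists>w. inward_shift \<Omega> x r w)"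
    and "admissible \<gamma> v g" and "\<And>x. v x \<noteq> 0 \<Longrightarrow> \<exists>(y, r)\<in>F. x \<in> ball y (r / 2)"
  shows "approximable g"
  using assms(5-)
proof (induction F arbitrary: v g rule: finite_induct)
  case empty
  \<comment> \<open>With no balls left \<open>v\<close> vanishes everywhere, so the local result
    applies on any ball; \<open>sh0\<close> supplies one.\<close>
  show ?case by (rule approximable_local[OF empty(2) \<gamma>(1,3) sh0]) (use empty in auto)
next
  case (insert xr F)
  obtain x0 r where xr: "xr = (x0, r)" by fastforce
  obtain w where w: "inward_shift \<Omega> x0 r w" and r: "r > 0" using insert.prems(1) xr by blast
  obtain \<beta> :: "'a \<Rightarrow> real" and \<beta>' M where \<beta>: "C1_grad \<beta> \<beta>'" "\<And>x. \<bar>\<beta> x\<bar> \<le> M" "\<And>x. norm (\<beta>' x) \<le> M"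
    and o: "\<And>x. x \<in> ball x0 (r / 2) \<Longrightarrow> \<beta> x = 1" and z: "\<And>x. x \<notin> ball x0 r \<Longrightarrow> \<beta> x = 0"
    using ex_cutoff[OF r, of x0] by blast
  have adm1: "admissible \<gamma> (\<lambda>x. \<beta> x * v x) (\<lambda>x. \<beta> x *\<^sub>R g x + v x *\<^sub>R \<beta>' x)"
    by (rule admissible_mult[OF insert.prems(2) \<gamma>(1,2) \<beta>])
  have \<beta>2: "C1_grad (\<lambda>x. 1 - \<beta> x) (\<lambda>x. - \<beta>' x)" using C1_grad_diff[OF C1_grad_const[of 1] \<beta>(1)] by simp
  have adm2: "admissible \<gamma> (\<lambda>x. (1 - \<beta> x) * v x) (\<lambda>x. (1 - \<beta> x) *\<^sub>R g x + v x *\<^sub>R (- \<beta>' x))"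
  proof (rule admissible_mult[OF insert.prems(2) \<gamma>(1,2) \<beta>2, where M="1 + M"])
    show "\<bar>1 - \<beta> x\<bar> \<le> 1 + M" for x using \<beta>(2)[of x] by linarith
    show "norm (- \<beta>' x) \<le> 1 + M" for x using \<beta>(3)[of x] by simp
  qed
  have a1: "approximable (\<lambda>x. \<beta> x *\<^sub>R g x + v x *\<^sub>R \<beta>' x)"
    by (rule approximable_local[OF adm1 \<gamma>(1,3) w]) (simp add: z)
  have a2: "approximable (\<lambda>x. (1 - \<beta> x) *\<^sub>R g x + v x *\<^sub>R (- \<beta>' x))"
  proof (rule insert.IH[OF _ adm2])
    show "\<And>x r. (x, r) \<in> F \<Longrightarrow> r > 0 \<and> (\<exists>w. inward_shift \<Omega> x r w)" using insert.prems(1) by blast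
    fix x assume nz: "(1 - \<beta> x) * v x \<noteq> 0"
    then have "v x \<noteq> 0" "x \<notin> ball x0 (r / 2)" using o[of x] by auto
    then show "\<exists>(y, r)\<in>F. x \<in> ball y (r / 2)" using insert.prems(3)[of x] xr by auto
  qed
  have m: "(\<lambda>x. \<beta> x *\<^sub>R g x + v x *\<^sub>R \<beta>' x) \<in> borel_measurable lebesgue"
      "(\<lambda>x. (1 - \<beta> x) *\<^sub>R g x + v x *\<^sub>R (- \<beta>' x)) \<in> borel_measurable lebesgue"
    using adm1 adm2 by (auto simp: admissible_def global_weak_gradient_def dest: borel_measurable_integrable)
  have "approximable (\<lambda>x. (\<beta> x *\<^sub>R g x + v x *\<^sub>R \<beta>' x) + ((1 - \<beta> x) *\<^sub>R g x + v x *\<^sub>R (- \<beta>' x)))"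
    by (rule approximable_add[OF m a1 a2])
  moreover have "(\<beta> x *\<^sub>R g x + v x *\<^sub>R \<beta>' x) + ((1 - \<beta> x) *\<^sub>R g x + v x *\<^sub>R (- \<beta>' x)) = g x" for x
    by (simp add: algebra_simps)
  ultimately show ?case by simp
qed

end

section \<open>Inward shifts and the boundary\<close>

lemma norm_orthogonal_component_le:
  fixes e u :: "'a::euclidean_space"
  assumes "norm e = 1" shows "norm (u - (u \<bullet> e) *\<^sub>R e) \<le> norm u"
proof -
  have "e \<bullet> e = 1" using assms by (simp add: norm_eq_1)
  then have "(norm (u - (u \<bullet> e) *\<^sub>R e))\<^sup>2 = (norm u)\<^sup>2 - (u \<bullet> e)\<^sup>2"
    unfolding power2_norm_eq_inner
    by (simp add: inner_diff_left inner_diff_right power2_eq_square inner_commute[of e u] algebra_simps)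
  then have "(norm (u - (u \<bullet> e) *\<^sub>R e))\<^sup>2 \<le> (norm u)\<^sup>2" by simp
  then show ?thesis by (rule power2_le_imp_le) simp
qed

text \<open>At an interior point small centred kernels do. At a boundary point the shift goes up
  along the axis of the chart, fast enough to beat the slope of the graph; \<open>F\<close> measures
  the height above it.\<close>

lemma ex_inward_shift:
  fixes \<Omega> :: "'a::euclidean_space set"
  assumes \<Omega>: "open \<Omega>" "lipschitz_boundary \<Omega>" and x0: "x0 \<in> closure \<Omega>"
  shows "\<exists>r w. r > 0 \<and> inward_shift \<Omega> x0 r w"
proof (cases "x0 \<in> \<Omega>")
  case True
  then obtain R where R: "R > 0" "cball x0 R \<subseteq> \<Omega>" using \<Omega>(1) open_contains_cball by blast
  have "closure {x. \<exists>y\<in>\<Omega> \<inter> ball x0 (R / 2). x - y \<in> cball (\<delta> *\<^sub>R 0) \<delta>} \<subseteq> \<Omega>" if "\<delta> < R / 2" for \<delta>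
  proof -
    have "{x. \<exists>y\<in>\<Omega> \<inter> ball x0 (R / 2). x - y \<in> cball (\<delta> *\<^sub>R 0) \<delta>} \<subseteq> cball x0 R"
    proof clarsimp
      fix x y assume "dist x0 y * 2 < R" "norm (x - y) \<le> \<delta>"
      then show "dist x0 x \<le> R" using that dist_triangle[of x0 x y] by (simp add: dist_norm norm_minus_commute)
    qed
    then show ?thesis using R(2) closure_minimal[OF _ closed_cball] by blast
  qed
  then have "inward_shift \<Omega> x0 (R / 2) 0" unfolding inward_shift_def using R(1) by (intro exI[of _ "R / 2"]) auto
  then show ?thesis using R(1) by (intro exI[of _ "R / 2"] exI[of _ 0]) auto
next
  case False
  then have "x0 \<in> frontier \<Omega>" using x0 \<Omega>(1) by (simp add: frontier_def interior_open)
  then obtain R e L g where R: "R > 0" and e: "norm e = 1" and g: "L-lipschitz_on {y. y \<bullet> e = 0} g"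
     and \<Omega>R: "\<Omega> \<inter> ball x0 R = {x \<in> ball x0 R. g (x - (x \<bullet> e) *\<^sub>R e) < x \<bullet> e}"
    using \<Omega>(2) unfolding lipschitz_boundary_def by meson
  have ee: "e \<bullet> e = 1" using e by (simp add: norm_eq_1)
  have L: "L \<ge> 0" using g by (rule lipschitz_on_nonneg)
  define F where "F z = z \<bullet> e - g (z - (z \<bullet> e) *\<^sub>R e)" for z
  have Fc: "continuous_on UNIV F"
    unfolding F_def
    by (intro continuous_intros continuous_on_compose2[OF lipschitz_on_continuous_on[OF g]])
       (auto simp: inner_diff_left ee)
  have mem: "z \<in> \<Omega> \<longleftrightarrow> 0 < F z" if "z \<in> ball x0 R" for z
  proof -
    have "z \<in> \<Omega> \<longleftrightarrow> z \<in> \<Omega> \<inter> ball x0 R" using that by blast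
    also have "\<dots> \<longleftrightarrow> 0 < F z" unfolding \<Omega>R using that by (simp add: F_def)
    finally show ?thesis .
  qed
  \<comment> \<open>Of the climb \<open>\<delta> * (L + 2)\<close>, a part
    \<open>\<delta> * L\<close> can be lost to the slope of \<open>g\<close>, a part \<delta> to the
    vertical component of \<open>u\<close>, and \<delta> remains as a margin.\<close>
  define w where "w = (L + 2) *\<^sub>R e"
  \<comment> \<open>The total displacement is at most \<open>\<delta> * (L + 3) \<le> R / 4\<close>,
    so points from the ball of radius \<open>R / 2\<close> stay in the chart.\<close>
  define d where "d = R / (4 * (L + 3))"
  have d: "d > 0" using R L by (simp add: d_def)
  have "closure {x. \<exists>y\<in>\<Omega> \<inter> ball x0 (R / 2). x - y \<in> cball (\<delta> *\<^sub>R w) \<delta>} \<subseteq> \<Omega>" if \<delta>: "0 < \<delta>" "\<delta> < d" for \<delta>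
  proof -
    have \<delta>R: "\<delta> * (L + 3) \<le> R / 4" using \<delta>(2) L by (simp add: d_def field_simps)
    \<comment> \<open>The positive margin makes this set closed and still contained in \<Omega>, so
      it also contains the closure of the shifted set.\<close>
    define S where "S = cball x0 (R * 3 / 4) \<inter> F -` {\<delta>..}"
    have "closed S" unfolding S_def
      by (intro closed_Int closed_cball continuous_closed_vimage) (use Fc in \<open>auto simp: continuous_on_eq_continuous_at\<close>)
    moreover have "{x. \<exists>y\<in>\<Omega> \<inter> ball x0 (R / 2). x - y \<in> cball (\<delta> *\<^sub>R w) \<delta>} \<subseteq> S"
    proof clarify
      fix x y assume y: "y \<in> \<Omega>" "y \<in> ball x0 (R / 2)" and xy: "x - y \<in> cball (\<delta> *\<^sub>R w) \<delta>"
      define u where "u = x - y - \<delta> *\<^sub>R w"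
      have u: "norm u \<le> \<delta>" using xy by (simp add: u_def dist_norm norm_minus_commute)
      have x: "x = y + \<delta> *\<^sub>R w + u" by (simp add: u_def)
      have nw: "norm w = L + 2" using e L by (simp add: w_def)
      have "norm (x - y) \<le> norm (\<delta> *\<^sub>R w) + norm u" unfolding x using norm_triangle_ineq[of "\<delta> *\<^sub>R w" u] by (simp add: add.assoc)
      also have "\<dots> \<le> \<delta> * (L + 3)" using u nw \<delta>(1) by (simp add: algebra_simps)
      finally have "dist x0 x \<le> R * 3 / 4"
        using y(2) dist_triangle[of x0 x y] \<delta>R by (simp add: dist_norm norm_minus_commute)
      moreover have "F x \<ge> \<delta>"
      proof -
        have "y \<in> ball x0 R" using y(2) R by simp
        then have Fy: "F y > 0" using mem y(1) by blast
        have xh: "x - (x \<bullet> e) *\<^sub>R e = (y - (y \<bullet> e) *\<^sub>R e) + (u - (u \<bullet> e) *\<^sub>R e)"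
          by (simp add: x w_def inner_add_left ee algebra_simps)
        have "dist (g (x - (x \<bullet> e) *\<^sub>R e)) (g (y - (y \<bullet> e) *\<^sub>R e)) \<le> L * dist (x - (x \<bullet> e) *\<^sub>R e) (y - (y \<bullet> e) *\<^sub>R e)"
          by (rule lipschitz_onD[OF g]) (auto simp: inner_diff_left ee)
        also have "\<dots> \<le> L * \<delta>"
          using norm_orthogonal_component_le[OF e, of u] u L by (intro mult_left_mono) (auto simp: xh dist_norm)
        finally have "g (x - (x \<bullet> e) *\<^sub>R e) \<le> g (y - (y \<bullet> e) *\<^sub>R e) + L * \<delta>" by (simp add: dist_real_def)
        moreover have "\<bar>u \<bullet> e\<bar> \<le> \<delta>" using Cauchy_Schwarz_ineq2[of u e] e u by simp
        moreover have "x \<bullet> e = y \<bullet> e + \<delta> * (L + 2) + u \<bullet> e" by (simp add: x w_def inner_add_left ee)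
        ultimately show ?thesis using Fy by (simp add: F_def algebra_simps abs_le_iff)
      qed
      ultimately show "x \<in> S" by (simp add: S_def)
    qed
    ultimately have "closure {x. \<exists>y\<in>\<Omega> \<inter> ball x0 (R / 2). x - y \<in> cball (\<delta> *\<^sub>R w) \<delta>} \<subseteq> S"
      by (intro closure_minimal)
    moreover have "S \<subseteq> \<Omega>"
    proof
      fix z assume z: "z \<in> S"
      then have "z \<in> ball x0 R" using R by (simp add: S_def)
      then show "z \<in> \<Omega>" using mem[of z] z \<delta>(1) by (simp add: S_def)
    qed
    ultimately show ?thesis by blast
  qed
  then have "inward_shift \<Omega> x0 (R / 2) w" unfolding inward_shift_def using d by (intro exI[of _ d]) auto
  then show ?thesis using R by (intro exI[of _ "R / 2"] exI[of _ w]) auto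
qed

section \<open>Test functions as competitors\<close>

lemma test_functions_subset_W11_0:
  assumes "open \<Omega>" shows "test_functions \<Omega> \<subseteq> W11_0 \<Omega>"
proof
  fix \<psi> assume \<psi>: "\<psi> \<in> test_functions \<Omega>"
  \<comment> \<open>The constant sequence will do, but even for the zero function the chosen weak
    gradient is known only almost everywhere.\<close>
  have 0: "AE x in lebesgue. x \<in> \<Omega> \<longrightarrow> weak_gradient \<Omega> (\<lambda>x. 0) x = 0"
    by (rule weak_gradient_AE[OF assms C1_grad_has_weak_gradient[OF C1_grad_const]])
  have "(LINT x:\<Omega>|lebesgue. norm (weak_gradient \<Omega> (\<lambda>x. 0) x)) = 0"
    unfolding set_lebesgue_integral_def
    by (rule integral_eq_zero_AE) (use 0 in eventually_elim, auto simp: indicator_def)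
  then have "W11_norm \<Omega> (\<lambda>x. \<psi> x - \<psi> x) = 0"
    by (simp add: W11_norm_def set_lebesgue_integral_def)
  then show "\<psi> \<in> W11_0 \<Omega>"
    using test_functions_W11(6)[OF \<psi>] \<psi> unfolding W11_0_def by (auto intro!: exI[of _ "\<lambda>k. \<psi>"])
qed

lemma holder_space_alt:
  assumes "f \<in> holder_space \<gamma> \<Omega>"
  obtains H where "H \<ge> 0" "\<And>x y. x \<in> \<Omega> \<Longrightarrow> y \<in> \<Omega> \<Longrightarrow> \<bar>f x - f y\<bar> \<le> H * norm (x - y) powr \<gamma>"
proof -
  obtain B where B: "\<And>x y. x \<in> \<Omega> \<Longrightarrow> y \<in> \<Omega> \<Longrightarrow> x \<noteq> y \<Longrightarrow> \<bar>f x - f y\<bar> / norm (x - y) powr \<gamma> \<le> B"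
    using assms unfolding holder_space_def bdd_above_def by blast
  have "\<bar>f x - f y\<bar> \<le> max 0 B * norm (x - y) powr \<gamma>" if "x \<in> \<Omega>" "y \<in> \<Omega>" for x y
  proof (cases "x = y")
    case False
    then have "\<bar>f x - f y\<bar> \<le> B * norm (x - y) powr \<gamma>"
      using B[OF that False] by (simp add: field_simps)
    also have "\<dots> \<le> max 0 B * norm (x - y) powr \<gamma>" by (intro mult_right_mono) auto
    finally show ?thesis .
  qed simp
  then show ?thesis using that[of "max 0 B"] by auto
qed

lemma test_functions_subset_holder_space:
  assumes "0 \<le> \<gamma>" "\<gamma> \<le> 1" shows "test_functions \<Omega> \<subseteq> holder_space \<gamma> \<Omega>"
proof
  fix \<psi> assume \<psi>: "\<psi> \<in> test_functions \<Omega>"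
  obtain S where S: "compact S" "\<And>x. x \<notin> S \<Longrightarrow> \<psi> x = 0" "\<And>x. x \<notin> S \<Longrightarrow> grad \<psi> x = 0"
    and C: "C1_grad \<psi> (grad \<psi>)" using test_functionE[OF \<psi>] by metis
  obtain M1 where M1: "\<And>x. norm (\<psi> x) \<le> M1"
    using bounded_continuous_support[OF C1_grad_continuous[OF C] S(2) compact_imp_bounded[OF S(1)]] by blast
  obtain M2 where M2: "\<And>x. norm (grad \<psi> x) \<le> M2"
    using bounded_continuous_support[OF C1_grad_continuous'[OF C] S(3) compact_imp_bounded[OF S(1)]] by blast
  have "\<bar>\<psi> x - \<psi> y\<bar> \<le> 2 * max M1 M2 * norm (x - y) powr \<gamma>" for x y
    by (rule C1_grad_holder[OF C _ _ assms]) (use M1 M2 in \<open>auto simp: le_max_iff_disj\<close>)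
  then have "\<bar>\<psi> x - \<psi> y\<bar> / norm (x - y) powr \<gamma> \<le> 2 * max M1 M2" if "x \<noteq> y" for x y
    using that by (simp add: divide_le_eq)
  then show "\<psi> \<in> holder_space \<gamma> \<Omega>" unfolding holder_space_def bdd_above_def by blast
qed

section \<open>Approximability of the admissible variations and absence of a gap\<close>

context double_phase
begin

lemma energy_eq_N: "energy p q a \<Omega> u = N (weak_gradient \<Omega> u)"
  unfolding energy_def N_def density_def
  by (rule nn_integral_cong) (simp add: indicator_def)

text \<open>Compactness of the closure yields finitely many balls with inward directions. Half radii
  are used in the cover because a cutoff equals 1 only on the half ball.\<close>

lemma approximable_if_admissible:
  assumes "lipschitz_boundary \<Omega>" "\<Omega> \<noteq> {}" and \<gamma>: "0 \<le> \<gamma>" "\<gamma> \<le> 1" "\<kappa> \<ge> (q - p) * (1 - \<gamma>)"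
    and adm: "admissible \<gamma> v g"
  shows "approximable g"
proof -
  obtain r w where rw: "\<And>x. x \<in> closure \<Omega> \<Longrightarrow> r x > 0 \<and> inward_shift \<Omega> x (r x) (w x)"
    using ex_inward_shift[OF open_\<Omega> assms(1)] by metis
  have "compact (closure \<Omega>)" using bounded_\<Omega> by (simp add: compact_closure)
  moreover have "closure \<Omega> \<subseteq> (\<Union>x\<in>closure \<Omega>. ball x (r x / 2))" using rw by force
  ultimately obtain I where I: "I \<subseteq> closure \<Omega>" "finite I" "closure \<Omega> \<subseteq> (\<Union>x\<in>I. ball x (r x / 2))"
    using compactE_image[of "closure \<Omega>" "closure \<Omega>" "\<lambda>x. ball x (r x / 2)"] by blast
  obtain x1 where x1: "x1 \<in> closure \<Omega>" using assms(2) closure_subset by blast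
  show ?thesis
  proof (rule approximable_finite_cover[OF \<gamma> conjunct2[OF rw[OF x1]] _ _ adm])
    show "finite ((\<lambda>x. (x, r x)) ` I)" using I(2) by simp
    show "r' > 0 \<and> (\<exists>w. inward_shift \<Omega> x r' w)" if "(x, r') \<in> (\<lambda>x. (x, r x)) ` I" for x r'
      using that I(1) rw by blast
    fix x assume "v x \<noteq> 0"
    then have "x \<in> closure \<Omega>" using adm closure_subset unfolding admissible_def by blast
    then obtain y where "y \<in> I" "x \<in> ball y (r y / 2)" using I(3) by blast
    then show "\<exists>(y, r)\<in>(\<lambda>x. (x, r x)) ` I. x \<in> ball y (r / 2)" by auto
  qed
qed

text \<open>The zero extension inherits the Hoelder constant from the boundary decay, and
  boundedness follows because \<Omega> is bounded. So the extension is admissible for the given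
  exponent without truncation.\<close>

lemma approximable_holder:
  assumes lip: "lipschitz_boundary \<Omega>" "\<Omega> \<noteq> {}" and \<gamma>: "0 < \<gamma>" "\<gamma> \<le> 1" "\<kappa> \<ge> (q - p) * (1 - \<gamma>)"
    and \<phi>: "\<phi> \<in> W11_0 \<Omega>" "\<phi> \<in> holder_space \<gamma> \<Omega>" "N (weak_gradient \<Omega> \<phi>) < \<infinity>"
  shows "approximable (\<lambda>x. indicator \<Omega> x *\<^sub>R weak_gradient \<Omega> \<phi> x)"
proof (rule approximable_if_admissible[OF lip])
  obtain H where H: "H \<ge> 0" "\<And>x y. x \<in> \<Omega> \<Longrightarrow> y \<in> \<Omega> \<Longrightarrow> \<bar>\<phi> x - \<phi> y\<bar> \<le> H * norm (x - y) powr \<gamma>"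
    using holder_space_alt[OF \<phi>(2)] by blast
  note bd = holder_W11_0_boundary[OF open_\<Omega> lip(1) \<phi>(1) H(2) H(1) \<gamma>(1)]
  let ?v = "\<lambda>x. indicator \<Omega> x * \<phi> x"
  obtain y0 where y0: "y0 \<in> \<Omega>" using lip(2) by blast
  obtain R where R: "\<And>x y. x \<in> \<Omega> \<Longrightarrow> y \<in> \<Omega> \<Longrightarrow> dist x y \<le> R" using bounded_\<Omega> bounded_two_points by metis
  have "\<bar>?v x\<bar> \<le> \<bar>\<phi> y0\<bar> + H * R powr \<gamma>" for x
  proof (cases "x \<in> \<Omega>")
    case True
    have "norm (x - y0) powr \<gamma> \<le> R powr \<gamma>" using R[OF True y0] \<gamma> by (intro powr_mono2) (auto simp: dist_norm)
    then have "H * norm (x - y0) powr \<gamma> \<le> H * R powr \<gamma>" using H(1) by (rule mult_left_mono)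
    then show ?thesis using H(2)[OF True y0] True by simp
  qed (use H in auto)
  \<comment> \<open>If exactly one of the points lies in \<Omega>, the increment is the value at
    that point, and \<open>bd\<close> bounds it by the distance to the other point.\<close>
  moreover have "\<bar>?v x - ?v y\<bar> \<le> H * norm (x - y) powr \<gamma>" for x y
    using bd[of x y] bd[of y x] H by (cases "x \<in> \<Omega>"; cases "y \<in> \<Omega>") (auto simp: norm_minus_commute)
  moreover have "global_weak_gradient ?v (\<lambda>x. indicator \<Omega> x *\<^sub>R weak_gradient \<Omega> \<phi> x)"
    using W11_0_chain[OF open_\<Omega> \<phi>(1), of "\<lambda>s. s" "\<lambda>s. 1" 1] by simp
  moreover have "N (\<lambda>x. indicator \<Omega> x *\<^sub>R weak_gradient \<Omega> \<phi> x) = N (weak_gradient \<Omega> \<phi>)" by (rule N_cong) simp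
  ultimately show "admissible \<gamma> ?v (\<lambda>x. indicator \<Omega> x *\<^sub>R weak_gradient \<Omega> \<phi> x)"
    unfolding admissible_def using \<phi>(3) H(1) by auto
qed (use \<gamma> in auto)

text \<open>Truncations of \<phi> are bounded, hence admissible with exponent 0, and their gradients
  converge to that of \<phi> in the modular.\<close>

lemma approximable_W11_0:
  assumes lip: "lipschitz_boundary \<Omega>" "\<Omega> \<noteq> {}" and \<kappa>: "\<kappa> \<ge> q - p"
    and \<phi>: "\<phi> \<in> W11_0 \<Omega>" "N (weak_gradient \<Omega> \<phi>) < \<infinity>"
  shows "approximable (\<lambda>x. indicator \<Omega> x *\<^sub>R weak_gradient \<Omega> \<phi> x)"
proof (rule approximable_perturb)
  define G where "G x = indicator \<Omega> x *\<^sub>R weak_gradient \<Omega> \<phi> x" for x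
  have \<phi>W: "\<phi> \<in> W11 \<Omega>" using \<phi> by (simp add: W11_0_def)
  have Gi: "integrable lebesgue G" unfolding G_def by (rule W11_weak_gradient_integrable(3)[OF open_\<Omega> \<phi>W])
  then show "(\<lambda>x. indicator \<Omega> x *\<^sub>R weak_gradient \<Omega> \<phi> x) \<in> borel_measurable lebesgue"
    unfolding G_def by (rule borel_measurable_integrable)
  have [measurable]: "G \<in> borel_measurable lebesgue" using Gi by simp
  have NG: "N G < \<infinity>"
  proof -
    have "N G = N (weak_gradient \<Omega> \<phi>)" unfolding G_def by (rule N_cong) simp
    then show ?thesis using \<phi>(2) by simp
  qed
  \<comment> \<open>A C1 truncation at height of order \<open>n + 1\<close>: its slope
    \<open>T'\<close> lies between 0 and 1 and tends to 1 pointwise. The chain rule therefore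
    applies, and the energy density of \<open>G\<close> dominates that of the error.\<close>
  define T where "T n s = real (Suc n) * arctan (s / real (Suc n))" for n s
  define T' where "T' n s = inverse (1 + (s / real (Suc n))\<^sup>2)" for n s
  have T: "(T n has_real_derivative T' n s) (at s)" for n s
    unfolding T_def T'_def by (auto intro!: derivative_eq_intros simp del: of_nat_Suc)
  have T'01: "0 < T' n s" "T' n s \<le> 1" for n s
  proof -
    have "0 < 1 + (s / real (Suc n))\<^sup>2" by (simp add: add_pos_nonneg)
    then show "0 < T' n s" "T' n s \<le> 1" by (auto simp: T'_def inverse_le_1_iff)
  qed
  have T'c: "continuous_on UNIV (T' n)" for n
  proof -
    have "1 + (s / real (Suc n))\<^sup>2 \<noteq> 0" for s :: real by (metis add_pos_nonneg less_irrefl zero_le_power2 zero_less_one)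
    then show ?thesis unfolding T'_def by (intro continuous_intros) auto
  qed
  define g where "g n x = indicator \<Omega> x *\<^sub>R T' n (\<phi> x) *\<^sub>R weak_gradient \<Omega> \<phi> x" for n x
  have gG: "g n x = (indicator \<Omega> x * T' n (\<phi> x)) *\<^sub>R G x" for n x by (simp add: g_def G_def indicator_def)
  have chain: "global_weak_gradient (\<lambda>x. indicator \<Omega> x * T n (\<phi> x)) (g n)" for n
    unfolding g_def by (rule W11_0_chain[OF open_\<Omega> \<phi>(1) T T'c, where M=1]) (use T'01 in \<open>auto simp: T_def less_imp_le\<close>)
  then have gm [measurable]: "g n \<in> borel_measurable lebesgue" for n
    unfolding global_weak_gradient_def by (blast intro: borel_measurable_integrable)
  have c1: "\<bar>indicator \<Omega> x * T' n (\<phi> x)\<bar> \<le> 1" for n x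
    using T'01[of n "\<phi> x"] by (simp add: indicator_def)
  have adm: "admissible 0 (\<lambda>x. indicator \<Omega> x * T n (\<phi> x)) (g n)" for n
  proof -
    have "N (g n) \<le> ennreal (max 1 1 powr q) * N G"
      unfolding gG by (rule N_scale_le) (use c1 in auto)
    then have Ng: "N (g n) < \<infinity>" using NG by (simp add: le_less_trans)
    have Tb: "\<bar>indicator \<Omega> x * T n (\<phi> x)\<bar> \<le> real (Suc n) * 2" for x
    proof -
      have "\<bar>arctan (\<phi> x / real (Suc n))\<bar> \<le> 2"
        using arctan_bounded[of "\<phi> x / real (Suc n)"] pi_less_4 by linarith
      then have "real (Suc n) * \<bar>arctan (\<phi> x / real (Suc n))\<bar> \<le> real (Suc n) * 2" by (intro mult_left_mono) auto
      then show ?thesis by (simp add: T_def abs_mult indicator_def del: of_nat_Suc)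
    qed
    have Td: "\<bar>indicator \<Omega> x * T n (\<phi> x) - indicator \<Omega> y * T n (\<phi> y)\<bar> \<le> (real (Suc n) * 4) * norm (x - y) powr 0" for x y
      using Tb[of x] Tb[of y] by (cases "x = y") (auto simp: abs_le_iff)
    show ?thesis
      unfolding admissible_def
    proof (intro conjI)
      show "\<exists>H\<ge>0. \<forall>x y. \<bar>indicator \<Omega> x * T n (\<phi> x) - indicator \<Omega> y * T n (\<phi> y)\<bar> \<le> H * norm (x - y) powr 0"
        using Td by (intro exI[of _ "real (Suc n) * 4"] conjI allI) simp_all
      show "\<exists>B. \<forall>x. \<bar>indicator \<Omega> x * T n (\<phi> x)\<bar> \<le> B" using Tb by blast
    qed (use chain Ng in \<open>auto simp: g_def\<close>)
  qed
  have "(\<lambda>n. N (\<lambda>x. g n x - G x)) \<longlonglongrightarrow> (\<integral>\<^sup>+x. 0 \<partial>(lebesgue :: 'a measure))"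
    unfolding N_def
  proof (rule nn_integral_dominated_convergence[where w="\<lambda>x. ennreal (density x (G x))"])
    show "(\<integral>\<^sup>+x. ennreal (density x (G x)) \<partial>lebesgue) < \<infinity>" using NG by (simp add: N_def)
    show "AE x in lebesgue. ennreal (density x (g n x - G x)) \<le> ennreal (density x (G x))" for n
    proof (intro AE_I2 ennreal_leI density_mono)
      fix x
      have "g n x - G x = (indicator \<Omega> x * T' n (\<phi> x) - 1) *\<^sub>R G x" by (simp add: gG algebra_simps)
      also have "norm \<dots> \<le> 1 * norm (G x)"
        unfolding norm_scaleR using T'01[of n "\<phi> x"] by (intro mult_right_mono) (auto simp: indicator_def)
      finally show "norm (g n x - G x) \<le> norm (G x)" by simp
    qed
    show "AE x in lebesgue. (\<lambda>n. ennreal (density x (g n x - G x))) \<longlonglongrightarrow> 0"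
    proof (rule AE_I2)
      fix x
      have "(\<lambda>n. \<phi> x * inverse (real (Suc n))) \<longlonglongrightarrow> \<phi> x * 0"
        by (intro tendsto_intros LIMSEQ_inverse_real_of_nat)
      then have "(\<lambda>n. \<phi> x / real (Suc n)) \<longlonglongrightarrow> 0" by (simp add: divide_inverse del: of_nat_Suc)
      then have "(\<lambda>n. T' n (\<phi> x)) \<longlonglongrightarrow> inverse (1 + 0\<^sup>2)"
        unfolding T'_def by (intro tendsto_intros) auto
      then have "(\<lambda>n. g n x - G x) \<longlonglongrightarrow> indicator \<Omega> x *\<^sub>R inverse (1 + 0\<^sup>2) *\<^sub>R weak_gradient \<Omega> \<phi> x - G x"
        unfolding g_def by (intro tendsto_intros)
      then have "(\<lambda>n. g n x - G x) \<longlonglongrightarrow> 0" by (simp add: G_def)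
      then have "(\<lambda>n. density x (g n x - G x)) \<longlonglongrightarrow> 0" by (rule density_tendsto_0)
      then show "(\<lambda>n. ennreal (density x (g n x - G x))) \<longlonglongrightarrow> 0" using tendsto_ennrealI by fastforce
    qed
  qed measurable
  then have lim: "(\<lambda>n. N (\<lambda>x. g n x - G x)) \<longlonglongrightarrow> 0" by simp
  fix \<epsilon> :: real assume "\<epsilon> > 0"
  then have "\<forall>\<^sub>F n in sequentially. N (\<lambda>x. g n x - G x) < ennreal \<epsilon>"
    by (intro order_tendstoD(2)[OF lim]) auto
  then obtain n where "N (\<lambda>x. g n x - G x) < ennreal \<epsilon>"
    using eventually_happens'[OF sequentially_bot] by blast
  moreover have "approximable (g n)"
    \<comment> \<open>For exponent 0 the condition on \<kappa> reads
      \<open>\<kappa> \<ge> (q - p) * (1 - 0)\<close>.\<close>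
    by (rule approximable_if_admissible[OF lip _ _ _ adm]) (use \<kappa> in auto)
  ultimately show "\<exists>g'. approximable g' \<and> g' \<in> borel_measurable lebesgue \<and>
      N (\<lambda>x. g' x - indicator \<Omega> x *\<^sub>R weak_gradient \<Omega> \<phi> x) \<le> ennreal \<epsilon>"
    using gm[of n] unfolding G_def by (intro exI[of _ "g n"]) auto
qed

lemma test_functions_subset_energy_space: "test_functions \<Omega> \<subseteq> energy_space p q a \<Omega>"
proof
  fix \<psi> assume \<psi>: "\<psi> \<in> test_functions \<Omega>"
  obtain S where S: "compact S" "\<And>x. x \<notin> S \<Longrightarrow> grad \<psi> x = 0"
    and C: "C1_grad \<psi> (grad \<psi>)" using test_functionE[OF \<psi>] by metis
  obtain M where M: "\<And>x. norm (grad \<psi> x) \<le> M"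
    using bounded_continuous_support[OF C1_grad_continuous'[OF C] S(2) compact_imp_bounded[OF S(1)]] by blast
  have "N (weak_gradient \<Omega> \<psi>) = N (grad \<psi>)"
    by (rule N_cong_AE[OF weak_gradient_AE[OF open_\<Omega> test_functions_W11(1)[OF \<psi>]]])
  also have "\<dots> < \<infinity>" by (rule N_bounded_finite[OF M])
  finally show "\<psi> \<in> energy_space p q a \<Omega>"
    using test_functions_subset_W11_0[OF open_\<Omega>] \<psi> by (auto simp: energy_space_def energy_eq_N)
qed

lemma energy_add:
  assumes u: "u \<in> W11 \<Omega>" and v: "v \<in> W11 \<Omega>"
  shows "energy p q a \<Omega> (\<lambda>x. u x + v x) =
    N (\<lambda>x. indicator \<Omega> x *\<^sub>R weak_gradient \<Omega> u x + indicator \<Omega> x *\<^sub>R weak_gradient \<Omega> v x)"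
proof -
  note w = has_weak_gradient_add[OF W11_weak_gradient_integrable(1)[OF open_\<Omega> u] W11_weak_gradient_integrable(1)[OF open_\<Omega> v]]
  show ?thesis unfolding energy_eq_N
    by (rule N_cong_AE) (use weak_gradient_AE[OF open_\<Omega> w] in eventually_elim, simp)
qed

text \<open>One inequality is inclusion of classes. For the other, the gradient of the smooth
  competitor is the gradient of \<open>u\<^sub>0 x + \<phi> x\<close> plus the error
  \<open>grad \<psi> x - G x\<close>; the convex splitting with weights \<open>1 - l\<close> and
  \<open>l\<close> turns smallness of the error in the modular into an estimate of energies.\<close>

lemma no_energy_gap:
  assumes u: "u\<^sub>0 \<in> W11 \<Omega>" and X: "X \<subseteq> W11_0 \<Omega>" "test_functions \<Omega> \<subseteq> X"
    and app: "\<And>\<phi>. \<phi> \<in> X \<Longrightarrow> approximable (\<lambda>x. indicator \<Omega> x *\<^sub>R weak_gradient \<Omega> \<phi> x)"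
  shows "(INF v\<in>affine_class u\<^sub>0 X. energy p q a \<Omega> v) = (INF w\<in>affine_class u\<^sub>0 (test_functions \<Omega>). energy p q a \<Omega> w)"
proof (rule antisym)
  show "(INF v\<in>affine_class u\<^sub>0 X. energy p q a \<Omega> v) \<le> (INF w\<in>affine_class u\<^sub>0 (test_functions \<Omega>). energy p q a \<Omega> w)"
    by (rule INF_superset_mono) (use X(2) in \<open>auto simp: affine_class_def\<close>)
  define I where "I = (INF w\<in>affine_class u\<^sub>0 (test_functions \<Omega>). energy p q a \<Omega> w)"
  have "I \<le> energy p q a \<Omega> (\<lambda>x. u\<^sub>0 x + \<phi> x)" if \<phi>: "\<phi> \<in> X" for \<phi>
  proof (cases "energy p q a \<Omega> (\<lambda>x. u\<^sub>0 x + \<phi> x) = \<infinity>")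
    case False
    define G0 where "G0 x = indicator \<Omega> x *\<^sub>R weak_gradient \<Omega> u\<^sub>0 x" for x
    define G where "G x = indicator \<Omega> x *\<^sub>R weak_gradient \<Omega> \<phi> x" for x
    have \<phi>W: "\<phi> \<in> W11 \<Omega>" using \<phi> X(1) by (auto simp: W11_0_def)
    have [measurable]: "G0 \<in> borel_measurable lebesgue" "G \<in> borel_measurable lebesgue"
      using W11_weak_gradient_integrable(3)[OF open_\<Omega> u] W11_weak_gradient_integrable(3)[OF open_\<Omega> \<phi>W]
      unfolding G0_def G_def by (auto dest: borel_measurable_integrable)
    define E where "E = N (\<lambda>x. G0 x + G x)"
    have E: "energy p q a \<Omega> (\<lambda>x. u\<^sub>0 x + \<phi> x) = E" unfolding E_def G0_def G_def by (rule energy_add[OF u \<phi>W])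
    \<comment> \<open>The error is sent to zero with \<open>l\<close> fixed, because its factor
      \<open>l powr (1 - q)\<close> blows up as \<open>l\<close> tends to 0; only afterwards does
      \<open>l\<close> tend to 0.\<close>
    have le: "I \<le> ennreal ((1 - l) powr (1 - q)) * E" if l: "0 < l" "l < 1" for l
    proof (rule ennreal_le_epsilon)
      fix e :: real assume e: "0 < e"
      define c where "c = l powr (1 - q)"
      have c: "c > 0" using l by (simp add: c_def)
      obtain \<psi> where \<psi>: "\<psi> \<in> test_functions \<Omega>" and small: "N (\<lambda>x. grad \<psi> x - G x) \<le> ennreal (e / c)"
        using app[OF \<phi>] e c unfolding approximable_def G_def by (meson divide_pos_pos)
      note t = test_functions_W11[OF \<psi>]
      have [measurable]: "grad \<psi> \<in> borel_measurable lebesgue" using t(3) by simp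
      have "I \<le> energy p q a \<Omega> (\<lambda>x. u\<^sub>0 x + \<psi> x)"
        unfolding I_def by (rule INF_lower) (use \<psi> in \<open>auto simp: affine_class_def\<close>)
      also have "\<dots> = N (\<lambda>x. G0 x + indicator \<Omega> x *\<^sub>R weak_gradient \<Omega> \<psi> x)"
        unfolding G0_def by (rule energy_add[OF u t(6)])
      also have "\<dots> = N (\<lambda>x. (G0 x + G x) + (grad \<psi> x - G x))"
        by (rule N_cong_AE) (use weak_gradient_AE[OF open_\<Omega> t(1)] in eventually_elim, simp)
      also have "\<dots> \<le> ennreal ((1 - l) powr (1 - q)) * E + ennreal c * N (\<lambda>x. grad \<psi> x - G x)"
        unfolding E_def c_def by (rule N_add_le) (use l in auto)
      also have "\<dots> \<le> ennreal ((1 - l) powr (1 - q)) * E + ennreal c * ennreal (e / c)"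
        by (intro add_left_mono mult_left_mono small) auto
      also have "ennreal c * ennreal (e / c) = ennreal e" using c e by (simp flip: ennreal_mult)
      finally show "I \<le> ennreal ((1 - l) powr (1 - q)) * E + ennreal e" .
    qed
    obtain E' where E': "E = ennreal E'" "E' \<ge> 0" using False E by (cases E) auto
    \<comment> \<open>The weights are \<open>1 / (n + 2)\<close>: the double \<open>Suc\<close>
      keeps them strictly below 1 already for \<open>n = 0\<close>.\<close>
    have l0: "(\<lambda>n. inverse (real (Suc (Suc n)))) \<longlonglongrightarrow> 0"
      using LIMSEQ_Suc[OF LIMSEQ_inverse_real_of_nat] by simp
    then have "(\<lambda>n. (1 - inverse (real (Suc (Suc n)))) powr (1 - q) * E') \<longlonglongrightarrow> (1 - 0) powr (1 - q) * E'"
      by (intro tendsto_intros) auto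
    then have lim: "(\<lambda>n. ennreal ((1 - inverse (real (Suc (Suc n)))) powr (1 - q) * E')) \<longlonglongrightarrow> E"
      using tendsto_ennrealI unfolding E'(1) by fastforce
    have "I \<le> E"
    proof (rule LIMSEQ_le_const[OF lim], intro exI allI impI)
      fix n :: nat
      show "I \<le> ennreal ((1 - inverse (real (Suc (Suc n)))) powr (1 - q) * E')"
        using le[of "inverse (real (Suc (Suc n)))"] E'(2) by (simp add: E'(1) ennreal_mult inverse_less_1_iff del: of_nat_Suc)
    qed
    then show ?thesis using E by simp
  qed simp
  then show "I \<le> (INF v\<in>affine_class u\<^sub>0 X. energy p q a \<Omega> v)"
    by (intro INF_greatest) (auto simp: affine_class_def)
qed

end

theorem theorem4:
  fixes \<Omega> :: "(real ^ 'n) set"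
    and a u\<^sub>0 :: "real ^ 'n \<Rightarrow> real"
    and p q \<kappa> :: real
  assumes "CARD('n) \<ge> 2"
    and "bounded_lipschitz_domain \<Omega>"
    and "1 < p" and "p < q"
    and "\<kappa> > 0"
    and "a \<in> Z_class \<kappa> \<Omega>"
    and "u\<^sub>0 \<in> W11 \<Omega>"
    and "energy p q a \<Omega> u\<^sub>0 < \<infinity>"
  shows "(\<kappa> \<ge> q - p \<longrightarrow>
           (INF v\<in>affine_class u\<^sub>0 (energy_space p q a \<Omega>). energy p q a \<Omega> v) =
           (INF w\<in>affine_class u\<^sub>0 (test_functions \<Omega>). energy p q a \<Omega> w)) \<and>
         (\<forall>\<gamma>. 0 < \<gamma> \<and> \<gamma> \<le> 1 \<and> \<kappa> \<ge> (q - p) * (1 - \<gamma>) \<longrightarrow>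
           (INF v\<in>affine_class u\<^sub>0 (energy_space p q a \<Omega> \<inter> holder_space \<gamma> \<Omega>). energy p q a \<Omega> v) =
           (INF w\<in>affine_class u\<^sub>0 (test_functions \<Omega>). energy p q a \<Omega> w))"
proof -
  have \<Omega>: "\<Omega> \<noteq> {}" "open \<Omega>" "bounded \<Omega>" and lip: "lipschitz_boundary \<Omega>"
    using assms(2) by (auto simp: bounded_lipschitz_domain_def)
  obtain C where C: "C > 0" "\<forall>x\<in>\<Omega>. \<forall>y\<in>\<Omega>. a x \<le> C * (a y + norm (x - y) powr \<kappa>)"
    and am: "a \<in> borel_measurable (lebesgue_on \<Omega>)" and a0: "\<forall>x\<in>\<Omega>. 0 \<le> a x"
    using assms(6) by (auto simp: Z_class_def)
  \<comment> \<open>Measurability on the restricted space becomes measurability of the zero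
    extension, the form in which the weight enters \<open>density\<close>.\<close>
  have am': "(\<lambda>x. indicator \<Omega> x * a x) \<in> borel_measurable lebesgue"
    using am \<Omega>(2) borel_measurable_restrict_space_iff[of \<Omega> lebesgue a] by (simp add: mult.commute)
  interpret double_phase \<Omega> a p q \<kappa> C
    by unfold_locales (use \<Omega> am' a0 C assms in auto)
  have part1: "(INF v\<in>affine_class u\<^sub>0 (energy_space p q a \<Omega>). energy p q a \<Omega> v) =
           (INF w\<in>affine_class u\<^sub>0 (test_functions \<Omega>). energy p q a \<Omega> w)" if "\<kappa> \<ge> q - p"
    using assms(7)
    by (rule no_energy_gap)
       (use approximable_W11_0[OF lip \<Omega>(1) that] test_functions_subset_energy_space in \<open>auto simp: energy_space_def energy_eq_N\<close>)
  have part2: "(INF v\<in>affine_class u\<^sub>0 (energy_space p q a \<Omega> \<inter> holder_space \<gamma> \<Omega>). energy p q a \<Omega> v) =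
           (INF w\<in>affine_class u\<^sub>0 (test_functions \<Omega>). energy p q a \<Omega> w)"
    if "0 < \<gamma> \<and> \<gamma> \<le> 1 \<and> \<kappa> \<ge> (q - p) * (1 - \<gamma>)" for \<gamma>
    using assms(7)
  proof (rule no_energy_gap)
    show "test_functions \<Omega> \<subseteq> energy_space p q a \<Omega> \<inter> holder_space \<gamma> \<Omega>"
      using test_functions_subset_energy_space test_functions_subset_holder_space[of \<gamma> \<Omega>] that by auto
    show "approximable (\<lambda>x. indicator \<Omega> x *\<^sub>R weak_gradient \<Omega> \<phi> x)" if \<phi>: "\<phi> \<in> energy_space p q a \<Omega> \<inter> holder_space \<gamma> \<Omega>" for \<phi>
      by (rule approximable_holder[OF lip \<Omega>(1)])
         (use \<phi> \<open>0 < \<gamma> \<and> \<gamma> \<le> 1 \<and> \<kappa> \<ge> (q - p) * (1 - \<gamma>)\<close> in \<open>auto simp: energy_space_def energy_eq_N\<close>)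
  qed (auto simp: energy_space_def)
  show ?thesis using part1 part2 by blast
qed

end
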